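(* Let $E_1\to M$ and $E_2\to M$ be Lie algebroids over the same manifold $M$ and let $\kappa:E_1\to E_2$ be a Lie algebroid morphism covering the identity of $M$. For $\mathrm{div}_{E_1}\in\mathrm{Div}_0(E_1)$ and $\mathrm{div}_{E_2}\in\mathrm{Div}_0(E_2)$ let $\phi\in\mathrm{Sec}(E_1^* )$ be the 1-form defined by $$\kappa^*(\mathrm{div}_{E_2})-\mathrm{div}_{E_1}=i_\phi .$$ Then the cohomology class $\mathrm{Mod}(\kappa)=[\phi]\in H^1(E_1,d_{E_1})$ is well defined, independently of the choice of $\mathrm{div}_{E_1}\in\mathrm{Div}_0(E_1)$ and $\mathrm{div}_{E_2}\in\mathrm{Div}_0(E_2)$.
   Context: All objects are smooth. For a Lie algebroid $E\to M$ with anchor $\rho$, $d_E$ denotes the Lie algebroid de Rham differential on $\mathcal A(E^* )=\bigoplus_i\mathrm{Sec}(\bigwedge^iE^* )$ and $H^*(E,d_E)$ its cohomology. $\mathrm{Div}(E)$ is the set of linear maps $\mathrm{div}:\mathrm{Sec}(E)\to C^\infty(M)$ with $\mathrm{div}(fX)=f\,\mathrm{div}(X)+\rho(X)(f)$ and $\mathrm{div}([X,Y])=\rho(X)(\mathrm{div}(Y))-\rho(Y)(\mathrm{div}(X))$. $|\mathrm{Vol}|_E=(\bigwedge^{\mathrm{top}}E^*\setminus 0)/\mathbb Z_2$, with $\mathbb Z_2$ acting by $\mu\mapsto-\mu$ on the line bundle with zero section removed. A section $|\mu|$ is given locally by unordered pairs $\{\mu_U,-\mu_U\}$ of nowhere-vanishing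 local sections of $\bigwedge^{\mathrm{top}}E^*$ agreeing on overlaps; global sections always exist. Each $|\mu|$ gives a divergence $\mathrm{div}_{|\mu|}\in\mathrm{Div}(E)$ by $\mathcal L_X\mu=\mathrm{div}_{|\mu|}(X)\,\mu$ for local representatives $\mu$ of $|\mu|$, where $\mathcal L_X=d_E\,i_X+i_X\,d_E$ for $X\in\mathrm{Sec}(E)$. $\mathrm{Div}_0(E)=\{\mathrm{div}_{|\mu|}:|\mu|\in\mathrm{Sec}(|\mathrm{Vol}|_E)\}$. For a base-preserving Lie algebroid morphism $\kappa:E_1\to E_2$, $\kappa^*:\mathrm{Div}(E_2)\to\mathrm{Div}(E_1)$ is $\kappa^*(\mathrm{div}_2)(X)=\mathrm{div}_2(\kappa(X))$. For a 1-form $\phi\in\mathrm{Sec}(E_1^* )$, $i_\phi$ is the map $X\mapsto\langle X,\phi\rangle$ on $\mathrm{Sec}(E_1)$. *)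

theory Defs
  imports "HOL-Analysis.Analysis"
begin

section \<open>Smooth manifolds\<close>

text \<open>
  Coordinates of $\mathbb R^n$ are indexed by \<open>{..<n}\<close> inside the type \<^typ>\<open>nat \<Rightarrow> real\<close>, as in
  \<^const>\<open>Euclidean_space\<close>; in this way the dimension may be any natural number, zero included.
\<close>

definition partial :: "nat \<Rightarrow> ((nat \<Rightarrow> real) \<Rightarrow> real) \<Rightarrow> (nat \<Rightarrow> real) \<Rightarrow> real" where
  "partial i f x = deriv (\<lambda>t. f (x(i := t))) (x i)"

fun Ck_on :: "nat \<Rightarrow> nat \<Rightarrow> (nat \<Rightarrow> real) set \<Rightarrow> ((nat \<Rightarrow> real) \<Rightarrow> real) \<Rightarrow> bool" where
  "Ck_on n 0 V f \<longleftrightarrow> continuous_on V f"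
| "Ck_on n (Suc k) V f \<longleftrightarrow> continuous_on V f \<and>
     (\<forall>i<n. (\<forall>x\<in>V. (\<lambda>t. f (x(i := t))) field_differentiable at (x i)) \<and>
            Ck_on n k V (partial i f))"

definition Cinf_on :: "nat \<Rightarrow> (nat \<Rightarrow> real) set \<Rightarrow> ((nat \<Rightarrow> real) \<Rightarrow> real) \<Rightarrow> bool" where
  "Cinf_on n V f \<longleftrightarrow> (\<forall>k. Ck_on n k V f)"

text \<open>
  The underlying topological space of a manifold is a whole type \<open>'m\<close>. A chart is a pair
  \<open>(U, x)\<close> of its domain and its coordinate map.
\<close>

record 'm smooth_structure =
  mdim :: nat
  charts :: "('m set \<times> ('m \<Rightarrow> nat \<Rightarrow> real)) set"

definition smooth_manifold ::
  "'m::{t2_space, second_countable_topology} smooth_structure \<Rightarrow> bool" where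
  "smooth_manifold M \<longleftrightarrow>
     (\<Union>(U, x)\<in>charts M. U) = UNIV \<and>
     (\<forall>(U, x)\<in>charts M. open U \<and> openin (Euclidean_space (mdim M)) (x ` U) \<and>
        (\<exists>y. homeomorphism U (x ` U) x y)) \<and>
     (\<forall>(U, x)\<in>charts M. \<forall>(V, y)\<in>charts M. \<forall>i<mdim M.
        Cinf_on (mdim M) (x ` (U \<inter> V)) (\<lambda>z. y (the_inv_into U x z) i))"

definition smooth_fun :: "'m smooth_structure \<Rightarrow> 'm set \<Rightarrow> ('m \<Rightarrow> real) \<Rightarrow> bool" where
  "smooth_fun M W f \<longleftrightarrow>
     (\<forall>(U, x)\<in>charts M. Cinf_on (mdim M) (x ` (U \<inter> W)) (\<lambda>z. f (the_inv_into U x z)))"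

definition smooth_near ::
  "'m::topological_space smooth_structure \<Rightarrow> 'm \<Rightarrow> ('m \<Rightarrow> real) \<Rightarrow> bool" where
  "smooth_near M p f \<longleftrightarrow> (\<exists>W. open W \<and> p \<in> W \<and> smooth_fun M W f)"

text \<open>
  Tangent vectors at \<open>p\<close> are derivations of the algebra of germs at \<open>p\<close> of smooth functions. They
  are represented as functionals on all functions, being zero (by convention) on those which are
  not smooth near \<open>p\<close>.
\<close>

definition tangent_space ::
  "'m::topological_space smooth_structure \<Rightarrow> 'm \<Rightarrow> (('m \<Rightarrow> real) \<Rightarrow> real) set" where
  "tangent_space M p = {D.
     (\<forall>f. \<not> smooth_near M p f \<longrightarrow> D f = 0) \<and>
     (\<forall>f g. smooth_near M p f \<and> smooth_near M p g \<and> (\<forall>\<^sub>F q in nhds p. f q = g q) \<longrightarrow> D f = D g) \<and>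
     (\<forall>f g a b. smooth_near M p f \<and> smooth_near M p g \<longrightarrow>
        D (\<lambda>q. a * f q + b * g q) = a * D f + b * D g) \<and>
     (\<forall>f g. smooth_near M p f \<and> smooth_near M p g \<longrightarrow>
        D (\<lambda>q. f q * g q) = D f * g p + f p * D g)}"


section \<open>Vector bundles and their exterior forms\<close>

text \<open>
  The fibres are linear subspaces of an arbitrary real vector space \<open>'v\<close>. A local trivialisation
  $U \times \mathbb R^r \to E|_U$, $(p, c) \mapsto \sum_i c_i e_i(p)$, is given by its domain \<open>U\<close>
  and the corresponding local frame \<open>e\<close>.
\<close>

record ('m, 'v) vbundle =
  rank :: nat
  fibre :: "'m \<Rightarrow> 'v set"
  frames :: "('m set \<times> (nat \<Rightarrow> 'm \<Rightarrow> 'v)) set"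

definition sections ::
  "'m smooth_structure \<Rightarrow> ('m, 'v::real_vector, 'z) vbundle_scheme \<Rightarrow> 'm set \<Rightarrow> ('m \<Rightarrow> 'v) set" where
  "sections M E U = {X. (\<forall>p\<in>U. X p \<in> fibre E p) \<and>
     (\<forall>(W, e)\<in>frames E. \<exists>c. (\<forall>i<rank E. smooth_fun M (U \<inter> W) (c i)) \<and>
        (\<forall>p\<in>U \<inter> W. X p = (\<Sum>i<rank E. c i p *\<^sub>R e i p)))}"

abbreviation Sec ::
  "'m smooth_structure \<Rightarrow> ('m, 'v::real_vector, 'z) vbundle_scheme \<Rightarrow> ('m \<Rightarrow> 'v) set" where
  "Sec M E \<equiv> sections M E UNIV"

definition vector_bundle ::
  "'m::topological_space smooth_structure \<Rightarrow> ('m, 'v::real_vector, 'z) vbundle_scheme \<Rightarrow> bool" where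
  "vector_bundle M E \<longleftrightarrow>
     (\<Union>(U, e)\<in>frames E. U) = UNIV \<and>
     (\<forall>(U, e)\<in>frames E. open U \<and>
        (\<forall>p\<in>U. inj_on (\<lambda>i. e i p) {..<rank E} \<and>
               independent ((\<lambda>i. e i p) ` {..<rank E}) \<and>
               span ((\<lambda>i. e i p) ` {..<rank E}) = fibre E p) \<and>
        (\<forall>i<rank E. e i \<in> sections M E U))"

text \<open>
  An alternating \<open>k\<close>-linear form on the subspace \<open>V\<close> is a function of lists, with value zero (by
  convention) on everything but lists of \<open>k\<close> elements of \<open>V\<close>.
\<close>

definition alternating_forms :: "nat \<Rightarrow> 'v::real_vector set \<Rightarrow> ('v list \<Rightarrow> real) set" where
  "alternating_forms k V = {\<alpha>.
     (\<forall>vs. \<not> (length vs = k \<and> set vs \<subseteq> V) \<longrightarrow> \<alpha> vs = 0) \<and>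
     (\<forall>vs i u v a b. length vs = k \<and> set vs \<subseteq> V \<and> i < k \<and> u \<in> V \<and> v \<in> V \<longrightarrow>
        \<alpha> (vs[i := a *\<^sub>R u + b *\<^sub>R v]) = a * \<alpha> (vs[i := u]) + b * \<alpha> (vs[i := v])) \<and>
     (\<forall>vs. \<not> distinct vs \<longrightarrow> \<alpha> vs = 0)}"

text \<open>Smooth sections over \<open>U\<close> of $\bigwedge^k E^*$.\<close>

definition forms ::
  "'m smooth_structure \<Rightarrow> ('m, 'v::real_vector, 'z) vbundle_scheme \<Rightarrow> nat \<Rightarrow> 'm set
     \<Rightarrow> ('m \<Rightarrow> 'v list \<Rightarrow> real) set" where
  "forms M E k U = {\<omega>. (\<forall>p\<in>U. \<omega> p \<in> alternating_forms k (fibre E p)) \<and>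
     (\<forall>(W, e)\<in>frames E. \<forall>ns. length ns = k \<and> set ns \<subseteq> {..<rank E} \<longrightarrow>
        smooth_fun M (U \<inter> W) (\<lambda>p. \<omega> p (map (\<lambda>i. e i p) ns)))}"


section \<open>Lie algebroids\<close>

record ('m, 'v) algebroid = "('m, 'v) vbundle" +
  anchor :: "'m \<Rightarrow> 'v \<Rightarrow> ('m \<Rightarrow> real) \<Rightarrow> real"
  bracket :: "('m \<Rightarrow> 'v) \<Rightarrow> ('m \<Rightarrow> 'v) \<Rightarrow> 'm \<Rightarrow> 'v"

text \<open>The function $\rho(X)(f)$.\<close>

definition act :: "('m, 'v, 'z) algebroid_scheme \<Rightarrow> ('m \<Rightarrow> 'v) \<Rightarrow> ('m \<Rightarrow> real) \<Rightarrow> 'm \<Rightarrow> real" where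
  "act E X f p = anchor E p (X p) f"

text \<open>
  The anchor is a smooth vector bundle morphism from $E$ to $TM$ over the identity, smoothness being
  expressed by its values on local frames: these are smooth vector fields, i.e. map smooth functions
  to smooth functions.
\<close>

definition anchor_morphism ::
  "'m::topological_space smooth_structure \<Rightarrow> ('m, 'v::real_vector, 'z) algebroid_scheme \<Rightarrow> bool" where
  "anchor_morphism M E \<longleftrightarrow>
     (\<forall>p. \<forall>v\<in>fibre E p. anchor E p v \<in> tangent_space M p) \<and>
     (\<forall>p. \<forall>u\<in>fibre E p. \<forall>v\<in>fibre E p. \<forall>a b f.
        anchor E p (a *\<^sub>R u + b *\<^sub>R v) f = a * anchor E p u f + b * anchor E p v f) \<and>
     (\<forall>(U, e)\<in>frames E. \<forall>i<rank E. \<forall>W f. open W \<and> smooth_fun M W f \<longrightarrow>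
        smooth_fun M (U \<inter> W) (act E (e i) f))"

definition lie_algebroid ::
  "'m::topological_space smooth_structure \<Rightarrow> ('m, 'v::real_vector) algebroid \<Rightarrow> bool" where
  "lie_algebroid M E \<longleftrightarrow>
     vector_bundle M E \<and> anchor_morphism M E \<and>
     (\<forall>X\<in>Sec M E. \<forall>Y\<in>Sec M E. bracket E X Y \<in> Sec M E) \<and>
     (\<forall>X\<in>Sec M E. \<forall>Y\<in>Sec M E. \<forall>Z\<in>Sec M E. \<forall>a b.
        bracket E X (\<lambda>p. a *\<^sub>R Y p + b *\<^sub>R Z p) =
          (\<lambda>p. a *\<^sub>R bracket E X Y p + b *\<^sub>R bracket E X Z p)) \<and>
     (\<forall>X\<in>Sec M E. \<forall>Y\<in>Sec M E. bracket E Y X = (\<lambda>p. - bracket E X Y p)) \<and>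
     (\<forall>X\<in>Sec M E. \<forall>Y\<in>Sec M E. \<forall>Z\<in>Sec M E. \<forall>p.
        bracket E X (bracket E Y Z) p + bracket E Y (bracket E Z X) p
          + bracket E Z (bracket E X Y) p = 0) \<and>
     (\<forall>X\<in>Sec M E. \<forall>Y\<in>Sec M E. \<forall>f. smooth_fun M UNIV f \<longrightarrow>
        bracket E X (\<lambda>p. f p *\<^sub>R Y p) = (\<lambda>p. f p *\<^sub>R bracket E X Y p + act E X f p *\<^sub>R Y p)) \<and>
     (\<forall>X\<in>Sec M E. \<forall>Y\<in>Sec M E. \<forall>W f. open W \<and> smooth_fun M W f \<longrightarrow>
        (\<forall>p\<in>W. act E (bracket E X Y) f p = act E X (act E Y f) p - act E Y (act E X f) p))"

definition lie_algebroid_morphism ::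
  "'m smooth_structure \<Rightarrow> ('m, 'v::real_vector) algebroid \<Rightarrow> ('m, 'w::real_vector) algebroid
     \<Rightarrow> ('m \<Rightarrow> 'v \<Rightarrow> 'w) \<Rightarrow> bool" where
  "lie_algebroid_morphism M E F \<kappa> \<longleftrightarrow>
     (\<forall>p. \<forall>v\<in>fibre E p. \<kappa> p v \<in> fibre F p) \<and>
     (\<forall>p. \<forall>u\<in>fibre E p. \<forall>v\<in>fibre E p. \<forall>a b. \<kappa> p (a *\<^sub>R u + b *\<^sub>R v) = a *\<^sub>R \<kappa> p u + b *\<^sub>R \<kappa> p v) \<and>
     (\<forall>(U, e)\<in>frames E. \<forall>i<rank E. (\<lambda>p. \<kappa> p (e i p)) \<in> sections M F U) \<and>
     (\<forall>p. \<forall>v\<in>fibre E p. anchor F p (\<kappa> p v) = anchor E p v) \<and>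
     (\<forall>X\<in>Sec M E. \<forall>Y\<in>Sec M E.
        (\<lambda>p. \<kappa> p (bracket E X Y p)) = bracket F (\<lambda>p. \<kappa> p (X p)) (\<lambda>p. \<kappa> p (Y p)))"


section \<open>Cartan calculus\<close>

text \<open>
  For the differential calculus a form is viewed through its values on (global) sections:
  $\omega(X_1, \dots, X_k)$ is a function on the domain of \<open>\<omega>\<close>. The differential is given by the
  Koszul formula. It is local, so it also makes sense for forms defined over an open subset only;
  its values are then meaningful at the points of this subset.
\<close>

definition ev :: "('m \<Rightarrow> 'v list \<Rightarrow> real) \<Rightarrow> ('m \<Rightarrow> 'v) list \<Rightarrow> 'm \<Rightarrow> real" where
  "ev \<omega> Xs p = \<omega> p (map (\<lambda>X. X p) Xs)"

definition dE ::
  "('m, 'v, 'z) algebroid_scheme \<Rightarrow> (('m \<Rightarrow> 'v) list \<Rightarrow> 'm \<Rightarrow> real) \<Rightarrow> ('m \<Rightarrow> 'v) list \<Rightarrow> 'm \<Rightarrow> real"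
  where
  "dE E \<omega> Xs p =
     (\<Sum>i<length Xs. (- 1) ^ i * act E (Xs ! i) (\<omega> (nths Xs (- {i}))) p) +
     (\<Sum>j<length Xs. \<Sum>i<j.
        (- 1) ^ (i + j) * \<omega> (bracket E (Xs ! i) (Xs ! j) # nths Xs (- {i, j})) p)"

definition contr ::
  "('m \<Rightarrow> 'v) \<Rightarrow> (('m \<Rightarrow> 'v) list \<Rightarrow> 'm \<Rightarrow> real) \<Rightarrow> ('m \<Rightarrow> 'v) list \<Rightarrow> 'm \<Rightarrow> real" where
  "contr X \<omega> Xs = \<omega> (X # Xs)"

definition lie_derivative ::
  "('m, 'v, 'z) algebroid_scheme \<Rightarrow> ('m \<Rightarrow> 'v) \<Rightarrow> (('m \<Rightarrow> 'v) list \<Rightarrow> 'm \<Rightarrow> real)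
     \<Rightarrow> ('m \<Rightarrow> 'v) list \<Rightarrow> 'm \<Rightarrow> real" where
  "lie_derivative E X \<omega> Xs p = dE E (contr X \<omega>) Xs p + contr X (dE E \<omega>) Xs p"


section \<open>Cohomology\<close>

definition cocycles ::
  "'m smooth_structure \<Rightarrow> ('m, 'v::real_vector) algebroid \<Rightarrow> nat \<Rightarrow> ('m \<Rightarrow> 'v list \<Rightarrow> real) set" where
  "cocycles M E k = {\<omega> \<in> forms M E k UNIV.
     \<forall>Xs p. length Xs = Suc k \<and> set Xs \<subseteq> Sec M E \<longrightarrow> dE E (ev \<omega>) Xs p = 0}"

definition coboundaries ::
  "'m smooth_structure \<Rightarrow> ('m, 'v::real_vector) algebroid \<Rightarrow> nat \<Rightarrow> ('m \<Rightarrow> 'v list \<Rightarrow> real) set" where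
  "coboundaries M E k = {\<omega> \<in> forms M E k UNIV.
     if k = 0 then \<omega> = (\<lambda>p vs. 0)
     else \<exists>\<eta>\<in>forms M E (k - 1) UNIV. \<forall>Xs p. length Xs = k \<and> set Xs \<subseteq> Sec M E \<longrightarrow>
            ev \<omega> Xs p = dE E (ev \<eta>) Xs p}"

definition cohomologous ::
  "'m smooth_structure \<Rightarrow> ('m, 'v::real_vector) algebroid \<Rightarrow> nat \<Rightarrow> ('m \<Rightarrow> 'v list \<Rightarrow> real) rel" where
  "cohomologous M E k = {(\<omega>, \<omega>'). \<omega> \<in> cocycles M E k \<and> \<omega>' \<in> cocycles M E k \<and>
     (\<lambda>p vs. \<omega> p vs - \<omega>' p vs) \<in> coboundaries M E k}"

definition cohomology ::
  "'m smooth_structure \<Rightarrow> ('m, 'v::real_vector) algebroid \<Rightarrow> nat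
     \<Rightarrow> ('m \<Rightarrow> 'v list \<Rightarrow> real) set set" where
  "cohomology M E k = cocycles M E k // cohomologous M E k"

definition cohomology_class ::
  "'m smooth_structure \<Rightarrow> ('m, 'v::real_vector) algebroid \<Rightarrow> nat \<Rightarrow> ('m \<Rightarrow> 'v list \<Rightarrow> real)
     \<Rightarrow> ('m \<Rightarrow> 'v list \<Rightarrow> real) set" where
  "cohomology_class M E k \<omega> = cohomologous M E k `` {\<omega>}"


section \<open>Divergences\<close>

text \<open>
  A section of $|\mathrm{Vol}|_E$ assigns to each point an unordered pair $\{\mu, -\mu\}$ of nonzero
  elements of $\bigwedge^{\mathrm{top}} E^*$, and is locally induced by smooth forms.
\<close>

definition local_representative ::
  "'m::topological_space smooth_structure \<Rightarrow> ('m, 'v::real_vector) algebroid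
     \<Rightarrow> ('m \<Rightarrow> ('v list \<Rightarrow> real) set) \<Rightarrow> 'm set \<Rightarrow> ('m \<Rightarrow> 'v list \<Rightarrow> real) \<Rightarrow> bool" where
  "local_representative M E vol U \<mu> \<longleftrightarrow>
     open U \<and> \<mu> \<in> forms M E (rank E) U \<and>
     (\<forall>p\<in>U. \<mu> p \<noteq> (\<lambda>vs. 0) \<and> vol p = {\<mu> p, \<lambda>vs. - \<mu> p vs})"

definition vol_sections ::
  "'m::topological_space smooth_structure \<Rightarrow> ('m, 'v::real_vector) algebroid
     \<Rightarrow> ('m \<Rightarrow> ('v list \<Rightarrow> real) set) set" where
  "vol_sections M E = {vol. \<forall>p. \<exists>U \<mu>. p \<in> U \<and> local_representative M E vol U \<mu>}"

definition is_divergence_of ::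
  "'m::topological_space smooth_structure \<Rightarrow> ('m, 'v::real_vector) algebroid
     \<Rightarrow> ('m \<Rightarrow> ('v list \<Rightarrow> real) set) \<Rightarrow> (('m \<Rightarrow> 'v) \<Rightarrow> 'm \<Rightarrow> real) \<Rightarrow> bool" where
  "is_divergence_of M E vol dv \<longleftrightarrow>
     (\<forall>X\<in>Sec M E. \<forall>U \<mu>. local_representative M E vol U \<mu> \<longrightarrow>
        (\<forall>Xs. length Xs = rank E \<and> set Xs \<subseteq> Sec M E \<longrightarrow>
           (\<forall>p\<in>U. lie_derivative E X (ev \<mu>) Xs p = dv X p * ev \<mu> Xs p)))"

text \<open>Only the values of a divergence on \<^term>\<open>Sec M E\<close> matter.\<close>

definition Div0 ::
  "'m::topological_space smooth_structure \<Rightarrow> ('m, 'v::real_vector) algebroid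
     \<Rightarrow> (('m \<Rightarrow> 'v) \<Rightarrow> 'm \<Rightarrow> real) set" where
  "Div0 M E = {dv. \<exists>vol\<in>vol_sections M E. is_divergence_of M E vol dv}"

definition pullback_div ::
  "('m \<Rightarrow> 'v \<Rightarrow> 'w) \<Rightarrow> (('m \<Rightarrow> 'w) \<Rightarrow> 'm \<Rightarrow> real) \<Rightarrow> ('m \<Rightarrow> 'v) \<Rightarrow> 'm \<Rightarrow> real" where
  "pullback_div \<kappa> dv X = dv (\<lambda>p. \<kappa> p (X p))"

text \<open>$\phi \in \mathrm{Sec}(E^*)$ and $\kappa^*(\mathrm{div}_F) - \mathrm{div}_E = i_\phi$.\<close>

definition modular_form ::
  "'m smooth_structure \<Rightarrow> ('m, 'v::real_vector) algebroid \<Rightarrow> ('m \<Rightarrow> 'v \<Rightarrow> 'w)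
     \<Rightarrow> (('m \<Rightarrow> 'v) \<Rightarrow> 'm \<Rightarrow> real) \<Rightarrow> (('m \<Rightarrow> 'w) \<Rightarrow> 'm \<Rightarrow> real) \<Rightarrow> ('m \<Rightarrow> 'v list \<Rightarrow> real) \<Rightarrow> bool" where
  "modular_form M E \<kappa> divE divF \<phi> \<longleftrightarrow> \<phi> \<in> forms M E 1 UNIV \<and>
     (\<forall>X\<in>Sec M E. \<forall>p. pullback_div \<kappa> divF X p - divE X p = \<phi> p [X p])"

end

theory Submission
  imports Defs "HOL-Computational_Algebra.Polynomial"
begin

text \<open>
  For a local representative \<open>\<mu>\<close> of a volume, \<open>\<L>\<^sub>X \<mu> (X\<^sub>1, \<dots>) = \<rho>(X)(\<mu> (X\<^sub>1, \<dots>)) - \<Sum> \<mu> (\<dots>, [X, X\<^sub>j], \<dots>)\<close>.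
  Hence the divergence satisfies the Leibniz rule and, by the Jacobi identity, the cocycle condition.
  So \<open>\<kappa>\<^sup>*(div\<^sub>2) - div\<^sub>1\<close> is linear over smooth functions; bump functions extend local frames to global
  sections and thereby turn it into a smooth 1-form, which is closed. Two volumes differ locally by a
  factor \<open>\<plusminus> exp F\<close> with \<open>F\<close> smooth and global, and their divergences differ by \<open>X \<mapsto> \<rho>(X)(F)\<close>, so changing both
  volumes changes the 1-form by the differential of \<open>F\<^sub>2 - F\<^sub>1\<close>.
\<close>

section \<open>Calculus of smooth functions on Euclidean space\<close>

text \<open>Two features of the setting shape the proof. Brackets, Lie derivatives and divergences
  act on sections over the whole manifold, whereas frames and volume representatives are local.
  Pointwise computations therefore use global sections that agree with a frame near the chosen
  point; a neighbourhood is required and not just the point, because these sections are then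
  differentiated. Tangent vectors are abstract derivations of germs, without coordinates, so a chain
  rule has to be derived from the Leibniz rule. It is derived for \<open>exp\<close> only, and the
  change of volume is arranged so that this suffices: with \<open>h\<close> the local ratio of two
  representatives one differentiates \<open>h * h = exp (F + F)\<close> instead of a logarithm. On a
  frame the divergence is the logarithmic derivative of the volume minus the trace of the bracket
  with \<open>X\<close>. In a second derivative the products of these quantities are symmetric in
  the two sections, so they drop out of the commutator.\<close>

lemma openin_Euclidean_space_iff:
  "openin (Euclidean_space n) V \<longleftrightarrow> (\<exists>T. open T \<and> V = T \<inter> {x. \<forall>i\<ge>n. x i = 0})"
  by (auto simp: Euclidean_space_def openin_subtopology euclidean_product_topology)

lemma continuous_on_fun_upd: "continuous_on UNIV (\<lambda>t::real. x(i := t))" for x :: "nat \<Rightarrow> real"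
proof (rule continuous_on_coordinatewise_then_product)
  show "continuous_on UNIV (\<lambda>t. (x(i := t)) j)" for j
    by (cases "j = i") auto
qed

text \<open>An update in a coordinate \<open>i < n\<close> keeps all coordinates from
  \<open>n\<close> on at zero, so only the openness of \<open>T\<close> matters. Hence partial
  derivatives at points of \<open>V\<close> depend only on values on \<open>V\<close>.\<close>

lemma eventually_fun_upd_in_openin:
  assumes "openin (Euclidean_space n) V" "x \<in> V" "i < n"
  shows "\<forall>\<^sub>F t in nhds (x i). x(i := t) \<in> V"
proof -
  obtain T where T: "open T" "V = T \<inter> {x. \<forall>i\<ge>n. x i = 0}"
    using assms(1) by (auto simp: openin_Euclidean_space_iff)
  have "open ((\<lambda>t. x(i := t)) -` T)"
    using continuous_on_fun_upd T(1) by (simp add: open_vimage)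
  moreover have "x i \<in> (\<lambda>t. x(i := t)) -` T" using assms T by simp
  ultimately have "\<forall>\<^sub>F t in nhds (x i). x(i := t) \<in> T"
    by (metis (no_types, lifting) eventually_nhds vimageD)
  then show ?thesis
    by eventually_elim (use assms T in auto)
qed

lemma continuous_on_openin_local:
  fixes f :: "(nat \<Rightarrow> real) \<Rightarrow> real"
  assumes "openin (Euclidean_space n) V"
    and "\<And>x. x \<in> V \<Longrightarrow> \<exists>V'. openin (Euclidean_space n) V' \<and> x \<in> V' \<and> continuous_on V' f"
  shows "continuous_on V f"
  unfolding continuous_on_eq_continuous_within
proof
  fix x assume x: "x \<in> V"
  then obtain V' where V': "openin (Euclidean_space n) V'" "x \<in> V'" "continuous_on V' f"
    using assms by blast
  obtain T T' where T: "open T" "V = T \<inter> {x. \<forall>i\<ge>n. x i = 0}"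
    and T': "open T'" "V' = T' \<inter> {x. \<forall>i\<ge>n. x i = 0}"
    using assms(1) V'(1) unfolding openin_Euclidean_space_iff by blast
  have "at x within V = at x within V'"
    by (rule at_within_nhd[of x "T \<inter> T'"]) (use x V' T T' in auto)
  with V' show "continuous (at x within V) f"
    by (simp add: continuous_on_eq_continuous_within)
qed

lemma Ck_on_imp_continuous_on: "Ck_on n k V f \<Longrightarrow> continuous_on V f"
  by (cases k) auto

lemma Ck_on_Suc_imp_Ck_on: "Ck_on n (Suc k) V f \<Longrightarrow> Ck_on n k V f"
  by (induction k arbitrary: f) auto

lemma Ck_on_subset: "Ck_on n k V f \<Longrightarrow> V' \<subseteq> V \<Longrightarrow> Ck_on n k V' f"
  by (induction k arbitrary: f) (auto intro: continuous_on_subset)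

lemma Ck_on_local:
  assumes "openin (Euclidean_space n) V"
    and "\<And>x. x \<in> V \<Longrightarrow> \<exists>V'. openin (Euclidean_space n) V' \<and> x \<in> V' \<and> Ck_on n k V' f"
  shows "Ck_on n k V f"
  using assms(2)
proof (induction k arbitrary: f)
  case 0
  then show ?case using continuous_on_openin_local[OF assms(1), of f] by simp
next
  case (Suc k)
  have "continuous_on V f"
    by (rule continuous_on_openin_local[OF assms(1)]) (use Suc.prems in force)
  moreover have "(\<lambda>t. f (x(i := t))) field_differentiable at (x i)" if "i < n" "x \<in> V" for i x
    using Suc.prems[OF that(2)] that(1) by auto
  moreover have "Ck_on n k V (partial i f)" if "i < n" for i
    by (rule Suc.IH) (use Suc.prems that in force)
  ultimately show ?case by simp
qed

text \<open>The candidates \<open>f' i\<close> have to be derivatives only at points of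
  \<open>V\<close>, where they agree with \<open>partial i f\<close>. Congruence at level
  \<open>k\<close> is a premise because \<open>Ck_on_cong\<close> is itself proved by induction
  through this rule; \<open>Ck_on_Suc_intro\<close> then removes it.\<close>

lemma Ck_on_SucI:
  assumes "openin (Euclidean_space n) V"
    and "continuous_on V f"
    and "\<And>i x. i < n \<Longrightarrow> x \<in> V \<Longrightarrow> ((\<lambda>t. f (x(i := t))) has_field_derivative f' i x) (at (x i))"
    and "\<And>i. i < n \<Longrightarrow> Ck_on n k V (f' i)"
    and cong: "\<And>f g. Ck_on n k V f \<Longrightarrow> (\<And>x. x \<in> V \<Longrightarrow> f x = g x) \<Longrightarrow> Ck_on n k V g"
  shows "Ck_on n (Suc k) V f"
proof -
  have "Ck_on n k V (partial i f)" if "i < n" for i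
    using assms(4)[OF that]
    by (rule cong) (use assms(3)[OF that] DERIV_imp_deriv in \<open>force simp: partial_def\<close>)
  then show ?thesis using assms(2,3) by (auto simp: field_differentiable_def)
qed

lemma Ck_on_imp_DERIV_partial:
  assumes "Ck_on n (Suc k) V f" "i < n" "x \<in> V"
  shows "((\<lambda>t. f (x(i := t))) has_field_derivative partial i f x) (at (x i))"
  using assms by (auto simp: partial_def field_differentiable_derivI)

lemma Ck_on_cong:
  assumes V: "openin (Euclidean_space n) V"
  shows "Ck_on n k V f \<Longrightarrow> (\<And>x. x \<in> V \<Longrightarrow> f x = g x) \<Longrightarrow> Ck_on n k V g"
proof (induction k arbitrary: f g)
  case 0
  then show ?case using continuous_on_cong by force
next
  case (Suc k)
  show ?case
  proof (rule Ck_on_SucI[OF V])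
    show "continuous_on V g"
      using Ck_on_imp_continuous_on[OF Suc.prems(1)] Suc.prems(2) continuous_on_cong by force
    show "((\<lambda>t. g (x(i := t))) has_field_derivative partial i f x) (at (x i))" if "i < n" "x \<in> V" for i x
    proof -
      have "\<forall>\<^sub>F t in nhds (x i). f (x(i := t)) = g (x(i := t))"
        using eventually_fun_upd_in_openin[OF V that(2,1)] by eventually_elim (rule Suc.prems(2))
      then show ?thesis
        using Ck_on_imp_DERIV_partial[OF Suc.prems(1) that] by (rule DERIV_cong_ev[OF refl _ refl, THEN iffD1])
    qed
    show "Ck_on n k V (partial i f)" if "i < n" for i using Suc.prems that by auto
    show "Ck_on n k V g" if "Ck_on n k V f" "\<And>x. x \<in> V \<Longrightarrow> f x = g x" for f g
      using that by (rule Suc.IH)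
  qed
qed

lemma Ck_on_Suc_intro:
  assumes "openin (Euclidean_space n) V"
    and "continuous_on V f"
    and "\<And>i x. i < n \<Longrightarrow> x \<in> V \<Longrightarrow> ((\<lambda>t. f (x(i := t))) has_field_derivative f' i x) (at (x i))"
    and "\<And>i. i < n \<Longrightarrow> Ck_on n k V (f' i)"
  shows "Ck_on n (Suc k) V f"
  using Ck_on_SucI[OF assms] Ck_on_cong[OF assms(1)] by blast

lemma Ck_on_const: "openin (Euclidean_space n) V \<Longrightarrow> Ck_on n k V (\<lambda>x. c)"
proof (induction k arbitrary: c)
  case (Suc k)
  show ?case
    by (rule Ck_on_Suc_intro[where f'="\<lambda>i x. 0"]) (use Suc in auto)
qed auto

lemma Ck_on_add:
  assumes V: "openin (Euclidean_space n) V"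
  shows "Ck_on n k V f \<Longrightarrow> Ck_on n k V g \<Longrightarrow> Ck_on n k V (\<lambda>x. f x + g x)"
proof (induction k arbitrary: f g)
  case (Suc k)
  show ?case
  proof (rule Ck_on_Suc_intro[OF V, where f'="\<lambda>i x. partial i f x + partial i g x"])
    fix i x assume ix: "i < n" "x \<in> V"
    show "((\<lambda>t. f (x(i := t)) + g (x(i := t))) has_field_derivative partial i f x + partial i g x) (at (x i))"
      using ix by (intro DERIV_add Ck_on_imp_DERIV_partial[OF Suc.prems(1)] Ck_on_imp_DERIV_partial[OF Suc.prems(2)])
  qed (use Suc V in \<open>auto intro!: continuous_intros\<close>)
qed (auto intro: continuous_intros)

lemma Ck_on_mult:
  assumes V: "openin (Euclidean_space n) V"
  shows "Ck_on n k V f \<Longrightarrow> Ck_on n k V g \<Longrightarrow> Ck_on n k V (\<lambda>x. f x * g x)"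
proof (induction k arbitrary: f g)
  case (Suc k)
  show ?case
  proof (rule Ck_on_Suc_intro[OF V, where f'="\<lambda>i x. partial i f x * g x + partial i g x * f x"])
    fix i x assume ix: "i < n" "x \<in> V"
    show "((\<lambda>t. f (x(i := t)) * g (x(i := t))) has_field_derivative
        partial i f x * g x + partial i g x * f x) (at (x i))"
      using DERIV_mult[OF Ck_on_imp_DERIV_partial[OF Suc.prems(1) ix] Ck_on_imp_DERIV_partial[OF Suc.prems(2) ix]]
      by (simp only: fun_upd_triv)
  next
    fix i assume "i < n"
    then show "Ck_on n k V (\<lambda>x. partial i f x * g x + partial i g x * f x)"
      using Suc.prems by (intro Ck_on_add[OF V] Suc.IH) (auto intro: Ck_on_Suc_imp_Ck_on)
  qed (use Suc V in \<open>auto intro!: continuous_intros\<close>)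
qed (auto intro: continuous_intros)

text \<open>The whole tower of derivatives is one sequence \<open>H\<close>, so that the inductive
  chain rule can step from \<open>H j\<close> to \<open>H (Suc j)\<close>.\<close>

definition smooth_real_on :: "real set \<Rightarrow> (real \<Rightarrow> real) \<Rightarrow> bool" where
  "smooth_real_on S h \<longleftrightarrow>
     (\<exists>H. H 0 = h \<and> (\<forall>k. \<forall>s\<in>S. (H k has_field_derivative H (Suc k) s) (at s)))"

text \<open>Differentiating \<open>H j (f x)\<close> produces \<open>H (Suc j) (f x)\<close>, so the
  induction on \<open>k\<close> has to leave \<open>j\<close> free.\<close>

lemma Ck_on_compose:
  assumes V: "openin (Euclidean_space n) V"
    and f: "\<And>k. Ck_on n k V f" "f ` V \<subseteq> S"
    and H: "\<And>k s. s \<in> S \<Longrightarrow> (H k has_field_derivative H (Suc k) s) (at s)"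
  shows "Ck_on n k V (\<lambda>x. H j (f x :: real) :: real)"
proof (induction k arbitrary: j)
  case 0
  have "continuous_on S (H j)"
    using H by (intro DERIV_continuous_on) (auto intro: DERIV_subset)
  then show ?case
    using continuous_on_compose2[OF _ Ck_on_imp_continuous_on[OF f(1)] f(2)] by simp
next
  case (Suc k)
  show ?case
  proof (rule Ck_on_Suc_intro[OF V, where f'="\<lambda>i x. H (Suc j) (f x) * partial i f x"])
    show "continuous_on V (\<lambda>x. H j (f x))"
      using Ck_on_imp_continuous_on[OF Suc.IH] .
    fix i assume i: "i < n"
    have "Ck_on n k V (partial i f)" using f(1)[of "Suc k"] i by auto
    then show "Ck_on n k V (\<lambda>x. H (Suc j) (f x) * partial i f x)"
      using Ck_on_mult[OF V Suc.IH] by blast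
    fix x assume x: "x \<in> V"
    then have "(H j has_field_derivative H (Suc j) (f x)) (at (f (x(i := x i))))"
      using H f(2) by auto
    from DERIV_chain2[OF this Ck_on_imp_DERIV_partial[OF f(1) i x]]
    show "((\<lambda>t. H j (f (x(i := t)))) has_field_derivative H (Suc j) (f x) * partial i f x) (at (x i))" .
  qed
qed

lemma Cinf_on_compose:
  assumes "openin (Euclidean_space n) V" "Cinf_on n V f" "f ` V \<subseteq> S" "smooth_real_on S h"
  shows "Cinf_on n V (\<lambda>x. h (f x))"
  using assms Ck_on_compose[OF assms(1) _ assms(3)]
  unfolding Cinf_on_def smooth_real_on_def by metis

lemma Cinf_on_add:
  "openin (Euclidean_space n) V \<Longrightarrow> Cinf_on n V f \<Longrightarrow> Cinf_on n V g \<Longrightarrow> Cinf_on n V (\<lambda>x. f x + g x)"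
  by (simp add: Cinf_on_def Ck_on_add)

lemma Cinf_on_mult:
  "openin (Euclidean_space n) V \<Longrightarrow> Cinf_on n V f \<Longrightarrow> Cinf_on n V g \<Longrightarrow> Cinf_on n V (\<lambda>x. f x * g x)"
  by (simp add: Cinf_on_def Ck_on_mult)

lemma Cinf_on_const: "openin (Euclidean_space n) V \<Longrightarrow> Cinf_on n V (\<lambda>x. c)"
  by (simp add: Cinf_on_def Ck_on_const)

lemma Cinf_on_subset: "Cinf_on n V f \<Longrightarrow> V' \<subseteq> V \<Longrightarrow> Cinf_on n V' f"
  by (auto simp: Cinf_on_def intro: Ck_on_subset)

lemma Cinf_on_cong:
  "openin (Euclidean_space n) V \<Longrightarrow> Cinf_on n V f \<Longrightarrow> (\<And>x. x \<in> V \<Longrightarrow> f x = g x) \<Longrightarrow> Cinf_on n V g"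
  by (auto simp: Cinf_on_def intro: Ck_on_cong)

lemma Cinf_on_local:
  assumes "openin (Euclidean_space n) V"
    and "\<And>x. x \<in> V \<Longrightarrow> \<exists>V'. openin (Euclidean_space n) V' \<and> x \<in> V' \<and> Cinf_on n V' f"
  shows "Cinf_on n V f"
  using assms unfolding Cinf_on_def by (meson Ck_on_local)

lemma Cinf_on_prod:
  "openin (Euclidean_space n) V \<Longrightarrow> (\<And>i. i \<in> I \<Longrightarrow> Cinf_on n V (f i)) \<Longrightarrow>
    Cinf_on n V (\<lambda>x. \<Prod>i\<in>I. f i x)"
  by (induction I rule: infinite_finite_induct) (auto intro: Cinf_on_const Cinf_on_mult)

subsection \<open>Functions of one variable\<close>

lemma smooth_real_on_inverse: "smooth_real_on (- {0}) inverse"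
  unfolding smooth_real_on_def
proof (intro exI conjI allI ballI)
  let ?H = "\<lambda>k x::real. (- 1) ^ k * fact k * inverse x ^ Suc k"
  show "?H 0 = inverse" by auto
  fix k and s :: real assume "s \<in> - {0}"
  then have "((\<lambda>x. (- 1) ^ k * fact k * inverse x ^ Suc k) has_field_derivative
      (- 1) ^ k * fact k * (of_nat (Suc k) * inverse s ^ k * (- (inverse s ^ Suc (Suc 0))))) (at s)"
    by (intro DERIV_cmult DERIV_cong[OF DERIV_power[OF DERIV_inverse]]) auto
  then show "(?H k has_field_derivative ?H (Suc k) s) (at s)"
    by (rule DERIV_cong) (simp add: algebra_simps)
qed

lemma smooth_real_on_ln: "smooth_real_on {0<..} ln"
proof -
  obtain H where H: "H 0 = inverse" "\<And>k s::real. s \<in> - {0} \<Longrightarrow> (H k has_field_derivative H (Suc k) s) (at s)"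
    using smooth_real_on_inverse unfolding smooth_real_on_def by blast
  show ?thesis
    unfolding smooth_real_on_def
  proof (intro exI conjI allI ballI)
    \<comment> \<open>The tower of \<open>ln\<close> is the tower of its derivative
      \<open>inverse\<close>, shifted by one place.\<close>
    show "case_nat ln H 0 = ln" by simp
    fix k and s :: real assume "s \<in> {0<..}"
    then show "(case_nat ln H k has_field_derivative case_nat ln H (Suc k) s) (at s)"
      using H by (cases k) (auto intro!: derivative_eq_intros simp: inverse_eq_divide)
  qed
qed

text \<open>A power series that converges on the whole line can be differentiated termwise, and the
  derived series converges everywhere again. Iterating \<open>diffs\<close> therefore yields the
  tower of derivatives.\<close>

lemma smooth_real_on_powser:
  fixes c :: "nat \<Rightarrow> real"
  assumes "\<And>x. summable (\<lambda>n. c n * x ^ n)"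
  shows "smooth_real_on UNIV (\<lambda>x. \<Sum>n. c n * x ^ n)"
  unfolding smooth_real_on_def
proof (intro exI conjI allI ballI)
  let ?H = "\<lambda>k x. \<Sum>n. (diffs ^^ k) c n * x ^ n"
  show "?H 0 = (\<lambda>x. \<Sum>n. c n * x ^ n)" by simp
  fix k and s :: real
  have "summable (\<lambda>n. (diffs ^^ k) c n * x ^ n)" for x
    using assms by (induction k arbitrary: x) (auto intro: termdiff_converges_all)
  from termdiffs_strong_converges_everywhere[OF this]
  show "(?H k has_field_derivative ?H (Suc k) s) (at s)" by simp
qed

text \<open>A quotient by \<open>t\<^sup>2\<close> would leave smoothness at zero open. The shifted
  exponential series, with coefficients \<open>1 / (n + 2)!\<close>, defines the same function on
  the whole line.\<close>

lemma exp_second_order_remainder: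
  obtains G :: "real \<Rightarrow> real" where "smooth_real_on UNIV G" "\<And>t. exp t = 1 + t + t\<^sup>2 * G t"
proof
  let ?c = "\<lambda>n. inverse (fact (n + 2)) :: real"
  have sums: "(\<lambda>n. ?c n * t ^ (n + 2)) sums (exp t - (1 + t))" for t :: real
    using sums_split_initial_segment[OF exp_converges[of t], of 2]
    by (simp add: numeral_2_eq_2)
  have summ: "summable (\<lambda>n. ?c n * t ^ n)" for t
  proof (cases "t = 0")
    case True
    then show ?thesis by simp
  next
    case False
    have "summable (\<lambda>n. inverse (t\<^sup>2) * (?c n * t ^ (n + 2)))"
      using sums[of t] by (intro summable_mult) (auto simp: sums_iff)
    moreover have "inverse (t\<^sup>2) * (?c n * t ^ (n + 2)) = ?c n * t ^ n" for n
      using False by (simp add: power_add power2_eq_square field_simps del: fact_Suc add_2_eq_Suc')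
    ultimately show ?thesis by (simp only:)
  qed
  show "smooth_real_on UNIV (\<lambda>t. \<Sum>n. ?c n * t ^ n)"
    by (rule smooth_real_on_powser[OF summ])
  show "exp t = 1 + t + t\<^sup>2 * (\<Sum>n. ?c n * t ^ n)" for t
  proof -
    have "t\<^sup>2 * (\<Sum>n. ?c n * t ^ n) = (\<Sum>n. ?c n * t ^ (n + 2))"
      by (subst suminf_mult[OF summ, symmetric]) (simp add: power_add power2_eq_square mult_ac)
    then show ?thesis using sums[of t] by (simp add: sums_iff)
  qed
qed

section \<open>A smooth cutoff function on the real line\<close>

definition flat_exp :: "real \<Rightarrow> real" where
  "flat_exp x = (if x > 0 then exp (- inverse x) else 0)"

lemma tendsto_poly_div_exp_0: "((\<lambda>y. poly P y / exp y) \<longlongrightarrow> (0::real)) at_top"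
proof -
  have "((\<lambda>y. \<Sum>i\<le>degree P. coeff P i * (y ^ i / exp y)) \<longlongrightarrow> (\<Sum>i\<le>degree P. coeff P i * 0)) at_top"
    by (intro tendsto_intros tendsto_power_div_exp_0)
  then show ?thesis by (simp add: poly_altdef sum_divide_distrib)
qed

text \<open>The functions \<open>P (1/x) * exp (- 1/x)\<close>, extended by zero to
  \<open>x \<le> 0\<close>, are closed under differentiation: with \<open>y = 1/x\<close> the
  polynomial \<open>P\<close> becomes \<open>y\<^sup>2 * (P - P')\<close>, where
  \<open>[:0, 0, 1:]\<close> is \<open>y\<^sup>2\<close>. Starting from \<open>P = 1\<close> this
  gives all derivatives of \<open>flat_exp\<close>.\<close>

lemma flat_exp_poly_has_derivative:
  fixes P :: "real poly"
  defines "h \<equiv> \<lambda>P x. if x > 0 then poly P (inverse x) * exp (- inverse x) else (0::real)"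
  shows "(h P has_field_derivative h ([:0, 0, 1:] * (P - pderiv P)) s) (at s)"
proof -
  consider "s > 0" | "s < 0" | "s = 0" by linarith
  then show ?thesis
  proof cases
    case 1
    have "((\<lambda>x. poly P (inverse x) * exp (- inverse x)) has_field_derivative
        h ([:0, 0, 1:] * (P - pderiv P)) s) (at s)"
      using 1 unfolding h_def
      by (auto intro!: derivative_eq_intros DERIV_chain2[OF poly_DERIV] simp: algebra_simps power2_eq_square)
    then show ?thesis
      by (rule has_field_derivative_transform_within_open[of _ _ _ "{0<..}"]) (use 1 in \<open>auto simp: h_def\<close>)
  next
    case 2
    have "((\<lambda>x. 0) has_field_derivative h ([:0, 0, 1:] * (P - pderiv P)) s) (at s)"
      using 2 by (auto simp: h_def)
    then show ?thesis
      by (rule has_field_derivative_transform_within_open[of _ _ _ "{..<0}"]) (use 2 in \<open>auto simp: h_def\<close>)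
  next
    case 3
    \<comment> \<open>The extra factor \<open>[:0, 1:]\<close> is the \<open>1/x\<close> of the
      difference quotient at zero; as \<open>1/x\<close> tends to infinity, the exponential beats
      every polynomial.\<close>
    have "((\<lambda>x. poly ([:0, 1:] * P) (inverse x) / exp (inverse x)) \<longlongrightarrow> 0) (at_right 0)"
      using filterlim_compose[OF tendsto_poly_div_exp_0 filterlim_inverse_at_top_right] .
    then have "((\<lambda>x. h P x / x) \<longlongrightarrow> 0) (at_right 0)"
      by (rule tendsto_cong[THEN iffD1, rotated])
        (auto simp: eventually_at_filter h_def exp_minus field_simps)
    moreover have "((\<lambda>x. h P x / x) \<longlongrightarrow> 0) (at_left 0)"
      by (rule tendsto_cong[THEN iffD1, rotated, of "\<lambda>x. 0"])
        (auto simp: eventually_at_filter h_def)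
    ultimately have "((\<lambda>x. h P x / x) \<longlongrightarrow> 0) (at 0)"
      using filterlim_split_at_real by blast
    then show ?thesis using 3 by (simp add: has_field_derivative_iff h_def)
  qed
qed

lemma smooth_real_on_flat_exp: "smooth_real_on UNIV flat_exp"
  unfolding smooth_real_on_def
proof (intro exI conjI allI ballI)
  let ?P = "\<lambda>k. ((\<lambda>P. [:0, 0, 1:] * (P - pderiv P)) ^^ k) 1"
  let ?H = "\<lambda>k x. if x > 0 then poly (?P k) (inverse x) * exp (- inverse x) else (0::real)"
  show "?H 0 = flat_exp" by (auto simp: flat_exp_def fun_eq_iff)
  show "(?H k has_field_derivative ?H (Suc k) s) (at s)" for k s
    using flat_exp_poly_has_derivative[of "?P k" s] by (simp only: funpow.simps comp_apply)
qed

text \<open>The arguments \<open>4 - t\<^sup>2\<close> and \<open>t\<^sup>2 - 1\<close> add up to 3,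
  so at least one is positive and the denominator never vanishes. The numerator dies for
  \<open>\<bar>t\<bar> \<ge> 2\<close>, the other summand of the denominator for
  \<open>\<bar>t\<bar> \<le> 1\<close>. Using the square of \<open>t\<close> avoids the corner of
  the absolute value.\<close>

definition bump_real :: "real \<Rightarrow> real" where
  "bump_real t = flat_exp (4 - t\<^sup>2) * inverse (flat_exp (4 - t\<^sup>2) + flat_exp (t\<^sup>2 - 1))"

lemma flat_exp_sum_pos: "flat_exp (4 - a) + flat_exp (a - 1) > 0"
  by (auto simp: flat_exp_def add_pos_pos)

lemma bump_real_eq_1: "\<bar>t\<bar> \<le> 1 \<Longrightarrow> bump_real t = 1"
proof -
  assume "\<bar>t\<bar> \<le> 1"
  then have "t\<^sup>2 \<le> 1" by (simp add: abs_square_le_1)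
  then show ?thesis by (simp add: bump_real_def flat_exp_def)
qed

lemma bump_real_eq_0: "\<bar>t\<bar> \<ge> 2 \<Longrightarrow> bump_real t = 0"
proof -
  assume "\<bar>t\<bar> \<ge> 2"
  then have "t\<^sup>2 \<ge> 2\<^sup>2" by (subst abs_le_square_iff[symmetric]) simp
  then show ?thesis by (simp add: bump_real_def flat_exp_def)
qed

lemma Cinf_on_bump_real:
  assumes V: "openin (Euclidean_space n) V" and f: "Cinf_on n V f"
  shows "Cinf_on n V (\<lambda>x. bump_real (f x))"
proof -
  have sq: "Cinf_on n V (\<lambda>x. f x * f x)"
    using V f by (simp add: Cinf_on_mult)
  have 4: "Cinf_on n V (\<lambda>x. flat_exp (4 + (- 1) * (f x * f x)))"
    by (rule Cinf_on_compose[OF V _ _ smooth_real_on_flat_exp])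
      (intro Cinf_on_add Cinf_on_mult Cinf_on_const V sq, simp)
  have 1: "Cinf_on n V (\<lambda>x. flat_exp (f x * f x + - 1))"
    by (rule Cinf_on_compose[OF V _ _ smooth_real_on_flat_exp])
      (intro Cinf_on_add Cinf_on_mult Cinf_on_const V sq, simp)
  have "Cinf_on n V (\<lambda>x. inverse (flat_exp (4 + (- 1) * (f x * f x)) + flat_exp (f x * f x + - 1)))"
  proof (rule Cinf_on_compose[OF V _ _ smooth_real_on_inverse])
    show "(\<lambda>x. flat_exp (4 + (- 1) * (f x * f x)) + flat_exp (f x * f x + - 1)) ` V \<subseteq> - {0}"
      using flat_exp_sum_pos[of "f x * f x" for x] by (force simp: less_le)
  qed (intro Cinf_on_add V 1 4)
  from Cinf_on_mult[OF V 4 this] show ?thesis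
    by (simp add: bump_real_def power2_eq_square)
qed

section \<open>Smooth functions on manifolds\<close>

locale smooth_mfd =
  fixes M :: "'m::{t2_space, second_countable_topology} smooth_structure"
  assumes smooth_manifold: "smooth_manifold M"
begin

lemma chart_at: obtains U x where "(U, x) \<in> charts M" "p \<in> U"
proof -
  have "p \<in> (\<Union>(U, x)\<in>charts M. U)" using smooth_manifold unfolding smooth_manifold_def by simp
  then show thesis using that by auto
qed

lemma chart_homeomorphism:
  assumes "(U, x) \<in> charts M"
  obtains y where "homeomorphism U (x ` U) x y"
  using assms smooth_manifold unfolding smooth_manifold_def by blast

lemma chart_open: "(U, x) \<in> charts M \<Longrightarrow> open U"
  and openin_chart_range: "(U, x) \<in> charts M \<Longrightarrow> openin (Euclidean_space (mdim M)) (x ` U)"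
  using smooth_manifold unfolding smooth_manifold_def by blast+

lemma Cinf_on_transition:
  "(U, x) \<in> charts M \<Longrightarrow> (V, y) \<in> charts M \<Longrightarrow> i < mdim M \<Longrightarrow>
    Cinf_on (mdim M) (x ` (U \<inter> V)) (\<lambda>z. y (the_inv_into U x z) i)"
  using smooth_manifold unfolding smooth_manifold_def by blast

lemma chart_inv:
  assumes "(U, x) \<in> charts M" "q \<in> U"
  shows "the_inv_into U x (x q) = q"
proof -
  obtain y where "homeomorphism U (x ` U) x y" using chart_homeomorphism assms(1) .
  then have "inj_on x U" by (metis homeomorphism_def inj_on_inverseI)
  then show ?thesis using assms(2) by (rule the_inv_into_f_f)
qed

lemma openin_chart_image:
  assumes "(U, x) \<in> charts M" "open W"
  shows "openin (Euclidean_space (mdim M)) (x ` (U \<inter> W))"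
proof -
  obtain y where y: "homeomorphism U (x ` U) x y" using chart_homeomorphism assms(1) .
  have "openin (top_of_set (x ` U)) (x ` (U \<inter> W))"
    using homeomorphism_imp_open_map[OF y] assms(2) by blast
  then obtain S where S: "open S" "x ` (U \<inter> W) = x ` U \<inter> S"
    by (auto simp: openin_open)
  obtain T where T: "open T" "x ` U = T \<inter> {x. \<forall>i\<ge>mdim M. x i = 0}"
    using openin_chart_range[OF assms(1)] by (auto simp: openin_Euclidean_space_iff)
  show ?thesis
    unfolding openin_Euclidean_space_iff using S T by (intro exI[of _ "T \<inter> S"]) auto
qed

lemma smooth_fun_cong:
  assumes "smooth_fun M W f" "open W" "\<And>q. q \<in> W \<Longrightarrow> f q = g q"
  shows "smooth_fun M W g"
  unfolding smooth_fun_def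
proof (clarify)
  fix U x assume c: "(U, x) \<in> charts M"
  show "Cinf_on (mdim M) (x ` (U \<inter> W)) (\<lambda>z. g (the_inv_into U x z))"
  proof (rule Cinf_on_cong[OF openin_chart_image[OF c assms(2)]])
    show "Cinf_on (mdim M) (x ` (U \<inter> W)) (\<lambda>z. f (the_inv_into U x z))"
      using assms(1) c by (auto simp: smooth_fun_def)
  qed (use assms(3) chart_inv[OF c] in auto)
qed

lemma smooth_fun_subset: "smooth_fun M W f \<Longrightarrow> W' \<subseteq> W \<Longrightarrow> smooth_fun M W' f"
  unfolding smooth_fun_def by (fastforce elim!: Cinf_on_subset)

lemma smooth_fun_local:
  assumes "open W" "\<And>p. p \<in> W \<Longrightarrow> \<exists>W'. open W' \<and> p \<in> W' \<and> smooth_fun M W' f"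
  shows "smooth_fun M W f"
  unfolding smooth_fun_def
proof (clarify)
  fix U x assume c: "(U, x) \<in> charts M"
  show "Cinf_on (mdim M) (x ` (U \<inter> W)) (\<lambda>z. f (the_inv_into U x z))"
  proof (rule Cinf_on_local[OF openin_chart_image[OF c assms(1)]])
    fix z assume "z \<in> x ` (U \<inter> W)"
    then obtain q where q: "z = x q" "q \<in> U" "q \<in> W" by blast
    then obtain W' where W': "open W'" "q \<in> W'" "smooth_fun M W' f" using assms(2) by blast
    show "\<exists>V'. openin (Euclidean_space (mdim M)) V' \<and> z \<in> V' \<and>
        Cinf_on (mdim M) V' (\<lambda>z. f (the_inv_into U x z))"
      using W' q c openin_chart_image[OF c W'(1)] by (fastforce simp: smooth_fun_def)
  qed
qed

lemma smooth_fun_const: "open W \<Longrightarrow> smooth_fun M W (\<lambda>q. c)"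
  by (auto simp: smooth_fun_def intro!: Cinf_on_const openin_chart_image)

lemma smooth_fun_add:
  "open W \<Longrightarrow> smooth_fun M W f \<Longrightarrow> smooth_fun M W g \<Longrightarrow> smooth_fun M W (\<lambda>q. f q + g q)"
  by (auto simp: smooth_fun_def intro!: Cinf_on_add openin_chart_image)

lemma smooth_fun_mult:
  "open W \<Longrightarrow> smooth_fun M W f \<Longrightarrow> smooth_fun M W g \<Longrightarrow> smooth_fun M W (\<lambda>q. f q * g q)"
  by (auto simp: smooth_fun_def intro!: Cinf_on_mult openin_chart_image)

lemma smooth_fun_cmult: "open W \<Longrightarrow> smooth_fun M W f \<Longrightarrow> smooth_fun M W (\<lambda>q. a * f q)"
  by (intro smooth_fun_mult smooth_fun_const)

lemma smooth_fun_diff: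
  "open W \<Longrightarrow> smooth_fun M W f \<Longrightarrow> smooth_fun M W g \<Longrightarrow> smooth_fun M W (\<lambda>q. f q - g q)"
  using smooth_fun_add[of W f "\<lambda>q. - 1 * g q"] smooth_fun_cmult[of W g "- 1"] by simp

lemma smooth_fun_sum:
  "open W \<Longrightarrow> (\<And>i. i \<in> I \<Longrightarrow> smooth_fun M W (f i)) \<Longrightarrow> smooth_fun M W (\<lambda>q. \<Sum>i\<in>I. f i q)"
  by (induction I rule: infinite_finite_induct) (auto intro: smooth_fun_const smooth_fun_add)

lemma smooth_fun_compose:
  assumes "open W" "smooth_fun M W f" "f ` W \<subseteq> S" "smooth_real_on S h"
  shows "smooth_fun M W (\<lambda>q. h (f q))"
  unfolding smooth_fun_def
proof clarify
  fix U x assume c: "(U, x) \<in> charts M"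
  show "Cinf_on (mdim M) (x ` (U \<inter> W)) (\<lambda>z. h (f (the_inv_into U x z)))"
  proof (rule Cinf_on_compose[OF openin_chart_image[OF c assms(1)] _ _ assms(4)])
    show "(\<lambda>z. f (the_inv_into U x z)) ` x ` (U \<inter> W) \<subseteq> S"
      using assms(3) chart_inv[OF c] by auto
  qed (use assms(2) c in \<open>auto simp: smooth_fun_def\<close>)
qed

lemma smooth_fun_inverse:
  "open W \<Longrightarrow> smooth_fun M W f \<Longrightarrow> (\<And>q. q \<in> W \<Longrightarrow> f q \<noteq> 0) \<Longrightarrow> smooth_fun M W (\<lambda>q. inverse (f q))"
  by (rule smooth_fun_compose[OF _ _ _ smooth_real_on_inverse]) auto

lemma smooth_fun_ln:
  "open W \<Longrightarrow> smooth_fun M W f \<Longrightarrow> (\<And>q. q \<in> W \<Longrightarrow> f q > 0) \<Longrightarrow> smooth_fun M W (\<lambda>q. ln (f q))"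
  by (rule smooth_fun_compose[OF _ _ _ smooth_real_on_ln]) auto

text \<open>A product of one-dimensional cutoffs in a chart is 1 on a small box and 0 off a larger
  one. The closed set \<open>K\<close> is part of the result because extension by zero is smooth
  only if the region where \<open>b\<close> vanishes contains an open set which, together with
  \<open>W\<close>, covers the manifold.\<close>

lemma bump_function:
  assumes "open W" "p \<in> W"
  obtains b K N where "smooth_fun M UNIV b" "closed K" "K \<subseteq> W" "\<And>q. q \<notin> K \<Longrightarrow> b q = 0"
    "open N" "p \<in> N" "\<And>q. q \<in> N \<Longrightarrow> b q = 1"
proof -
  define n where "n = mdim M"
  obtain U x where c: "(U, x) \<in> charts M" and pU: "p \<in> U" using chart_at .
  obtain y where y: "homeomorphism U (x ` U) x y" using chart_homeomorphism c .
  then have yx: "y (x q) = q" if "q \<in> U" for q using that by (auto simp: homeomorphism_def)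
  obtain T where T: "open T" "x ` (U \<inter> W) = T \<inter> {x. \<forall>i\<ge>n. x i = 0}"
    using openin_chart_image[OF c assms(1)] by (auto simp: openin_Euclidean_space_iff n_def)
  have x0: "x q i = 0" if "q \<in> U" "i \<ge> n" for q i
    using openin_subset[OF openin_chart_range[OF c]] that
    by (auto simp: topspace_Euclidean_space n_def)
  have "x p \<in> T" using T assms pU by auto
  then obtain X where X: "x p \<in> (\<Pi>\<^sub>E i\<in>UNIV. X i)" "\<And>i. open (X i)" "(\<Pi>\<^sub>E i\<in>UNIV. X i) \<subseteq> T"
    using product_topology_open_contains_basis[of "\<lambda>i. euclideanreal" UNIV T "x p"] T(1)
    by (force simp: euclidean_product_topology)
  have "\<exists>e>0. ball (x p i) e \<subseteq> X i" for i
    using X(1,2) by (meson PiE_E UNIV_I open_contains_ball)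
  then obtain e where e: "\<And>i. e i > 0" "\<And>i. ball (x p i) (e i) \<subseteq> X i" by metis
  \<comment> \<open>Inserting 1 keeps the minimum meaningful in dimension zero. Dividing by 3 leaves
    room for inner radius \<open>\<delta>\<close> and outer radius \<open>2 * \<delta>\<close> below
    every \<open>e i\<close>.\<close>
  define \<delta> where "\<delta> = Min (insert 1 (e ` {..<n})) / 3"
  have \<delta>0: "\<delta> > 0" using e(1) by (auto simp: \<delta>_def)
  have \<delta>e: "2 * \<delta> < e i" if "i < n" for i
  proof -
    have "Min (insert 1 (e ` {..<n})) \<le> e i" using that by (intro Min_le) auto
    moreover have "3 * \<delta> = Min (insert 1 (e ` {..<n}))" by (simp add: \<delta>_def)
    ultimately show ?thesis using \<delta>0 by linarith
  qed
  \<comment> \<open>Pinning the coordinates from \<open>n\<close> on to \<open>{0}\<close> makes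
    every factor compact, so the infinite product is compact by Tychonoff.\<close>
  define C where "C = (\<Pi>\<^sub>E i\<in>UNIV. if i < n then cball (x p i) (2 * \<delta>) else {0})"
  have C_iff: "z \<in> C \<longleftrightarrow> (\<forall>i<n. \<bar>z i - x p i\<bar> \<le> 2 * \<delta>) \<and> (\<forall>i\<ge>n. z i = 0)" for z
  proof -
    have "z \<in> C \<longleftrightarrow> (\<forall>i. (i < n \<longrightarrow> \<bar>z i - x p i\<bar> \<le> 2 * \<delta>) \<and> (\<not> i < n \<longrightarrow> z i = 0))"
      unfolding C_def PiE_UNIV_domain Pi_iff by (simp add: dist_real_def abs_minus_commute)
    then show ?thesis by (auto simp: not_less)
  qed
  have "compactin (product_topology (\<lambda>i. euclideanreal) UNIV) C"
    unfolding C_def compactin_PiE by auto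
  then have "compact C"
    by (simp add: euclidean_product_topology)
  have "C \<subseteq> x ` (U \<inter> W)"
  proof
    fix z assume z: "z \<in> C"
    have "z i \<in> X i" for i
    proof (cases "i < n")
      case True
      then show ?thesis using z e(2)[of i] \<delta>e[of i]
        by (force simp: C_iff dist_real_def abs_minus_commute)
    next
      case False
      then show ?thesis using z X(1) x0[OF pU, of i] by (auto simp: C_iff PiE_UNIV_domain Pi_iff) (metis not_less)
    qed
    then have "z \<in> T" using X(3) by (auto simp: PiE_UNIV_domain)
    then show "z \<in> x ` (U \<inter> W)" using T(2) z by (auto simp: C_iff)
  qed
  define K where "K = y ` C"
  have KUW: "K \<subseteq> U \<inter> W"
    using \<open>C \<subseteq> _\<close> yx by (auto simp: K_def)
  have "continuous_on C y"
    using y \<open>C \<subseteq> _\<close> by (auto simp: homeomorphism_def intro: continuous_on_subset)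
  \<comment> \<open>The Hausdorff property enters here: the compact image of the box is closed in
    the whole manifold and not merely in the chart domain.\<close>
  then have "closed K"
    unfolding K_def using \<open>compact C\<close> by (intro compact_imp_closed compact_continuous_image)
  \<comment> \<open>Written with \<open>+ -\<close> and \<open>* inverse\<close> so that the closure
    rules for \<open>Cinf_on\<close> match syntactically.\<close>
  define b where "b q = (if q \<in> U then \<Prod>i<n. bump_real ((x q i + - x p i) * inverse \<delta>) else 0)" for q
  have b0: "b q = 0" if "q \<notin> K" for q
  proof (cases "q \<in> U")
    case True
    then have "x q \<notin> C" using that yx unfolding K_def by force
    then obtain i where "i < n" "\<bar>x q i - x p i\<bar> > 2 * \<delta>"
      using x0[OF True] by (auto simp: C_iff not_le)
    then have "\<bar>(x q i + - x p i) * inverse \<delta>\<bar> \<ge> 2"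
      using \<delta>0 by (simp add: abs_mult field_simps)
    then have "bump_real ((x q i + - x p i) * inverse \<delta>) = 0" by (rule bump_real_eq_0)
    then show ?thesis using \<open>i < n\<close> True by (auto simp: b_def)
  qed (simp add: b_def)
  define N where "N = U \<inter> x -` {z. \<forall>i<n. \<bar>z i - x p i\<bar> < \<delta>}"
  have "open (\<Inter>i\<in>{..<n}. {z::nat \<Rightarrow> real. \<bar>z i - x p i\<bar> < \<delta>})"
    by (intro open_INT finite_lessThan ballI open_Collect_less continuous_intros
        continuous_on_product_then_coordinatewise[where f="\<lambda>z. z"])
  moreover have "(\<Inter>i\<in>{..<n}. {z. \<bar>z i - x p i\<bar> < \<delta>}) = {z. \<forall>i<n. \<bar>z i - x p i\<bar> < \<delta>}" by auto
  ultimately have "open {z. \<forall>i<n. \<bar>z i - x p i\<bar> < \<delta>}" by simp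
  moreover have "continuous_on U x" using y by (simp add: homeomorphism_def)
  ultimately have "open N"
    unfolding N_def by (rule continuous_open_preimage[OF _ chart_open[OF c], rotated])
  have "p \<in> N" using pU \<delta>0 by (simp add: N_def)
  have b1: "b q = 1" if "q \<in> N" for q
  proof -
    have "bump_real ((x q i + - x p i) * inverse \<delta>) = 1" if "i < n" for i
    proof (rule bump_real_eq_1)
      have "\<bar>x q i - x p i\<bar> < \<delta>" using \<open>q \<in> N\<close> that by (simp add: N_def)
      then show "\<bar>(x q i + - x p i) * inverse \<delta>\<bar> \<le> 1"
        using \<delta>0 by (simp add: abs_mult field_simps)
    qed
    then show ?thesis using that by (simp add: b_def N_def)
  qed
  \<comment> \<open>The open sets \<open>U\<close> and \<open>- K\<close> cover the manifold: on the
    first, \<open>b\<close> is a product of smooth functions of the coordinates; on the second it is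
    zero.\<close>
  have "smooth_fun M UNIV b"
  proof (rule smooth_fun_local)
    fix q :: 'm
    have "smooth_fun M U b"
      unfolding smooth_fun_def
    proof clarify
      fix U' x' assume c': "(U', x') \<in> charts M"
      have V: "openin (Euclidean_space (mdim M)) (x' ` (U' \<inter> U))"
        by (rule openin_chart_image[OF c' chart_open[OF c]])
      have "Cinf_on (mdim M) (x' ` (U' \<inter> U))
          (\<lambda>z. \<Prod>i<n. bump_real ((x (the_inv_into U' x' z) i + - x p i) * inverse \<delta>))"
        by (intro Cinf_on_prod Cinf_on_bump_real Cinf_on_mult Cinf_on_add Cinf_on_const V
            Cinf_on_transition c c') (simp add: n_def)
      then show "Cinf_on (mdim M) (x' ` (U' \<inter> U)) (\<lambda>z. b (the_inv_into U' x' z))"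
        by (rule Cinf_on_cong[OF V]) (auto simp: b_def chart_inv[OF c'])
    qed
    moreover have "smooth_fun M (- K) b"
      by (rule smooth_fun_cong[OF smooth_fun_const[of _ 0]]) (use \<open>closed K\<close> b0 in auto)
    ultimately show "\<exists>W'. open W' \<and> q \<in> W' \<and> smooth_fun M W' b"
      using chart_open[OF c] \<open>closed K\<close> KUW by (cases "q \<in> U") (auto simp: open_Compl)
  qed simp
  then show thesis using that \<open>closed K\<close> KUW b0 \<open>open N\<close> \<open>p \<in> N\<close> b1 by blast
qed

text \<open>Nothing is assumed about \<open>f\<close> near the boundary of \<open>W\<close>. The
  open set \<open>- K\<close>, on which the extension is zero, takes care of it.\<close>

lemma smooth_fun_extend:
  assumes "smooth_fun M UNIV b" "closed K" "K \<subseteq> W" "\<And>q. q \<notin> K \<Longrightarrow> b q = 0"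
    "open W" "smooth_fun M W f"
  shows "smooth_fun M UNIV (\<lambda>q. if q \<in> W then b q * f q else 0)"
proof (rule smooth_fun_local)
  fix p :: 'm
  let ?f = "\<lambda>q. if q \<in> W then b q * f q else 0"
  have "smooth_fun M W (\<lambda>q. b q * f q)"
    using assms by (intro smooth_fun_mult) (auto intro: smooth_fun_subset)
  then have "smooth_fun M W ?f"
    by (rule smooth_fun_cong) (use assms in auto)
  moreover have "smooth_fun M (- K) ?f"
    by (rule smooth_fun_cong[OF smooth_fun_const[of _ 0]]) (use assms in auto)
  ultimately show "\<exists>W'. open W' \<and> p \<in> W' \<and> smooth_fun M W' ?f"
    using assms by (cases "p \<in> W") (auto simp: open_Compl)
qed simp

section \<open>Germs of smooth functions and derivations at a point\<close>

lemma smooth_near_common: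
  assumes "smooth_near M p f" "smooth_near M p g"
  obtains W where "open W" "p \<in> W" "smooth_fun M W f" "smooth_fun M W g"
proof -
  from assms obtain W W' where "open W" "p \<in> W" "smooth_fun M W f"
    "open W'" "p \<in> W'" "smooth_fun M W' g"
    unfolding smooth_near_def by blast
  then show thesis
    by (intro that[of "W \<inter> W'"]) (auto intro: smooth_fun_subset)
qed

lemma smooth_near_const: "smooth_near M p (\<lambda>q. c)"
  unfolding smooth_near_def by (rule exI[of _ UNIV]) (simp add: smooth_fun_const)

lemma smooth_near_add: "smooth_near M p f \<Longrightarrow> smooth_near M p g \<Longrightarrow> smooth_near M p (\<lambda>q. f q + g q)"
  by (erule (1) smooth_near_common) (auto simp: smooth_near_def intro: smooth_fun_add)

lemma smooth_near_mult: "smooth_near M p f \<Longrightarrow> smooth_near M p g \<Longrightarrow> smooth_near M p (\<lambda>q. f q * g q)"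
  by (erule (1) smooth_near_common) (auto simp: smooth_near_def intro: smooth_fun_mult)

lemma smooth_near_sum:
  "(\<And>i. i \<in> I \<Longrightarrow> smooth_near M p (f i)) \<Longrightarrow> smooth_near M p (\<lambda>q. \<Sum>i\<in>I. f i q)"
  by (induction I rule: infinite_finite_induct) (auto intro: smooth_near_const smooth_near_add)

lemma smooth_near_compose:
  "smooth_near M p f \<Longrightarrow> smooth_real_on UNIV h \<Longrightarrow> smooth_near M p (\<lambda>q. h (f q))"
  unfolding smooth_near_def using smooth_fun_compose[of _ f UNIV h] by blast

lemma smooth_near_cong:
  assumes "smooth_near M p f" "\<forall>\<^sub>F q in nhds p. f q = g q"
  shows "smooth_near M p g"
proof -
  obtain W where W: "open W" "p \<in> W" "\<And>q. q \<in> W \<Longrightarrow> f q = g q"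
    using assms(2) unfolding eventually_nhds by blast
  obtain W' where W': "open W'" "p \<in> W'" "smooth_fun M W' f"
    using assms(1) unfolding smooth_near_def by blast
  have "smooth_fun M (W \<inter> W') g"
    by (rule smooth_fun_cong[of _ f]) (use W W' in \<open>auto intro: smooth_fun_subset\<close>)
  then show ?thesis using W W' unfolding smooth_near_def by blast
qed

context
  fixes D p
  assumes D: "D \<in> tangent_space M p"
begin

lemma tangent_cong:
  "smooth_near M p f \<Longrightarrow> \<forall>\<^sub>F q in nhds p. f q = g q \<Longrightarrow> D g = D f"
  using D smooth_near_cong[of p f g] unfolding tangent_space_def by force

lemma tangent_lincomb:
  "smooth_near M p f \<Longrightarrow> smooth_near M p g \<Longrightarrow> D (\<lambda>q. a * f q + b * g q) = a * D f + b * D g"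
  using D unfolding tangent_space_def by blast

lemma tangent_mult:
  "smooth_near M p f \<Longrightarrow> smooth_near M p g \<Longrightarrow> D (\<lambda>q. f q * g q) = D f * g p + f p * D g"
  using D unfolding tangent_space_def by blast

lemma tangent_add:
  "smooth_near M p f \<Longrightarrow> smooth_near M p g \<Longrightarrow> D (\<lambda>q. f q + g q) = D f + D g"
  using tangent_lincomb[of f g 1 1] by simp

lemma tangent_diff:
  "smooth_near M p f \<Longrightarrow> smooth_near M p g \<Longrightarrow> D (\<lambda>q. f q - g q) = D f - D g"
  using tangent_lincomb[of f g 1 "- 1"] by simp

lemma tangent_const: "D (\<lambda>q. c) = 0"
proof -
  have "D (\<lambda>q. 1 * 1) = D (\<lambda>q. 1) * 1 + 1 * D (\<lambda>q. 1)"
    by (rule tangent_mult) (rule smooth_near_const)+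
  then have "D (\<lambda>q. 1) = 0" by simp
  then show ?thesis
    using tangent_lincomb[OF smooth_near_const[of p 1] smooth_near_const[of p 1], of c 0] by simp
qed

lemma tangent_sum:
  "(\<And>i. i \<in> I \<Longrightarrow> smooth_near M p (f i)) \<Longrightarrow> D (\<lambda>q. \<Sum>i\<in>I. f i q) = (\<Sum>i\<in>I. D (f i))"
  by (induction I rule: infinite_finite_induct)
    (auto simp: tangent_const tangent_add smooth_near_sum)

text \<open>
  The chain rule for derivations: the second order remainder of \<open>exp\<close> is \<open>t\<^sup>2\<close> times a smooth function,
  and a derivation kills products of functions vanishing at \<open>p\<close>.
\<close>

lemma tangent_exp:
  assumes f: "smooth_near M p f"
  shows "D (\<lambda>q. exp (f q)) = exp (f p) * D f"
proof -
  obtain G :: "real \<Rightarrow> real" where G: "smooth_real_on UNIV G" "\<And>t. exp t = 1 + t + t\<^sup>2 * G t"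
    using exp_second_order_remainder by blast
  define g where "g q = f q + - f p" for q
  have g: "smooth_near M p g"
    unfolding g_def by (intro smooth_near_add smooth_near_const f)
  have Dg: "D g = D f"
    unfolding g_def using tangent_add[OF f smooth_near_const[of p "- f p"]] by (simp add: tangent_const)
  have gG: "smooth_near M p (\<lambda>q. g q * G (g q))"
    by (rule smooth_near_mult[OF g smooth_near_compose[OF g G(1)]])
  have rem: "D (\<lambda>q. g q * (g q * G (g q))) = 0"
    unfolding tangent_mult[OF g gG] by (simp add: g_def)
  have D1: "D (\<lambda>q. 1 + g q + g q * (g q * G (g q))) = D f"
    using tangent_add[OF smooth_near_add[OF smooth_near_const[of _ 1] g] smooth_near_mult[OF g gG]]
      tangent_add[OF smooth_near_const[of _ 1] g] rem
    by (simp add: tangent_const Dg)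
  \<comment> \<open>The summand \<open>0 * f q\<close> only brings the expression into the shape of
    a linear combination of two functions, as \<open>tangent_lincomb\<close> expects.\<close>
  have expf: "(\<lambda>q. exp (f q)) = (\<lambda>q. exp (f p) * (1 + g q + g q * (g q * G (g q))) + 0 * f q)"
  proof
    fix q
    have "exp (f q) = exp (f p) * exp (g q)" by (simp add: g_def flip: exp_add)
    then show "exp (f q) = exp (f p) * (1 + g q + g q * (g q * G (g q))) + 0 * f q"
      using G(2)[of "g q"] by (simp add: power2_eq_square mult.assoc)
  qed
  have "D (\<lambda>q. exp (f p) * (1 + g q + g q * (g q * G (g q))) + 0 * f q)
      = exp (f p) * D (\<lambda>q. 1 + g q + g q * (g q * G (g q))) + 0 * D f"
    by (rule tangent_lincomb) (intro smooth_near_add smooth_near_const g smooth_near_mult gG f)+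
  also have "\<dots> = exp (f p) * D f" by (simp add: D1)
  finally show ?thesis by (rule trans[OF arg_cong[OF expf, of D]])
qed

end

end

section \<open>Alternating forms\<close>

lemma alternating_forms_lincomb:
  assumes "\<alpha> \<in> alternating_forms k V" "\<beta> \<in> alternating_forms k V"
  shows "(\<lambda>vs. a * \<alpha> vs + b * \<beta> vs) \<in> alternating_forms k V"
  using assms unfolding alternating_forms_def by (auto simp: algebra_simps)

lemma in_span_imp_lincomb:
  assumes "v \<in> span (f ` I)" "finite I" "inj_on f I"
  obtains c where "v = (\<Sum>i\<in>I. c i *\<^sub>R f i)"
proof -
  obtain u where "v = (\<Sum>w\<in>f ` I. u w *\<^sub>R w)"
    using assms by (auto simp: span_finite)
  then show thesis using assms(3) that[of "u \<circ> f"] by (simp add: sum.reindex)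
qed

lemma independent_image_lincomb_zero:
  fixes f :: "'i \<Rightarrow> 'v::real_vector"
  assumes "independent (f ` I)" "inj_on f I" "finite I" "(\<Sum>i\<in>I. c i *\<^sub>R f i) = 0" "i \<in> I"
  shows "c i = 0"
proof -
  have "(\<Sum>v\<in>f ` I. c (the_inv_into I f v) *\<^sub>R v) = (\<Sum>i\<in>I. c i *\<^sub>R f i)"
    using assms(2) by (simp add: sum.reindex the_inv_into_f_f)
  then have "c (the_inv_into I f (f i)) = 0"
    using assms by (intro independentD[OF assms(1), of "f ` I" "\<lambda>v. c (the_inv_into I f v)"]) auto
  then show ?thesis using assms by (simp add: the_inv_into_f_f)
qed

lemma nths_remove_nth: "nths vs (- {j}) = take j vs @ drop (Suc j) vs"
proof (induction vs arbitrary: j)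
  case (Cons w vs)
  show ?case
  proof (cases j)
    case 0
    then show ?thesis by (simp add: nths_Cons nths_all)
  next
    case (Suc i)
    have "{k. Suc k \<in> - {Suc i}} = - {i}" by auto
    then show ?thesis using Suc Cons[of i] by (simp add: nths_Cons)
  qed
qed simp

locale alternating_form =
  fixes k :: nat and V :: "'v::real_vector set" and \<alpha> :: "'v list \<Rightarrow> real"
  assumes subspace: "subspace V" and alternating: "\<alpha> \<in> alternating_forms k V"
begin

lemma outside: "\<not> (length vs = k \<and> set vs \<subseteq> V) \<Longrightarrow> \<alpha> vs = 0"
  and not_distinct: "\<not> distinct vs \<Longrightarrow> \<alpha> vs = 0"
  and update_lincomb: "length vs = k \<Longrightarrow> set vs \<subseteq> V \<Longrightarrow> i < k \<Longrightarrow> u \<in> V \<Longrightarrow> v \<in> V \<Longrightarrow>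
    \<alpha> (vs[i := a *\<^sub>R u + b *\<^sub>R v]) = a * \<alpha> (vs[i := u]) + b * \<alpha> (vs[i := v])"
  using alternating unfolding alternating_forms_def by blast+

lemma update_sum:
  assumes "length vs = k" "set vs \<subseteq> V" "i < k"
  shows "(\<And>j. j \<in> I \<Longrightarrow> v j \<in> V) \<Longrightarrow>
    \<alpha> (vs[i := \<Sum>j\<in>I. c j *\<^sub>R v j]) = (\<Sum>j\<in>I. c j * \<alpha> (vs[i := v j]))"
proof (induction I rule: infinite_finite_induct)
  case (insert j I)
  have "(\<Sum>j\<in>I. c j *\<^sub>R v j) \<in> V"
    using insert.prems by (auto intro!: subspace_sum[OF subspace] subspace_scale[OF subspace])
  then have "\<alpha> (vs[i := c j *\<^sub>R v j + 1 *\<^sub>R (\<Sum>j\<in>I. c j *\<^sub>R v j)])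
      = c j * \<alpha> (vs[i := v j]) + 1 * \<alpha> (vs[i := \<Sum>j\<in>I. c j *\<^sub>R v j])"
    using insert.prems assms by (intro update_lincomb) auto
  then show ?case using insert by simp
qed (use update_lincomb[OF assms subspace_0[OF subspace] subspace_0[OF subspace], of 0 0] in auto)

lemma middle_sum:
  assumes "\<And>j. j \<in> I \<Longrightarrow> v j \<in> V"
    and "length us + length zs + 1 = k" "set us \<subseteq> V" "set zs \<subseteq> V"
  shows "\<alpha> (us @ (\<Sum>j\<in>I. c j *\<^sub>R v j) # zs) = (\<Sum>j\<in>I. c j * \<alpha> (us @ v j # zs))"
  using update_sum[of "us @ 0 # zs" "length us" I v c] assms subspace_0[OF subspace] by simp

lemma middle_add:
  assumes "x \<in> V" "y \<in> V" "length us + length zs + 1 = k" "set us \<subseteq> V" "set zs \<subseteq> V"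
  shows "\<alpha> (us @ (x + y) # zs) = \<alpha> (us @ x # zs) + \<alpha> (us @ y # zs)"
  using update_lincomb[of "us @ 0 # zs" "length us" x y 1 1] assms subspace_0[OF subspace] by simp

text \<open>Polarisation: expand the vanishing value with \<open>x + y\<close> in both slots. For
  lists that are not admissible both sides are zero by convention.\<close>

lemma swap: "\<alpha> (us @ x # y # zs) = - \<alpha> (us @ y # x # zs)"
proof (cases "length us + length zs + 2 = k \<and> set (x # y # us @ zs) \<subseteq> V")
  case True
  then have xy: "x + y \<in> V" using subspace_add[OF subspace] by auto
  have "0 = \<alpha> (us @ (x + y) # (x + y) # zs)" by (simp add: not_distinct)
  also have "\<dots> = \<alpha> (us @ x # (x + y) # zs) + \<alpha> (us @ y # (x + y) # zs)"
    using True xy by (intro middle_add) auto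
  also have "\<alpha> (us @ x # (x + y) # zs) = \<alpha> (us @ x # x # zs) + \<alpha> (us @ x # y # zs)"
    using True middle_add[of x y "us @ [x]" zs] by simp
  also have "\<alpha> (us @ y # (x + y) # zs) = \<alpha> (us @ y # x # zs) + \<alpha> (us @ y # y # zs)"
    using True middle_add[of x y "us @ [y]" zs] by simp
  finally show ?thesis by (simp add: not_distinct)
next
  case False
  then show ?thesis
    using outside[of "us @ x # y # zs"] outside[of "us @ y # x # zs"] by auto
qed

lemma move: "\<alpha> (us @ x # ys @ zs) = (- 1) ^ length ys * \<alpha> (us @ ys @ x # zs)"
proof (induction ys arbitrary: us)
  case (Cons y ys)
  show ?case using swap[of us x y "ys @ zs"] Cons[of "us @ [y]"] by simp
qed simp

text \<open>The Koszul formula puts a bracket in front of a list with one entry removed. Moving the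
  head back into the gap passes \<open>j\<close> entries and so absorbs exactly the sign attached to
  that term.\<close>

lemma update_eq_head:
  assumes "j < length vs"
  shows "(- 1) ^ j * \<alpha> (v # nths vs (- {j})) = \<alpha> (vs[j := v])"
proof -
  show ?thesis
    using move[of "[]" v "take j vs" "drop (Suc j) vs"] assms
    by (simp add: nths_remove_nth upd_conv_take_nth_drop mult.assoc[symmetric] flip: power_mult_distrib)
qed

text \<open>Claiming only that both values vanish together avoids the sign of the permutation. The
  fixed prefix \<open>us\<close> lets the induction strip off heads.\<close>

lemma zero_iff_perm: "mset xs = mset ys \<Longrightarrow> \<alpha> (us @ xs) = 0 \<longleftrightarrow> \<alpha> (us @ ys) = 0"
proof (induction xs arbitrary: us ys)
  case (Cons x xs)
  then have "x \<in> set ys" by (metis list.set_intros(1) set_mset_mset)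
  then obtain ys1 ys2 where ys: "ys = ys1 @ x # ys2" by (meson split_list)
  then have "mset xs = mset (ys1 @ ys2)" using Cons.prems by simp
  from Cons.IH[OF this, of "us @ [x]"] show ?case
    using move[of us x ys1 ys2] ys by simp
qed simp

text \<open>Arguments are expanded in the basis one at a time from the right, until only basis
  vectors are left. Then either an index repeats, and the form vanishes, or the list is a
  permutation of the basis.\<close>

lemma zero_if_zero_on_basis:
  assumes "span (e ` {..<k}) = V" "inj_on e {..<k}" "\<alpha> (map e [0..<k]) = 0"
  shows "\<alpha> vs = 0"
proof -
  have eV: "e i \<in> V" if "i < k" for i
    using assms(1) span_base[of "e i" "e ` {..<k}"] that by auto
  have *: "\<alpha> (us @ map e ns) = 0"
    if "set us \<subseteq> V" "set ns \<subseteq> {..<k}" "length us + length ns = k" for us ns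
    using that
  proof (induction us arbitrary: ns rule: rev_induct)
    case Nil
    show ?case
    proof (cases "distinct ns")
      case True
      \<comment> \<open>Here the degree equals the dimension: \<open>k\<close> distinct indices
        below \<open>k\<close> exhaust all of them.\<close>
      then have "set ns = {..<k}"
        using Nil by (intro card_subset_eq) (auto simp: distinct_card)
      then have "mset ns = mset [0..<k]"
        using True set_eq_iff_mset_eq_distinct[of ns "[0..<k]"] by (simp add: atLeast0LessThan)
      then have "mset (map e ns) = mset (map e [0..<k])" by (metis mset_map)
      from zero_iff_perm[OF this, of "[]"] show ?thesis using assms(3) by simp
    next
      case False
      then show ?thesis using not_distinct[of "map e ns"] by (simp add: distinct_map)
    qed
  next
    case (snoc u us)
    obtain c where c: "u = (\<Sum>i<k. c i *\<^sub>R e i)"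
      using in_span_imp_lincomb[of u e "{..<k}"] snoc.prems assms by auto
    have "\<alpha> (us @ u # map e ns) = (\<Sum>i<k. c i * \<alpha> (us @ e i # map e ns))"
      unfolding c by (rule middle_sum) (use snoc.prems eV in auto)
    also have "\<dots> = 0"
    proof (rule sum.neutral, rule ballI)
      fix i assume "i \<in> {..<k}"
      then show "c i * \<alpha> (us @ e i # map e ns) = 0"
        using snoc.IH[of "i # ns"] snoc.prems by simp
    qed
    finally show ?case by simp
  qed
  show ?thesis
    using *[of vs "[]"] outside[of vs] by auto
qed

end

text \<open>The difference of \<open>\<alpha>\<close> and the stated multiple of
  \<open>\<beta>\<close> is again alternating and vanishes on the basis, hence everywhere.\<close>

lemma top_forms_proportional:
  assumes "subspace V" "\<alpha> \<in> alternating_forms k V" "\<beta> \<in> alternating_forms k V"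
    and "span (e ` {..<k}) = V" "inj_on e {..<k}" "\<beta> (map e [0..<k]) \<noteq> 0"
  shows "\<alpha> vs = \<alpha> (map e [0..<k]) / \<beta> (map e [0..<k]) * \<beta> vs"
proof -
  let ?c = "\<alpha> (map e [0..<k]) / \<beta> (map e [0..<k])"
  interpret alternating_form k V "\<lambda>vs. 1 * \<alpha> vs + (- ?c) * \<beta> vs"
    by (rule alternating_form.intro[OF assms(1) alternating_forms_lincomb[OF assms(2,3)]])
  show ?thesis using zero_if_zero_on_basis[OF assms(4,5), of vs] assms(6) by simp
qed

section \<open>Sections of vector bundles\<close>

locale vector_bundle_on = smooth_mfd M
  for M :: "'m::{t2_space, second_countable_topology} smooth_structure" +
  fixes E :: "('m, 'v::real_vector, 'z) vbundle_scheme"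
  assumes vector_bundle: "vector_bundle M E"
begin

lemma frame_at: obtains W e where "(W, e) \<in> frames E" "p \<in> W"
proof -
  have "p \<in> (\<Union>(U, e)\<in>frames E. U)" using vector_bundle unfolding vector_bundle_def by simp
  then show thesis using that by auto
qed

context
  fixes W e
  assumes frame: "(W, e) \<in> frames E"
begin

lemmas frame_properties =
  bspec[OF vector_bundle[unfolded vector_bundle_def, THEN conjunct2] frame, unfolded prod.case]

lemma frame_open: "open W"
  using frame_properties by (rule conjunct1)

lemma frame_inj: "p \<in> W \<Longrightarrow> inj_on (\<lambda>i. e i p) {..<rank E}"
  and frame_independent: "p \<in> W \<Longrightarrow> independent ((\<lambda>i. e i p) ` {..<rank E})"
  and frame_span: "p \<in> W \<Longrightarrow> span ((\<lambda>i. e i p) ` {..<rank E}) = fibre E p"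
  and frame_sections: "i < rank E \<Longrightarrow> e i \<in> sections M E W"
  using frame_properties by auto

lemma frame_in_fibre: "i < rank E \<Longrightarrow> p \<in> W \<Longrightarrow> e i p \<in> fibre E p"
  using frame_span[of p] span_base[of "e i p" "(\<lambda>i. e i p) ` {..<rank E}"] by auto

end

lemma subspace_fibre: "subspace (fibre E p)"
  by (metis frame_at frame_span subspace_span)

text \<open>The chosen coefficients are determined only for vectors of the fibre and indices below
  \<open>rank E\<close>, by independence of the frame; all other values are arbitrary.\<close>

definition coord :: "(nat \<Rightarrow> 'm \<Rightarrow> 'v) \<Rightarrow> 'm \<Rightarrow> 'v \<Rightarrow> nat \<Rightarrow> real" where
  "coord e p v = (SOME c. v = (\<Sum>i<rank E. c i *\<^sub>R e i p))"

lemma coord_eq: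
  assumes "(W, e) \<in> frames E" "p \<in> W" "v \<in> fibre E p"
  shows "v = (\<Sum>i<rank E. coord e p v i *\<^sub>R e i p)"
proof -
  have "\<exists>c. v = (\<Sum>i<rank E. c i *\<^sub>R e i p)"
    using in_span_imp_lincomb[OF _ _ frame_inj[OF assms(1,2)], of v] assms frame_span[OF assms(1,2)] by auto
  then show ?thesis unfolding coord_def by (rule someI_ex)
qed

lemma coord_lincomb:
  assumes "(W, e) \<in> frames E" "p \<in> W" "i < rank E"
  shows "coord e p (\<Sum>i<rank E. c i *\<^sub>R e i p) i = c i"
proof -
  have "(\<Sum>i<rank E. c i *\<^sub>R e i p) \<in> fibre E p"
    using frame_in_fibre[OF assms(1)] assms(2)
    by (auto intro!: subspace_sum[OF subspace_fibre] subspace_scale[OF subspace_fibre])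
  from coord_eq[OF assms(1,2) this]
  have "(\<Sum>i<rank E. (c i - coord e p (\<Sum>i<rank E. c i *\<^sub>R e i p) i) *\<^sub>R e i p) = 0"
    by (simp add: algebra_simps sum_subtractf)
  from independent_image_lincomb_zero[OF frame_independent[OF assms(1,2)] frame_inj[OF assms(1,2)] _ this]
  show ?thesis using assms(3) by simp
qed

lemma coord_add_scale:
  assumes "(W, e) \<in> frames E" "p \<in> W" "u \<in> fibre E p" "v \<in> fibre E p" "i < rank E"
  shows "coord e p (a *\<^sub>R u + b *\<^sub>R v) i = a * coord e p u i + b * coord e p v i"
proof -
  have "a *\<^sub>R u + b *\<^sub>R v = (\<Sum>i<rank E. (a * coord e p u i + b * coord e p v i) *\<^sub>R e i p)"
    using coord_eq[OF assms(1,2,3)] coord_eq[OF assms(1,2,4)]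
    by (simp add: scaleR_add_left sum.distrib scaleR_sum_right[symmetric] flip: scaleR_scaleR)
  then show ?thesis using coord_lincomb[OF assms(1,2,5)] by simp
qed

text \<open>Membership in \<open>sections\<close> offers some smooth coefficients, possibly
  different ones for each open set. Replacing them by the canonical \<open>coord\<close> makes the
  condition local, so that sections can be glued.\<close>

lemma sections_iff:
  assumes "open U"
  shows "X \<in> sections M E U \<longleftrightarrow> (\<forall>p\<in>U. X p \<in> fibre E p) \<and>
    (\<forall>(W, e)\<in>frames E. \<forall>i<rank E. smooth_fun M (U \<inter> W) (\<lambda>p. coord e p (X p) i))"
    (is "_ \<longleftrightarrow> ?R")
proof
  assume X: "X \<in> sections M E U"
  have "smooth_fun M (U \<inter> W) (\<lambda>p. coord e p (X p) i)"
    if f: "(W, e) \<in> frames E" and i: "i < rank E" for W e i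
  proof -
    obtain c where c: "\<And>i. i<rank E \<Longrightarrow> smooth_fun M (U \<inter> W) (c i)"
      "\<And>p. p\<in>U \<inter> W \<Longrightarrow> X p = (\<Sum>i<rank E. c i p *\<^sub>R e i p)"
      using X f unfolding sections_def by blast
    show ?thesis
      by (rule smooth_fun_cong[OF c(1)[OF i]])
        (use assms frame_open[OF f] coord_lincomb[OF f _ i] c(2) in auto)
  qed
  then show ?R using X unfolding sections_def by blast
next
  assume R: ?R
  show "X \<in> sections M E U"
    unfolding sections_def
  proof (intro CollectI conjI ballI)
    fix z assume z: "z \<in> frames E"
    obtain W e where We: "z = (W, e)" by fastforce
    show "case z of (W, e) \<Rightarrow> \<exists>c. (\<forall>i<rank E. smooth_fun M (U \<inter> W) (c i)) \<and>
        (\<forall>p\<in>U \<inter> W. X p = (\<Sum>i<rank E. c i p *\<^sub>R e i p))"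
      unfolding We prod.case
      using R z We coord_eq[of W e] by (intro exI[of _ "\<lambda>i p. coord e p (X p) i"]) auto
  qed (use R in auto)
qed

lemma sections_in_fibre: "X \<in> sections M E U \<Longrightarrow> p \<in> U \<Longrightarrow> X p \<in> fibre E p"
  unfolding sections_def by blast

lemma smooth_fun_coord:
  "X \<in> sections M E U \<Longrightarrow> open U \<Longrightarrow> (W, e) \<in> frames E \<Longrightarrow> i < rank E \<Longrightarrow>
    smooth_fun M (U \<inter> W) (\<lambda>p. coord e p (X p) i)"
  using sections_iff by blast

lemma sections_local:
  assumes "open U" "\<And>p. p \<in> U \<Longrightarrow> \<exists>U'. open U' \<and> p \<in> U' \<and> X \<in> sections M E U'"
  shows "X \<in> sections M E U"
  unfolding sections_iff[OF assms(1)]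
proof (intro conjI ballI, goal_cases)
  case (1 p)
  then show ?case using assms(2) sections_in_fibre by blast
next
  case (2 z)
  obtain W e where z: "z = (W, e)" by fastforce
  have f: "(W, e) \<in> frames E" using 2 z by simp
  show ?case
    unfolding z prod.case
  proof (intro allI impI)
    fix i assume i: "i < rank E"
    show "smooth_fun M (U \<inter> W) (\<lambda>p. coord e p (X p) i)"
    proof (rule smooth_fun_local)
      fix p assume p: "p \<in> U \<inter> W"
      then obtain U' where U': "open U'" "p \<in> U'" "X \<in> sections M E U'" using assms(2) by blast
      then show "\<exists>W'. open W' \<and> p \<in> W' \<and> smooth_fun M W' (\<lambda>p. coord e p (X p) i)"
        using p smooth_fun_coord[OF U'(3,1) f i] frame_open[OF f] by (intro exI[of _ "U' \<inter> W"]) auto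
    qed (use assms(1) frame_open[OF f] in auto)
  qed
qed

lemma sections_cong:
  assumes "X \<in> sections M E U" "open U" "\<And>p. p \<in> U \<Longrightarrow> X p = Y p"
  shows "Y \<in> sections M E U"
  using assms(1,3) unfolding sections_def by auto

lemma sections_lincomb:
  assumes "open U" "X \<in> sections M E U" "Y \<in> sections M E U" "smooth_fun M U f" "smooth_fun M U g"
  shows "(\<lambda>p. f p *\<^sub>R X p + g p *\<^sub>R Y p) \<in> sections M E U"
  unfolding sections_iff[OF assms(1)]
proof (intro conjI ballI, goal_cases)
  case (1 p)
  then show ?case using assms sections_in_fibre
    by (auto intro!: subspace_add[OF subspace_fibre] subspace_scale[OF subspace_fibre])
next
  case (2 z)
  obtain W e where z: "z = (W, e)" by fastforce
  have fr: "(W, e) \<in> frames E" using 2 z by simp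
  have o: "open (U \<inter> W)" using assms(1) frame_open[OF fr] by auto
  show ?case
    unfolding z prod.case
  proof (intro allI impI)
    fix i assume i: "i < rank E"
    have "smooth_fun M (U \<inter> W) (\<lambda>p. f p * coord e p (X p) i + g p * coord e p (Y p) i)"
      by (intro smooth_fun_add smooth_fun_mult o smooth_fun_coord assms fr i)
        (use assms in \<open>auto intro: smooth_fun_subset\<close>)
    then show "smooth_fun M (U \<inter> W) (\<lambda>p. coord e p (f p *\<^sub>R X p + g p *\<^sub>R Y p) i)"
      by (rule smooth_fun_cong[OF _ o])
        (use coord_add_scale[OF fr _ _ _ i] assms sections_in_fibre in auto)
  qed
qed

lemma sections_zero: "open U \<Longrightarrow> (\<lambda>p. 0) \<in> sections M E U"
  unfolding sections_def using subspace_0[OF subspace_fibre] frame_open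
  by (auto intro!: exI[of _ "\<lambda>i p. 0"] smooth_fun_const)

lemma sections_scale:
  "open U \<Longrightarrow> X \<in> sections M E U \<Longrightarrow> smooth_fun M U f \<Longrightarrow> (\<lambda>p. f p *\<^sub>R X p) \<in> sections M E U"
  using sections_lincomb[of U X X f "\<lambda>p. 0"] by (simp add: smooth_fun_const)

lemma sections_add:
  "open U \<Longrightarrow> X \<in> sections M E U \<Longrightarrow> Y \<in> sections M E U \<Longrightarrow> (\<lambda>p. X p + Y p) \<in> sections M E U"
  using sections_lincomb[of U X Y "\<lambda>p. 1" "\<lambda>p. 1"] by (simp add: smooth_fun_const)

lemma sections_sum:
  "open U \<Longrightarrow> (\<And>i. i \<in> I \<Longrightarrow> X i \<in> sections M E U) \<Longrightarrow> (\<And>i. i \<in> I \<Longrightarrow> smooth_fun M U (f i)) \<Longrightarrow>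
    (\<lambda>p. \<Sum>i\<in>I. f i p *\<^sub>R X i p) \<in> sections M E U"
proof (induction I rule: infinite_finite_induct)
  case (insert j I)
  have "(\<lambda>p. f j p *\<^sub>R X j p) \<in> sections M E U"
    using insert.prems by (intro sections_scale) auto
  from sections_add[OF _ this, of "\<lambda>p. \<Sum>i\<in>I. f i p *\<^sub>R X i p"] show ?case
    using insert by simp
qed (auto intro: sections_zero)

lemma sections_extend:
  assumes "smooth_fun M UNIV b" "closed K" "K \<subseteq> W" "\<And>q. q \<notin> K \<Longrightarrow> b q = 0"
    "open W" "X \<in> sections M E W"
  shows "(\<lambda>q. if q \<in> W then b q *\<^sub>R X q else 0) \<in> Sec M E"
proof (rule sections_local)
  fix p :: 'm
  let ?X = "\<lambda>q. if q \<in> W then b q *\<^sub>R X q else 0"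
  have "(\<lambda>q. b q *\<^sub>R X q) \<in> sections M E W"
    using assms by (intro sections_scale) (auto intro: smooth_fun_subset)
  then have "?X \<in> sections M E W"
    by (rule sections_cong) (use assms in auto)
  moreover have "?X \<in> sections M E (- K)"
    by (rule sections_cong[OF sections_zero]) (use assms in auto)
  ultimately show "\<exists>W'. open W' \<and> p \<in> W' \<and> ?X \<in> sections M E W'"
    using assms by (cases "p \<in> W") (auto simp: open_Compl)
qed simp

text \<open>Supplies global sections to which brackets and divergences apply. Agreement on the
  neighbourhood \<open>N\<close> gives equal germs at \<open>p\<close>, hence equal derivatives
  there.\<close>

lemma frame_extends:
  assumes "(W, e) \<in> frames E" "p \<in> W"
  obtains Y N where "\<And>i. i < rank E \<Longrightarrow> Y i \<in> Sec M E" "open N" "p \<in> N" "N \<subseteq> W"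
    "\<And>i q. q \<in> N \<Longrightarrow> Y i q = e i q"
proof -
  have W: "open W" by (rule frame_open[OF assms(1)])
  obtain b K N where b: "smooth_fun M UNIV b" "closed K" "K \<subseteq> W" "\<And>q. q \<notin> K \<Longrightarrow> b q = 0"
    and N: "open N" "p \<in> N" "\<And>q. q \<in> N \<Longrightarrow> b q = 1"
    using bump_function[OF W assms(2)] by metis
  define Y where "Y i q = (if q \<in> W then b q *\<^sub>R e i q else 0)" for i q
  have "N \<subseteq> W" using b(3,4) N(3) by fastforce
  moreover have "Y i \<in> Sec M E" if "i < rank E" for i
    unfolding Y_def using sections_extend[OF b W frame_sections[OF assms(1) that]] .
  moreover have "Y i q = e i q" if "q \<in> N" for i q
    using that N(3) \<open>N \<subseteq> W\<close> by (auto simp: Y_def)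
  ultimately show thesis using N that[of Y N] by blast
qed

lemma section_through:
  assumes "v \<in> fibre E p"
  obtains X where "X \<in> Sec M E" "X p = v"
proof -
  obtain W e where f: "(W, e) \<in> frames E" "p \<in> W" using frame_at .
  obtain Y N where Y: "\<And>i. i < rank E \<Longrightarrow> Y i \<in> Sec M E" "p \<in> N" "\<And>i q. q \<in> N \<Longrightarrow> Y i q = e i q"
    using frame_extends[OF f] by metis
  have "(\<lambda>q. \<Sum>i<rank E. coord e p v i *\<^sub>R Y i q) \<in> Sec M E"
    by (intro sections_sum smooth_fun_const) (use Y(1) in auto)
  moreover have "(\<Sum>i<rank E. coord e p v i *\<^sub>R Y i p) = v"
    using coord_eq[OF f assms] Y(2,3) by simp
  ultimately show thesis using that by blast
qed

text \<open>Let the \<open>c i\<close> be the coordinates of \<open>X\<close>. Then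
  \<open>b * b * X\<close> is the global sum of the sections \<open>(b * c i) * (b * e i)\<close>:
  one factor \<open>b\<close> extends the coefficient, the other the frame vector. At
  \<open>p\<close> one has \<open>b = 1\<close> and every coefficient is zero.\<close>

lemma tensorial_vanishing:
  fixes \<Delta> :: "('m \<Rightarrow> 'v) \<Rightarrow> 'm \<Rightarrow> real"
  assumes add: "\<And>X Y. X \<in> Sec M E \<Longrightarrow> Y \<in> Sec M E \<Longrightarrow> \<Delta> (\<lambda>q. X q + Y q) p = \<Delta> X p + \<Delta> Y p"
    and scale: "\<And>X f. X \<in> Sec M E \<Longrightarrow> smooth_fun M UNIV f \<Longrightarrow> \<Delta> (\<lambda>q. f q *\<^sub>R X q) p = f p * \<Delta> X p"
    and X: "X \<in> Sec M E" "X p = 0"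
  shows "\<Delta> X p = 0"
proof -
  obtain W e where f: "(W, e) \<in> frames E" "p \<in> W" using frame_at .
  have W: "open W" by (rule frame_open[OF f(1)])
  obtain b K N where b: "smooth_fun M UNIV b" "closed K" "K \<subseteq> W" "\<And>q. q \<notin> K \<Longrightarrow> b q = 0"
    and N: "open N" "p \<in> N" "\<And>q. q \<in> N \<Longrightarrow> b q = 1"
    using bump_function[OF W f(2)] by metis
  define Y where "Y i q = (if q \<in> W then b q *\<^sub>R e i q else 0)" for i q
  define g where "g i q = (if q \<in> W then b q * coord e q (X q) i else 0)" for i q
  have Y: "Y i \<in> Sec M E" if "i < rank E" for i
    unfolding Y_def using sections_extend[OF b W frame_sections[OF f(1) that]] .
  have g: "smooth_fun M UNIV (g i)" if "i < rank E" for i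
    unfolding g_def using smooth_fun_extend[OF b W] smooth_fun_coord[OF X(1) _ f(1) that] by simp
  have sum0: "\<Delta> (\<lambda>q. 0) p = 0"
    using scale[OF sections_zero smooth_fun_const[of UNIV 0]] by simp
  have sum_eq: "\<Delta> (\<lambda>q. \<Sum>i<n. g i q *\<^sub>R Y i q) p = (\<Sum>i<n. g i p * \<Delta> (Y i) p)" if "n \<le> rank E" for n
    using that
  proof (induction n)
    case (Suc n)
    have "(\<lambda>q. \<Sum>i<n. g i q *\<^sub>R Y i q) \<in> Sec M E"
      using Suc.prems by (intro sections_sum Y g) auto
    then show ?case
      using Suc add[of "\<lambda>q. \<Sum>i<n. g i q *\<^sub>R Y i q" "\<lambda>q. g n q *\<^sub>R Y n q"]
        scale[of "Y n" "g n"] sections_scale[of UNIV "Y n" "g n"] Y g by simp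
  qed (simp add: sum0)
  have "(\<lambda>q. \<Sum>i<rank E. g i q *\<^sub>R Y i q) = (\<lambda>q. (b q * b q) *\<^sub>R X q)"
  proof
    fix q
    show "(\<Sum>i<rank E. g i q *\<^sub>R Y i q) = (b q * b q) *\<^sub>R X q"
    proof (cases "q \<in> W")
      case True
      have "(\<Sum>i<rank E. g i q *\<^sub>R Y i q) = (b q * b q) *\<^sub>R (\<Sum>i<rank E. coord e q (X q) i *\<^sub>R e i q)"
        using True by (simp add: g_def Y_def scaleR_sum_right mult_ac)
      also have "(\<Sum>i<rank E. coord e q (X q) i *\<^sub>R e i q) = X q"
        using coord_eq[OF f(1) True sections_in_fibre[OF X(1)]] by simp
      finally show ?thesis .
    next
      case False
      then have "b q = 0" using b(3,4) by blast
      then show ?thesis using False by (simp add: g_def)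
    qed
  qed
  moreover have "(\<Sum>i<rank E. g i p * \<Delta> (Y i) p) = 0"
  proof (rule sum.neutral, rule ballI)
    fix i assume "i \<in> {..<rank E}"
    then have "g i p = 0"
      using coord_lincomb[OF f, of i "\<lambda>i. 0"] X(2) by (simp add: g_def)
    then show "g i p * \<Delta> (Y i) p = 0" by simp
  qed
  moreover have "\<Delta> (\<lambda>q. (b q * b q) *\<^sub>R X q) p = \<Delta> X p"
    using scale[OF X(1) smooth_fun_mult[OF _ b(1,1)]] N(2,3) by simp
  ultimately show ?thesis using sum_eq[OF order_refl] by simp
qed

section \<open>Forms evaluated on global sections\<close>

lemma form_alternating_form:
  "\<omega> \<in> forms M E k U \<Longrightarrow> p \<in> U \<Longrightarrow> alternating_form k (fibre E p) (\<omega> p)"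
  by unfold_locales (auto simp: forms_def subspace_fibre)

text \<open>By definition a form is smooth on frame vectors only. The sections in the list are
  expanded in the frame from the right, one at a time, with smooth coefficients; the index list
  \<open>ns\<close> collects the slots already expanded.\<close>

lemma smooth_fun_ev:
  assumes \<omega>: "\<omega> \<in> forms M E k U" and U: "open U"
    and Xs: "set Xs \<subseteq> Sec M E" "length Xs = k"
  shows "smooth_fun M U (ev \<omega> Xs)"
proof (rule smooth_fun_local[OF U])
  fix p assume p: "p \<in> U"
  obtain W e where f: "(W, e) \<in> frames E" "p \<in> W" using frame_at .
  have o: "open (U \<inter> W)" using U frame_open[OF f(1)] by auto
  have "smooth_fun M (U \<inter> W) (\<lambda>p. \<omega> p (map (\<lambda>X. X p) Xs @ map (\<lambda>i. e i p) ns))"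
    if "set Xs \<subseteq> Sec M E" "set ns \<subseteq> {..<rank E}" "length Xs + length ns = k" for Xs ns
    using that
  proof (induction Xs arbitrary: ns rule: rev_induct)
    case Nil
    then show ?case using \<omega> f(1) unfolding forms_def by auto
  next
    case (snoc X Xs)
    have X: "X \<in> Sec M E" using snoc.prems by simp
    have "smooth_fun M (U \<inter> W)
        (\<lambda>q. \<Sum>i<rank E. coord e q (X q) i * \<omega> q (map (\<lambda>X. X q) Xs @ map (\<lambda>i. e i q) (i # ns)))"
    proof (intro smooth_fun_sum o smooth_fun_mult)
      fix i assume i: "i \<in> {..<rank E}"
      show "smooth_fun M (U \<inter> W) (\<lambda>q. coord e q (X q) i)"
        using smooth_fun_coord[OF X _ f(1), of i] i by (auto intro: smooth_fun_subset)
      show "smooth_fun M (U \<inter> W) (\<lambda>q. \<omega> q (map (\<lambda>X. X q) Xs @ map (\<lambda>i. e i q) (i # ns)))"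
        using snoc.prems i by (intro snoc.IH) auto
    qed
    then show ?case
    proof (rule smooth_fun_cong[OF _ o])
      fix q assume q: "q \<in> U \<inter> W"
      interpret alternating_form k "fibre E q" "\<omega> q"
        using form_alternating_form[OF \<omega>] q by simp
      have "X q = (\<Sum>i<rank E. coord e q (X q) i *\<^sub>R e i q)"
        using coord_eq[OF f(1)] q sections_in_fibre[OF X] by auto
      moreover have "\<omega> q (map (\<lambda>X. X q) Xs @ (\<Sum>i<rank E. coord e q (X q) i *\<^sub>R e i q) # map (\<lambda>i. e i q) ns)
        = (\<Sum>i<rank E. coord e q (X q) i * \<omega> q (map (\<lambda>X. X q) Xs @ e i q # map (\<lambda>i. e i q) ns))"
        using snoc.prems q frame_in_fibre[OF f(1), of _ q] sections_in_fibre[of _ UNIV q]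
        by (intro middle_sum) auto
      ultimately show "(\<Sum>i<rank E. coord e q (X q) i * \<omega> q (map (\<lambda>X. X q) Xs @ map (\<lambda>i. e i q) (i # ns)))
          = \<omega> q (map (\<lambda>X. X q) (Xs @ [X]) @ map (\<lambda>i. e i q) ns)"
        by simp
    qed
  qed
  from this[of Xs "[]"] have "smooth_fun M (U \<inter> W) (ev \<omega> Xs)"
    using Xs unfolding ev_def by simp
  then show "\<exists>W'. open W' \<and> p \<in> W' \<and> smooth_fun M W' (ev \<omega> Xs)"
    using o p f(2) by blast
qed

lemma top_form_frame_nonzero:
  assumes "\<mu> \<in> alternating_forms (rank E) (fibre E p)" "\<mu> \<noteq> (\<lambda>vs. 0)" "(W, e) \<in> frames E" "p \<in> W"
  shows "\<mu> (map (\<lambda>i. e i p) [0..<rank E]) \<noteq> 0"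
proof
  interpret alternating_form "rank E" "fibre E p" \<mu>
    using assms(1) by unfold_locales (auto simp: subspace_fibre)
  assume "\<mu> (map (\<lambda>i. e i p) [0..<rank E]) = 0"
  then have "\<mu> vs = 0" for vs
    by (rule zero_if_zero_on_basis[OF frame_span[OF assms(3,4)] frame_inj[OF assms(3,4)]])
  then show False using assms(2) by auto
qed

end

section \<open>Divergences on Lie algebroids\<close>

lemma nths_Cons_remove: "nths (x # xs) (- {0}) = xs"
  "nths (x # xs) (- {Suc i}) = x # nths xs (- {i})"
  "nths (x # xs) (- {0, Suc j}) = nths xs (- {j})"
  "nths (x # xs) (- {Suc i, Suc j}) = x # nths xs (- {i, j})"
proof -
  have *: "{k. Suc k \<in> - {0}} = UNIV" "{k. Suc k \<in> - {Suc i}} = - {i}"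
    "{k. Suc k \<in> - {0, Suc j}} = - {j}" "{k. Suc k \<in> - {Suc i, Suc j}} = - {i, j}" by auto
  show "nths (x # xs) (- {0}) = xs"
    "nths (x # xs) (- {Suc i}) = x # nths xs (- {i})"
    "nths (x # xs) (- {0, Suc j}) = nths xs (- {j})"
    "nths (x # xs) (- {Suc i, Suc j}) = x # nths xs (- {i, j})"
    unfolding nths_Cons * by (auto simp: nths_all)
qed

text \<open>Splitting off index 0 in the second half of Cartan's formula makes the anchor terms of
  the entries of \<open>Xs\<close> cancel. Here \<open>\<omega>\<close> is an arbitrary function of
  lists, so the terms with a bracket of two entries remain as pairs; antisymmetry removes them in
  \<open>lie_derivative_ev\<close>.\<close>

lemma lie_derivative_expand:
  "lie_derivative E X \<omega> Xs p = act E X (\<omega> Xs) p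
    - (\<Sum>j<length Xs. (- 1) ^ j * \<omega> (bracket E X (Xs ! j) # nths Xs (- {j})) p)
    + (\<Sum>j<length Xs. \<Sum>i<j. (- 1) ^ (i + j) *
        (\<omega> (X # bracket E (Xs ! i) (Xs ! j) # nths Xs (- {i, j})) p
          + \<omega> (bracket E (Xs ! i) (Xs ! j) # X # nths Xs (- {i, j})) p))"
  unfolding lie_derivative_def contr_def dE_def list.size(4)
  by (simp add: sum.lessThan_Suc_shift nths_Cons_remove sum.distrib sum_negf sum_subtractf distrib_left
      del: sum.lessThan_Suc)

locale lie_algebroid_on = smooth_mfd M
  for M :: "'m::{t2_space, second_countable_topology} smooth_structure" +
  fixes E :: "('m, 'v::real_vector) algebroid"
  assumes lie_algebroid: "lie_algebroid M E"

sublocale lie_algebroid_on \<subseteq> vector_bundle_on M E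
  using lie_algebroid by unfold_locales (simp add: lie_algebroid_def)

context lie_algebroid_on
begin

lemmas algebroid_axioms = lie_algebroid[unfolded lie_algebroid_def]
lemmas anchor_axioms =
  algebroid_axioms[THEN conjunct2, THEN conjunct1, unfolded anchor_morphism_def]
lemmas anchor_lincomb = anchor_axioms[THEN conjunct2, THEN conjunct1, rule_format]
lemmas bracket_closed = algebroid_axioms[THEN conjunct2, THEN conjunct2, THEN conjunct1, rule_format]
lemmas bracket_lincomb_right = algebroid_axioms[THEN conjunct2, THEN conjunct2, THEN conjunct2, THEN conjunct1, rule_format]
lemmas bracket_antisym = algebroid_axioms[THEN conjunct2, THEN conjunct2, THEN conjunct2, THEN conjunct2, THEN conjunct1, rule_format]
lemmas jacobi = algebroid_axioms[THEN conjunct2, THEN conjunct2, THEN conjunct2, THEN conjunct2, THEN conjunct2, THEN conjunct1, rule_format]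
lemmas bracket_scale_right = algebroid_axioms[THEN conjunct2, THEN conjunct2, THEN conjunct2, THEN conjunct2, THEN conjunct2, THEN conjunct2, THEN conjunct1, rule_format]
lemmas act_bracket = algebroid_axioms[THEN conjunct2, THEN conjunct2, THEN conjunct2, THEN conjunct2, THEN conjunct2, THEN conjunct2, THEN conjunct2, rule_format, OF _ _ conjI]

lemma anchor_tangent: "X \<in> Sec M E \<Longrightarrow> anchor E p (X p) \<in> tangent_space M p"
  using anchor_axioms[THEN conjunct1, rule_format] sections_in_fibre by blast

lemma act_frame_smooth:
  assumes "(U, e) \<in> frames E" "i < rank E" "open W" "smooth_fun M W f"
  shows "smooth_fun M (U \<inter> W) (act E (e i) f)"
  using bspec[OF anchor_axioms[THEN conjunct2, THEN conjunct2] assms(1)] assms(2-) by simp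

lemma bracket_lincomb_left:
  assumes "X \<in> Sec M E" "Y \<in> Sec M E" "Z \<in> Sec M E"
  shows "bracket E (\<lambda>p. a *\<^sub>R X p + b *\<^sub>R Y p) Z p = a *\<^sub>R bracket E X Z p + b *\<^sub>R bracket E Y Z p"
proof -
  have "(\<lambda>p. a *\<^sub>R X p + b *\<^sub>R Y p) \<in> Sec M E"
    using assms by (intro sections_lincomb smooth_fun_const) auto
  from bracket_antisym[OF assms(3) this]
  have "bracket E (\<lambda>p. a *\<^sub>R X p + b *\<^sub>R Y p) Z p = - bracket E Z (\<lambda>p. a *\<^sub>R X p + b *\<^sub>R Y p) p" by simp
  then show ?thesis
    using bracket_lincomb_right[OF assms(3,1,2)] bracket_antisym[OF assms(1,3)] bracket_antisym[OF assms(2,3)]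
    by simp
qed

lemma bracket_scale_left:
  assumes "X \<in> Sec M E" "Y \<in> Sec M E" "smooth_fun M UNIV f"
  shows "bracket E (\<lambda>p. f p *\<^sub>R X p) Y p = f p *\<^sub>R bracket E X Y p + (- act E Y f p) *\<^sub>R X p"
proof -
  have "(\<lambda>p. f p *\<^sub>R X p) \<in> Sec M E"
    using assms by (intro sections_scale) auto
  from bracket_antisym[OF assms(2) this]
  have "bracket E (\<lambda>p. f p *\<^sub>R X p) Y p = - bracket E Y (\<lambda>p. f p *\<^sub>R X p) p" by simp
  then show ?thesis
    using bracket_scale_right[OF assms(2,1,3)] bracket_antisym[OF assms(1,2)] by simp
qed

text \<open>The Jacobi identity read as: the bracket with \<open>[X, Y]\<close> is the commutator of
  the brackets with \<open>X\<close> and with \<open>Y\<close>. The explicit coefficients 1 and -1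
  fit linearity in a slot of a form.\<close>

lemma bracket_bracket_left:
  assumes "X \<in> Sec M E" "Y \<in> Sec M E" "Z \<in> Sec M E"
  shows "bracket E (bracket E X Y) Z p =
    1 *\<^sub>R bracket E X (bracket E Y Z) p + (- 1) *\<^sub>R bracket E Y (bracket E X Z) p"
proof -
  \<comment> \<open>Linearity is given for combinations of two sections, so a sign is pulled out by
    adding a second term with coefficient 0.\<close>
  have "bracket E Y (\<lambda>p. (- 1) *\<^sub>R bracket E X Z p + 0 *\<^sub>R Z p) p = - bracket E Y (bracket E X Z) p"
    using bracket_lincomb_right[of Y "bracket E X Z" Z "- 1" 0] assms bracket_closed by simp
  then have "bracket E Y (bracket E Z X) p = - bracket E Y (bracket E X Z) p"
    using bracket_antisym[OF assms(1,3)] by simp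
  moreover have "bracket E Z (bracket E X Y) p = - bracket E (bracket E X Y) Z p"
    using bracket_antisym[OF bracket_closed[OF assms(1,2)] assms(3)] by simp
  ultimately show ?thesis using jacobi[OF assms, of p] by simp
qed

lemma anchor_sum:
  "(\<And>i. i \<in> I \<Longrightarrow> v i \<in> fibre E p) \<Longrightarrow>
    anchor E p (\<Sum>i\<in>I. c i *\<^sub>R v i) f = (\<Sum>i\<in>I. c i * anchor E p (v i) f)"
proof (induction I rule: infinite_finite_induct)
  case (insert j I)
  have "(\<Sum>i\<in>I. c i *\<^sub>R v i) \<in> fibre E p"
    using insert.prems by (auto intro!: subspace_sum[OF subspace_fibre] subspace_scale[OF subspace_fibre])
  then show ?case
    using insert anchor_lincomb[of "v j" p "\<Sum>i\<in>I. c i *\<^sub>R v i" "c j" 1 f] by simp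
qed (use anchor_lincomb[OF subspace_0[OF subspace_fibre] subspace_0[OF subspace_fibre], of p 0 0] in auto)

lemma act_smooth:
  assumes X: "X \<in> Sec M E" and W: "open W" and f: "smooth_fun M W f"
  shows "smooth_fun M W (act E X f)"
proof (rule smooth_fun_local[OF W])
  fix p assume p: "p \<in> W"
  obtain U e where fr: "(U, e) \<in> frames E" "p \<in> U" using frame_at .
  have o: "open (U \<inter> W)" using W frame_open[OF fr(1)] by auto
  have "smooth_fun M (U \<inter> W) (\<lambda>q. \<Sum>i<rank E. coord e q (X q) i * act E (e i) f q)"
  proof (intro smooth_fun_sum smooth_fun_mult o)
    fix i assume "i \<in> {..<rank E}"
    then have i: "i < rank E" by simp
    show "smooth_fun M (U \<inter> W) (\<lambda>q. coord e q (X q) i)"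
      using smooth_fun_coord[OF X _ fr(1) i] by (auto intro: smooth_fun_subset)
    show "smooth_fun M (U \<inter> W) (\<lambda>q. act E (e i) f q)"
      using act_frame_smooth[OF fr(1) i W f] by simp
  qed
  then have "smooth_fun M (U \<inter> W) (act E X f)"
  proof (rule smooth_fun_cong[OF _ o])
    fix q assume q: "q \<in> U \<inter> W"
    have "anchor E q (\<Sum>i<rank E. coord e q (X q) i *\<^sub>R e i q) f
        = (\<Sum>i<rank E. coord e q (X q) i * anchor E q (e i q) f)"
      by (rule anchor_sum) (use frame_in_fibre[OF fr(1)] q in auto)
    moreover have "(\<Sum>i<rank E. coord e q (X q) i *\<^sub>R e i q) = X q"
      using coord_eq[OF fr(1), of q "X q"] sections_in_fibre[OF X] q by auto
    ultimately show "(\<Sum>i<rank E. coord e q (X q) i * act E (e i) f q) = act E X f q"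
      by (simp add: act_def)
  qed
  then show "\<exists>W'. open W' \<and> p \<in> W' \<and> smooth_fun M W' (act E X f)"
    using o p fr(2) by blast
qed

lemma ev_update: "ev \<omega> (Xs[j := Y]) p = \<omega> p ((map (\<lambda>X. X p) Xs)[j := Y p])"
  by (simp add: ev_def map_update)

text \<open>The sign and the leading bracket of each term combine into a replacement in slot
  \<open>j\<close>, while exchanging the first two arguments cancels the pairs left over in
  \<open>lie_derivative_expand\<close>.\<close>

lemma lie_derivative_ev:
  assumes "\<omega> \<in> forms M E k U" "p \<in> U" "length Xs = k"
  shows "lie_derivative E X (ev \<omega>) Xs p = act E X (ev \<omega> Xs) p
    - (\<Sum>j<k. ev \<omega> (Xs[j := bracket E X (Xs ! j)]) p)"
proof -
  interpret alternating_form k "fibre E p" "\<omega> p"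
    using form_alternating_form[OF assms(1,2)] .
  have "(- 1) ^ j * ev \<omega> (Y # nths Xs (- {j})) p = ev \<omega> (Xs[j := Y]) p" if "j < k" for j Y
    using update_eq_head[of j "map (\<lambda>X. X p) Xs" "Y p"] that assms(3)
    by (simp add: ev_def map_update nths_map)
  moreover have "ev \<omega> (X # Y # Zs) p + ev \<omega> (Y # X # Zs) p = 0" for Y Zs
    using swap[of "[]" "X p" "Y p" "map (\<lambda>X. X p) Zs"] by (simp add: ev_def)
  ultimately show ?thesis
    unfolding lie_derivative_expand assms(3) by simp
qed

lemma adapted_frame:
  assumes "open U" "p \<in> U"
  obtains W e Y N where "(W, e) \<in> frames E" "\<And>i. i < rank E \<Longrightarrow> Y i \<in> Sec M E"
    "open N" "p \<in> N" "N \<subseteq> U" "N \<subseteq> W" "\<And>i q. q \<in> N \<Longrightarrow> Y i q = e i q"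
proof -
  obtain W e where fr: "(W, e) \<in> frames E" "p \<in> W" using frame_at .
  obtain Y N where "\<And>i. i < rank E \<Longrightarrow> Y i \<in> Sec M E" "open N" "p \<in> N" "N \<subseteq> W"
    "\<And>i q. q \<in> N \<Longrightarrow> Y i q = e i q"
    using frame_extends[OF fr] by metis
  then show thesis using fr assms by (intro that[of W e Y "N \<inter> U"]) auto
qed

lemma representative_frame_nonzero:
  assumes "local_representative M E vol U \<mu>" "(W, e) \<in> frames E" "q \<in> U" "q \<in> W"
    "\<And>i. Y i q = e i q"
  shows "ev \<mu> (map Y [0..<rank E]) q \<noteq> 0"
proof -
  have "\<mu> q (map (\<lambda>i. e i q) [0..<rank E]) \<noteq> 0"
    using assms unfolding local_representative_def forms_def
    by (intro top_form_frame_nonzero[OF _ _ assms(2,4)]) auto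
  then show ?thesis using assms(5) by (simp add: ev_def comp_def)
qed

end

section \<open>Smoothness, Leibniz rule and cocycle identity of a divergence\<close>

locale divergence_on = lie_algebroid_on M E
  for M :: "'m::{t2_space, second_countable_topology} smooth_structure"
    and E :: "('m, 'v::real_vector) algebroid" +
  fixes vol dv
  assumes vol: "vol \<in> vol_sections M E" and divergence: "is_divergence_of M E vol dv"
begin

lemma representative_at:
  obtains U \<mu> where "local_representative M E vol U \<mu>" "p \<in> U"
  using vol unfolding vol_sections_def by blast

lemma representativeD:
  assumes "local_representative M E vol U \<mu>"
  shows "open U" "\<mu> \<in> forms M E (rank E) U"
  using assms unfolding local_representative_def by auto

text \<open>The defining equation solved for the derivative of a value of the volume. All later
  properties of a divergence are read off from it on a suitable list of sections.\<close>

lemma act_representative: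
  assumes "local_representative M E vol U \<mu>" "p \<in> U" "X \<in> Sec M E" "set Xs \<subseteq> Sec M E" "length Xs = rank E"
  shows "act E X (ev \<mu> Xs) p
    = dv X p * ev \<mu> Xs p + (\<Sum>j<rank E. ev \<mu> (Xs[j := bracket E X (Xs ! j)]) p)"
proof -
  have "lie_derivative E X (ev \<mu>) Xs p = dv X p * ev \<mu> Xs p"
    using divergence assms unfolding is_divergence_of_def by blast
  then show ?thesis
    using lie_derivative_ev[OF representativeD(2)[OF assms(1)] assms(2,5), of X] by simp
qed

lemma set_update_bracket:
  assumes "X \<in> Sec M E" "set Xs \<subseteq> Sec M E" "j < length Xs"
  shows "set (Xs[j := bracket E X (Xs ! j)]) \<subseteq> Sec M E"
  using assms bracket_closed[of X "Xs ! j"] set_update_subset_insert[of Xs j] nth_mem[of j Xs] by blast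

text \<open>On sections extending a frame the equation can be divided by the nonvanishing value of
  the representative, which exhibits \<open>dv X\<close> locally as a quotient of smooth
  functions.\<close>

lemma div_smooth:
  assumes X: "X \<in> Sec M E"
  shows "smooth_fun M UNIV (dv X)"
proof (rule smooth_fun_local)
  fix p :: 'm
  obtain U \<mu> where rep: "local_representative M E vol U \<mu>" and pU: "p \<in> U" using representative_at .
  note U = representativeD(1)[OF rep] and \<mu> = representativeD(2)[OF rep]
  obtain W e Y N where fr: "(W, e) \<in> frames E" and Y: "\<And>i. i < rank E \<Longrightarrow> Y i \<in> Sec M E"
    and N: "open N" "p \<in> N" "N \<subseteq> U" "N \<subseteq> W" "\<And>i q. q \<in> N \<Longrightarrow> Y i q = e i q"
    using adapted_frame[OF U pU] by metis
  define Ys where "Ys = map Y [0..<rank E]"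
  have Ys: "set Ys \<subseteq> Sec M E" "length Ys = rank E" using Y by (auto simp: Ys_def)
  have nz: "ev \<mu> Ys q \<noteq> 0" if "q \<in> N" for q
    unfolding Ys_def using that N by (intro representative_frame_nonzero[OF rep fr]) auto
  have sm: "smooth_fun M N (ev \<mu> Zs)" if "set Zs \<subseteq> Sec M E" "length Zs = rank E" for Zs
    using smooth_fun_ev[OF \<mu> U that] N(3) by (rule smooth_fun_subset)
  have "smooth_fun M N (\<lambda>q. (act E X (ev \<mu> Ys) q
      - (\<Sum>j<rank E. ev \<mu> (Ys[j := bracket E X (Ys ! j)]) q)) * inverse (ev \<mu> Ys q))"
    by (intro smooth_fun_mult smooth_fun_diff smooth_fun_sum smooth_fun_inverse act_smooth N(1) X sm Ys nz)
      (use set_update_bracket[OF X Ys(1)] Ys(2) in auto)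
  then have "smooth_fun M N (dv X)"
  proof (rule smooth_fun_cong[OF _ N(1)])
    fix q assume q: "q \<in> N"
    show "(act E X (ev \<mu> Ys) q - (\<Sum>j<rank E. ev \<mu> (Ys[j := bracket E X (Ys ! j)]) q)) * inverse (ev \<mu> Ys q)
        = dv X q"
      using act_representative[OF rep _ X Ys, of q] q N(3) nz[OF q] by auto
  qed
  then show "\<exists>W'. open W' \<and> p \<in> W' \<and> smooth_fun M W' (dv X)" using N by blast
qed simp

lemma div_near: "X \<in> Sec M E \<Longrightarrow> smooth_near M p (dv X)"
  unfolding smooth_near_def using div_smooth by blast

text \<open>
  An identity between divergences at \<open>p\<close> may be checked after multiplication with the
  nonzero value of a representative on a frame of global sections.
\<close>

lemma frame_at_point:
  obtains U \<mu> Y W e where "local_representative M E vol U \<mu>" "p \<in> U" "(W, e) \<in> frames E" "p \<in> W"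
    "\<And>i. Y i p = e i p" "set (map Y [0..<rank E]) \<subseteq> Sec M E" "length (map Y [0..<rank E]) = rank E"
    "ev \<mu> (map Y [0..<rank E]) p \<noteq> 0"
proof -
  obtain U \<mu> where rep: "local_representative M E vol U \<mu>" and pU: "p \<in> U" using representative_at .
  obtain W e Y N where fr: "(W, e) \<in> frames E" and Y: "\<And>i. i < rank E \<Longrightarrow> Y i \<in> Sec M E"
    and N: "open N" "p \<in> N" "N \<subseteq> U" "N \<subseteq> W" "\<And>i q. q \<in> N \<Longrightarrow> Y i q = e i q"
    using adapted_frame[OF representativeD(1)[OF rep] pU] by metis
  then have "ev \<mu> (map Y [0..<rank E]) p \<noteq> 0"
    by (intro representative_frame_nonzero[OF rep fr]) auto
  then show thesis using rep pU fr Y N by (intro that[of U \<mu> W e Y]) auto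
qed

lemma div_lincomb:
  assumes X: "X \<in> Sec M E" and Y: "Y \<in> Sec M E"
  shows "dv (\<lambda>q. a *\<^sub>R X q + b *\<^sub>R Y q) p = a * dv X p + b * dv Y p"
proof -
  obtain U \<mu> F W e where rep: "local_representative M E vol U \<mu>" and pU: "p \<in> U"
    and Fs: "set (map F [0..<rank E]) \<subseteq> Sec M E" "length (map F [0..<rank E]) = rank E"
    and nz: "ev \<mu> (map F [0..<rank E]) p \<noteq> 0"
    using frame_at_point by metis
  define Fs where "Fs = map F [0..<rank E]"
  note Fs = Fs[folded Fs_def] and nz = nz[folded Fs_def]
  interpret alternating_form "rank E" "fibre E p" "\<mu> p"
    using form_alternating_form[OF representativeD(2)[OF rep] pU] .
  let ?Z = "\<lambda>q. a *\<^sub>R X q + b *\<^sub>R Y q"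
  have Z: "?Z \<in> Sec M E"
    by (intro sections_lincomb X Y smooth_fun_const) auto
  have "ev \<mu> (Fs[j := bracket E ?Z (Fs ! j)]) p =
      a * ev \<mu> (Fs[j := bracket E X (Fs ! j)]) p + b * ev \<mu> (Fs[j := bracket E Y (Fs ! j)]) p"
    if j: "j < rank E" for j
  proof -
    have Fj: "Fs ! j \<in> Sec M E" using Fs j by auto
    show ?thesis
      unfolding ev_update bracket_lincomb_left[OF X Y Fj]
      by (rule update_lincomb)
        (use Fs j sections_in_fibre[of _ UNIV p] bracket_closed[OF X Fj] bracket_closed[OF Y Fj] in auto)
  qed
  then have "(\<Sum>j<rank E. ev \<mu> (Fs[j := bracket E ?Z (Fs ! j)]) p) =
      a * (\<Sum>j<rank E. ev \<mu> (Fs[j := bracket E X (Fs ! j)]) p)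
      + b * (\<Sum>j<rank E. ev \<mu> (Fs[j := bracket E Y (Fs ! j)]) p)"
    by (simp add: sum.distrib sum_distrib_left)
  moreover have "act E ?Z f p = a * act E X f p + b * act E Y f p" for f
    unfolding act_def using anchor_lincomb sections_in_fibre[OF X] sections_in_fibre[OF Y] by blast
  ultimately have "dv ?Z p * ev \<mu> Fs p = (a * dv X p + b * dv Y p) * ev \<mu> Fs p"
    using act_representative[OF rep pU X Fs] act_representative[OF rep pU Y Fs]
      act_representative[OF rep pU Z Fs] by (simp add: algebra_simps)
  then show ?thesis using nz by simp
qed

text \<open>The bracket of \<open>f X\<close> with the frame section \<open>F j\<close> has the
  extra term \<open>- act E (F j) f\<close> times \<open>X\<close>. In slot \<open>j\<close> only
  the \<open>j\<close>-th coordinate of \<open>X\<close> survives, so the extra terms add up to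
  \<open>- act E X f\<close>: the trace of a rank one map.\<close>

lemma div_scale:
  assumes X: "X \<in> Sec M E" and f: "smooth_fun M UNIV f"
  shows "dv (\<lambda>q. f q *\<^sub>R X q) p = f p * dv X p + act E X f p"
proof -
  obtain U \<mu> F W e where rep: "local_representative M E vol U \<mu>" and pU: "p \<in> U"
    and fr: "(W, e) \<in> frames E" "p \<in> W" and Fe: "\<And>i. F i p = e i p"
    and Fs: "set (map F [0..<rank E]) \<subseteq> Sec M E" "length (map F [0..<rank E]) = rank E"
    and nz: "ev \<mu> (map F [0..<rank E]) p \<noteq> 0"
    using frame_at_point by metis
  define Fs where "Fs = map F [0..<rank E]"
  note Fs = Fs[folded Fs_def] and nz = nz[folded Fs_def]
  interpret alternating_form "rank E" "fibre E p" "\<mu> p"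
    using form_alternating_form[OF representativeD(2)[OF rep] pU] .
  let ?Z = "\<lambda>q. f q *\<^sub>R X q"
  have Z: "?Z \<in> Sec M E"
    by (intro sections_scale X f) auto
  define c where "c = coord e p (X p)"
  have Xp: "X p = (\<Sum>i<rank E. c i *\<^sub>R e i p)"
    unfolding c_def using coord_eq[OF fr] sections_in_fibre[OF X] by blast
  have vs: "map (\<lambda>X. X p) Fs = map (\<lambda>i. e i p) [0..<rank E]"
    using Fe by (simp add: Fs_def)
  have set_vs: "set (map (\<lambda>X. X p) Fs) \<subseteq> fibre E p"
    using Fs(1) sections_in_fibre[of _ UNIV p] by auto
  \<comment> \<open>Every other component of \<open>X\<close> repeats a vector already present in
    the list, and an alternating form kills it.\<close>
  have X_slot: "ev \<mu> (Fs[j := X]) p = c j * ev \<mu> Fs p" if j: "j < rank E" for j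
  proof -
    have "ev \<mu> (Fs[j := X]) p = (\<Sum>i<rank E. c i * \<mu> p ((map (\<lambda>X. X p) Fs)[j := e i p]))"
      unfolding ev_update Xp
      by (rule update_sum) (use Fs(2) j frame_in_fibre[OF fr(1) _ fr(2)] set_vs in auto)
    also have "\<dots> = (\<Sum>i<rank E. if i = j then c j * ev \<mu> Fs p else 0)"
    proof (rule sum.cong[OF refl])
      fix i assume "i \<in> {..<rank E}"
      then have i: "i < rank E" by simp
      show "c i * \<mu> p ((map (\<lambda>X. X p) Fs)[j := e i p]) = (if i = j then c j * ev \<mu> Fs p else 0)"
      proof (cases "i = j")
        case True
        have "(map (\<lambda>X. X p) Fs)[j := e j p] = map (\<lambda>X. X p) Fs"
          unfolding vs using j list_update_id[of "map (\<lambda>i. e i p) [0..<rank E]" j] by simp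
        then show ?thesis using True by (simp add: ev_def)
      next
        case False
        let ?l = "(map (\<lambda>i. e i p) [0..<rank E])[j := e i p]"
        have "?l ! i = ?l ! j" "i < length ?l" "j < length ?l" using i j False by auto
        then have "\<not> distinct ?l" using False nth_eq_iff_index_eq by blast
        then show ?thesis using False not_distinct vs by simp
      qed
    qed
    also have "\<dots> = c j * ev \<mu> Fs p" using j by simp
    finally show ?thesis .
  qed
  have "ev \<mu> (Fs[j := bracket E ?Z (Fs ! j)]) p =
      f p * ev \<mu> (Fs[j := bracket E X (Fs ! j)]) p - act E (F j) f p * c j * ev \<mu> Fs p"
    if j: "j < rank E" for j
  proof -
    have Fj: "Fs ! j \<in> Sec M E" "Fs ! j = F j" using Fs j by (auto simp: Fs_def)
    have "ev \<mu> (Fs[j := bracket E ?Z (Fs ! j)]) p =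
        f p * ev \<mu> (Fs[j := bracket E X (Fs ! j)]) p + (- act E (Fs ! j) f p) * ev \<mu> (Fs[j := X]) p"
      unfolding ev_update bracket_scale_left[OF X Fj(1) f]
      by (rule update_lincomb)
        (use Fs(2) j set_vs sections_in_fibre[OF bracket_closed[OF X Fj(1)]] sections_in_fibre[OF X] in auto)
    then show ?thesis using X_slot[OF j] Fj(2) by simp
  qed
  then have "(\<Sum>j<rank E. ev \<mu> (Fs[j := bracket E ?Z (Fs ! j)]) p) =
      f p * (\<Sum>j<rank E. ev \<mu> (Fs[j := bracket E X (Fs ! j)]) p)
      - (\<Sum>j<rank E. c j * act E (F j) f p) * ev \<mu> Fs p"
    by (simp add: sum_subtractf sum_distrib_left sum_distrib_right mult_ac)
  moreover have "(\<Sum>j<rank E. c j * act E (F j) f p) = act E X f p"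
    unfolding act_def Xp Fe
    by (rule anchor_sum[symmetric]) (use frame_in_fibre[OF fr(1) _ fr(2)] in auto)
  moreover have "act E ?Z g p = f p * act E X g p" for g
    unfolding act_def using anchor_lincomb[of "X p" p "X p" "f p" 0 g] sections_in_fibre[OF X] by simp
  ultimately have "dv ?Z p * ev \<mu> Fs p = (f p * dv X p + act E X f p) * ev \<mu> Fs p"
    using act_representative[OF rep pU X Fs] act_representative[OF rep pU Z Fs]
    by (simp add: algebra_simps)
  then show ?thesis using nz by simp
qed

text \<open>The equation of \<open>act_representative\<close> is differentiated once more. The
  second term, and the third and fourth together, are symmetric in \<open>X\<close> and
  \<open>Y\<close>, so the commutator sees only the first term and the double sum.\<close>

lemma act_act_representative:
  assumes rep: "local_representative M E vol U \<mu>" and pU: "p \<in> U"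
    and X: "X \<in> Sec M E" and Y: "Y \<in> Sec M E" and Zs: "set Zs \<subseteq> Sec M E" "length Zs = rank E"
  shows "act E X (act E Y (ev \<mu> Zs)) p
    = act E X (dv Y) p * ev \<mu> Zs p + dv Y p * dv X p * ev \<mu> Zs p
      + dv Y p * (\<Sum>j<rank E. ev \<mu> (Zs[j := bracket E X (Zs ! j)]) p)
      + dv X p * (\<Sum>j<rank E. ev \<mu> (Zs[j := bracket E Y (Zs ! j)]) p)
      + (\<Sum>j<rank E. \<Sum>i<rank E. ev \<mu> (Zs[j := bracket E Y (Zs ! j),
            i := bracket E X (Zs[j := bracket E Y (Zs ! j)] ! i)]) p)"
proof -
  note U = representativeD(1)[OF rep] and \<mu> = representativeD(2)[OF rep]
  have D: "anchor E p (X p) \<in> tangent_space M p" by (rule anchor_tangent[OF X])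
  have near: "smooth_near M p (ev \<mu> Vs)" if "set Vs \<subseteq> Sec M E" "length Vs = rank E" for Vs
    unfolding smooth_near_def using smooth_fun_ev[OF \<mu> U that] U pU by blast
  have ZY: "set (Zs[j := bracket E Y (Zs ! j)]) \<subseteq> Sec M E" if "j < rank E" for j
    using set_update_bracket[OF Y Zs(1)] that Zs(2) by simp
  have sm1: "smooth_near M p (\<lambda>q. dv Y q * ev \<mu> Zs q)"
    by (intro smooth_near_mult div_near[OF Y] near Zs)
  have sm2: "smooth_near M p (\<lambda>q. \<Sum>j<rank E. ev \<mu> (Zs[j := bracket E Y (Zs ! j)]) q)"
    by (intro smooth_near_sum near) (use ZY Zs(2) in auto)
  \<comment> \<open>The equation holds on all of \<open>U\<close>, so both sides have the same germ
    at \<open>p\<close> and a derivation may be applied to it.\<close>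
  have "\<forall>\<^sub>F q in nhds p. dv Y q * ev \<mu> Zs q + (\<Sum>j<rank E. ev \<mu> (Zs[j := bracket E Y (Zs ! j)]) q)
      = act E Y (ev \<mu> Zs) q"
    unfolding eventually_nhds using U pU act_representative[OF rep _ Y Zs] by (intro exI[of _ U]) auto
  from tangent_cong[OF D smooth_near_add[OF sm1 sm2] this]
  have "act E X (act E Y (ev \<mu> Zs)) p = act E X (\<lambda>q. dv Y q * ev \<mu> Zs q
      + (\<Sum>j<rank E. ev \<mu> (Zs[j := bracket E Y (Zs ! j)]) q)) p"
    by (simp only: act_def[of E X])
  also have "\<dots> = act E X (dv Y) p * ev \<mu> Zs p + dv Y p * act E X (ev \<mu> Zs) p
      + (\<Sum>j<rank E. act E X (ev \<mu> (Zs[j := bracket E Y (Zs ! j)])) p)"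
    unfolding act_def[of E X] tangent_add[OF D sm1 sm2] tangent_mult[OF D div_near[OF Y] near[OF Zs]]
    by (subst tangent_sum[OF D]) (use near ZY Zs(2) in auto)
  also have "\<dots> = act E X (dv Y) p * ev \<mu> Zs p + dv Y p * (dv X p * ev \<mu> Zs p
        + (\<Sum>j<rank E. ev \<mu> (Zs[j := bracket E X (Zs ! j)]) p))
      + (\<Sum>j<rank E. dv X p * ev \<mu> (Zs[j := bracket E Y (Zs ! j)]) p
        + (\<Sum>i<rank E. ev \<mu> (Zs[j := bracket E Y (Zs ! j),
            i := bracket E X (Zs[j := bracket E Y (Zs ! j)] ! i)]) p))"
    using act_representative[OF rep pU X] Zs ZY by simp
  finally show ?thesis
    by (simp add: algebra_simps sum.distrib sum_distrib_left)
qed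

text \<open>The anchor respects brackets, so the derivative along \<open>[X, Y]\<close> is the
  commutator of two derivatives. Double replacements in different slots do not depend on the order
  and cancel. Those in the same slot combine by Jacobi into the bracket sum of
  \<open>[X, Y]\<close>, which stands on both sides.\<close>

lemma div_bracket:
  assumes X: "X \<in> Sec M E" and Y: "Y \<in> Sec M E"
  shows "dv (bracket E X Y) p = act E X (dv Y) p - act E Y (dv X) p"
proof -
  obtain U \<mu> F W e where rep: "local_representative M E vol U \<mu>" and pU: "p \<in> U"
    and Fs: "set (map F [0..<rank E]) \<subseteq> Sec M E" "length (map F [0..<rank E]) = rank E"
    and nz: "ev \<mu> (map F [0..<rank E]) p \<noteq> 0"
    using frame_at_point by metis
  define Zs where "Zs = map F [0..<rank E]"
  note Zs = Fs[folded Zs_def] and nz = nz[folded Zs_def]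
  note U = representativeD(1)[OF rep] and \<mu> = representativeD(2)[OF rep]
  interpret alternating_form "rank E" "fibre E p" "\<mu> p"
    using form_alternating_form[OF \<mu> pU] .
  define T where "T X Y = (\<Sum>j<rank E. \<Sum>i<rank E. ev \<mu> (Zs[j := bracket E Y (Zs ! j),
            i := bracket E X (Zs[j := bracket E Y (Zs ! j)] ! i)]) p)" for X Y
  \<comment> \<open>Off-diagonal part of the double sum, set to 0 on the diagonal. For
    \<open>i = j\<close> the second update overwrites the first, which leaves the iterated bracket
    \<open>C\<close>.\<close>
  define B where "B X Y i j = (if i = j then 0 else
      ev \<mu> (Zs[j := bracket E Y (Zs ! j), i := bracket E X (Zs ! i)]) p)" for X Y i j
  define C where "C X Y j = ev \<mu> (Zs[j := bracket E X (bracket E Y (Zs ! j))]) p" for X Y j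
  have T: "T X Y = (\<Sum>j<rank E. \<Sum>i<rank E. B X Y i j) + (\<Sum>j<rank E. C X Y j)" for X Y
  proof -
    have "(\<Sum>i<rank E. ev \<mu> (Zs[j := bracket E Y (Zs ! j),
        i := bracket E X (Zs[j := bracket E Y (Zs ! j)] ! i)]) p)
      = (\<Sum>i<rank E. B X Y i j + (if i = j then C X Y j else 0))" if "j < rank E" for j
      using that Zs(2) by (intro sum.cong) (auto simp: B_def C_def)
    then show ?thesis by (simp add: T_def sum.distrib)
  qed
  have "B X Y i j = B Y X j i" for i j
    by (auto simp: B_def list_update_swap)
  then have "(\<Sum>j<rank E. \<Sum>i<rank E. B X Y i j) = (\<Sum>j<rank E. \<Sum>i<rank E. B Y X i j)"
    by (subst sum.swap) simp
  then have TT: "T X Y - T Y X = (\<Sum>j<rank E. C X Y j - C Y X j)"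
    by (simp add: T sum_subtractf)
  have "ev \<mu> (Zs[j := bracket E (bracket E X Y) (Zs ! j)]) p = C X Y j - C Y X j" if j: "j < rank E" for j
  proof -
    have Zj: "Zs ! j \<in> Sec M E" using Zs j by auto
    have "ev \<mu> (Zs[j := bracket E (bracket E X Y) (Zs ! j)]) p = 1 * C X Y j + (- 1) * C Y X j"
      unfolding ev_update bracket_bracket_left[OF X Y Zj] C_def
      by (rule update_lincomb)
        (use Zs j sections_in_fibre[of _ UNIV p] bracket_closed X Y Zj in auto)
    then show ?thesis by simp
  qed
  then have "act E (bracket E X Y) (ev \<mu> Zs) p = dv (bracket E X Y) p * ev \<mu> Zs p + (T X Y - T Y X)"
    using act_representative[OF rep pU bracket_closed[OF X Y] Zs] by (simp add: TT)
  moreover have "act E (bracket E X Y) (ev \<mu> Zs) p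
      = act E X (act E Y (ev \<mu> Zs)) p - act E Y (act E X (ev \<mu> Zs)) p"
    using act_bracket[OF X Y U smooth_fun_ev[OF \<mu> U Zs] pU] .
  ultimately have "dv (bracket E X Y) p * ev \<mu> Zs p = (act E X (dv Y) p - act E Y (dv X) p) * ev \<mu> Zs p"
    unfolding act_act_representative[OF rep pU X Y Zs, folded T_def]
      act_act_representative[OF rep pU Y X Zs, folded T_def]
    by (simp add: algebra_simps)
  then show ?thesis using nz by simp
qed

end

section \<open>Change of volume\<close>

context lie_algebroid_on
begin

lemma representatives_proportional:
  assumes "local_representative M E vol U \<mu>" "local_representative M E vol' U' \<mu>'"
    "(W, e) \<in> frames E" "q \<in> U" "q \<in> U'" "q \<in> W" "\<And>i. Y i q = e i q"
  shows "\<mu>' q vs = ev \<mu>' (map Y [0..<rank E]) q / ev \<mu> (map Y [0..<rank E]) q * \<mu> q vs"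
proof -
  have "\<mu> q \<in> alternating_forms (rank E) (fibre E q)" "\<mu>' q \<in> alternating_forms (rank E) (fibre E q)"
    using assms unfolding local_representative_def forms_def by auto
  moreover have eq: "map (\<lambda>X. X q) (map Y [0..<rank E]) = map (\<lambda>i. e i q) [0..<rank E]"
    using assms(7) by simp
  moreover have "\<mu> q (map (\<lambda>i. e i q) [0..<rank E]) \<noteq> 0"
    using representative_frame_nonzero[OF assms(1,3,4,6), of Y] assms(7) unfolding ev_def eq by simp
  ultimately show ?thesis
    unfolding ev_def eq
    by (intro top_forms_proportional[OF subspace_fibre _ _ frame_span[OF assms(3,6)] frame_inj[OF assms(3,6)]])
qed

text \<open>
  Squares remove the sign ambiguity of the representatives, so the logarithm of the ratio of the two
  volumes is globally defined.
\<close>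

lemma volume_ratio:
  assumes vol: "vol \<in> vol_sections M E" and vol': "vol' \<in> vol_sections M E"
  obtains F where "\<And>U \<mu> U' \<mu>' q vs. local_representative M E vol U \<mu> \<Longrightarrow>
    local_representative M E vol' U' \<mu>' \<Longrightarrow> q \<in> U \<Longrightarrow> q \<in> U' \<Longrightarrow>
    (\<mu>' q vs)\<^sup>2 = exp (2 * F q) * (\<mu> q vs)\<^sup>2"
proof -
  \<comment> \<open>The claim is about elements of \<open>vol p\<close> and \<open>vol' p\<close>,
    not about representatives, so a single choice of \<open>t\<close> at each point serves all
    representatives.\<close>
  have "\<exists>t. \<exists>\<alpha>\<in>vol p. \<exists>\<alpha>'\<in>vol' p. \<forall>vs. (\<alpha>' vs)\<^sup>2 = exp (2 * t) * (\<alpha> vs)\<^sup>2" for p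
  proof -
    obtain U \<mu> where rep: "p \<in> U" "local_representative M E vol U \<mu>"
      using vol unfolding vol_sections_def by blast
    obtain U' \<mu>' where rep': "p \<in> U'" "local_representative M E vol' U' \<mu>'"
      using vol' unfolding vol_sections_def by blast
    obtain W e where fr: "(W, e) \<in> frames E" "p \<in> W" using frame_at .
    define c where "c = ev \<mu>' (map e [0..<rank E]) p / ev \<mu> (map e [0..<rank E]) p"
    have "c \<noteq> 0"
      using representative_frame_nonzero[OF rep(2) fr(1) rep(1) fr(2), of e]
        representative_frame_nonzero[OF rep'(2) fr(1) rep'(1) fr(2), of e] by (simp add: c_def)
    then have "exp (2 * ln \<bar>c\<bar>) = c\<^sup>2"
      by (simp add: exp_double)
    moreover have "\<mu>' p vs = c * \<mu> p vs" for vs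
      unfolding c_def by (rule representatives_proportional[OF rep(2) rep'(2) fr(1) rep(1) rep'(1) fr(2)]) (rule refl)
    ultimately have "\<forall>vs. (\<mu>' p vs)\<^sup>2 = exp (2 * ln \<bar>c\<bar>) * (\<mu> p vs)\<^sup>2"
      by (simp add: power_mult_distrib)
    moreover have "\<mu> p \<in> vol p" "\<mu>' p \<in> vol' p"
      using rep rep' unfolding local_representative_def by auto
    ultimately show ?thesis by blast
  qed
  then obtain F where F: "\<And>p. \<exists>\<alpha>\<in>vol p. \<exists>\<alpha>'\<in>vol' p. \<forall>vs. (\<alpha>' vs)\<^sup>2 = exp (2 * F p) * (\<alpha> vs)\<^sup>2"
    by metis
  show thesis
  proof (rule that)
    fix U \<mu> U' \<mu>' q vs
    assume rep: "local_representative M E vol U \<mu>" "local_representative M E vol' U' \<mu>'" "q \<in> U" "q \<in> U'"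
    obtain \<alpha> \<alpha>' where \<alpha>: "\<alpha> \<in> vol q" "\<alpha>' \<in> vol' q" "\<forall>vs. (\<alpha>' vs)\<^sup>2 = exp (2 * F q) * (\<alpha> vs)\<^sup>2"
      using F[of q] by blast
    have "vol q = {\<mu> q, \<lambda>vs. - \<mu> q vs}" "vol' q = {\<mu>' q, \<lambda>vs. - \<mu>' q vs}"
      using rep unfolding local_representative_def by auto
    with \<alpha>(1,2) have "(\<alpha> vs)\<^sup>2 = (\<mu> q vs)\<^sup>2" "(\<alpha>' vs)\<^sup>2 = (\<mu>' q vs)\<^sup>2"
      by auto
    with \<alpha>(3) show "(\<mu>' q vs)\<^sup>2 = exp (2 * F q) * (\<mu> q vs)\<^sup>2" by metis
  qed
qed

text \<open>So far \<open>F\<close> is only a pointwise choice. On a frame it is half the logarithm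
  of \<open>h * h\<close>, with \<open>h\<close> the ratio of the representatives, hence smooth.
  Differentiating \<open>h * h = exp (F + F)\<close> gives \<open>act E X h = h * act E X F\<close>
  for either sign of \<open>h\<close>; the product rule for \<open>m' = h * m\<close> then compares
  the divergences.\<close>

lemma divergence_change_of_volume:
  assumes "divergence_on M E vol dv" "divergence_on M E vol' dv'"
  obtains F where "smooth_fun M UNIV F"
    "\<And>X p. X \<in> Sec M E \<Longrightarrow> dv' X p - dv X p = act E X F p"
proof -
  interpret A: divergence_on M E vol dv by fact
  interpret B: divergence_on M E vol' dv' by fact
  obtain F where F: "\<And>U \<mu> U' \<mu>' q vs. local_representative M E vol U \<mu> \<Longrightarrow>
    local_representative M E vol' U' \<mu>' \<Longrightarrow> q \<in> U \<Longrightarrow> q \<in> U' \<Longrightarrow>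
    (\<mu>' q vs)\<^sup>2 = exp (2 * F q) * (\<mu> q vs)\<^sup>2"
    using volume_ratio[OF A.vol B.vol] by metis
  have "(\<exists>W. open W \<and> p \<in> W \<and> smooth_fun M W F) \<and>
      (\<forall>X\<in>Sec M E. smooth_near M p F \<longrightarrow> dv' X p - dv X p = act E X F p)" for p
  proof -
    obtain U \<mu> where rep: "local_representative M E vol U \<mu>" and pU: "p \<in> U" using A.representative_at .
    obtain U' \<mu>' where rep': "local_representative M E vol' U' \<mu>'" and pU': "p \<in> U'" using B.representative_at .
    note U = A.representativeD[OF rep] and U' = B.representativeD[OF rep']
    obtain W e Y N where fr: "(W, e) \<in> frames E" and Y: "\<And>i. i < rank E \<Longrightarrow> Y i \<in> Sec M E"
      and N: "open N" "p \<in> N" "N \<subseteq> U \<inter> U'" "N \<subseteq> W" "\<And>i q. q \<in> N \<Longrightarrow> Y i q = e i q"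
      using adapted_frame[of "U \<inter> U'" p] U(1) U'(1) pU pU' by (metis IntI open_Int)
    define Ys where "Ys = map Y [0..<rank E]"
    have Ys: "set Ys \<subseteq> Sec M E" "length Ys = rank E" using Y by (auto simp: Ys_def)
    define m m' where "m = ev \<mu> Ys" and "m' = ev \<mu>' Ys"
    have m0: "m q \<noteq> 0" "m' q \<noteq> 0" if "q \<in> N" for q
      unfolding m_def m'_def Ys_def using that N
        representative_frame_nonzero[OF rep fr, of q Y] representative_frame_nonzero[OF rep' fr, of q Y]
      by blast+
    have sm: "smooth_fun M N (ev \<mu> Zs)" "smooth_fun M N (ev \<mu>' Zs)"
      if "set Zs \<subseteq> Sec M E" "length Zs = rank E" for Zs
      using smooth_fun_ev[OF U(2,1) that] smooth_fun_ev[OF U'(2,1) that] N(3)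
      by (auto elim!: smooth_fun_subset)
    note m = sm(1)[OF Ys, folded m_def] and m' = sm(2)[OF Ys, folded m'_def]
    define h where "h q = m' q * inverse (m q)" for q
    have h: "smooth_fun M N h"
      unfolding h_def by (intro smooth_fun_mult smooth_fun_inverse N(1) m m' m0)
    have h0: "h q \<noteq> 0" if "q \<in> N" for q using m0[OF that] by (simp add: h_def)
    \<comment> \<open>The sum \<open>F q + F q\<close> in place of \<open>2 * F q\<close> lets the
      derivative be taken with \<open>tangent_add\<close>.\<close>
    have hh: "exp (F q + F q) = h q * h q" if "q \<in> N" for q
    proof -
      have "(m' q)\<^sup>2 = exp (2 * F q) * (m q)\<^sup>2"
        unfolding m_def m'_def ev_def using F[OF rep rep'] that N(3) by blast
      then show ?thesis using m0[OF that] by (simp add: h_def field_simps power2_eq_square)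
    qed
    have "smooth_fun M N (\<lambda>q. (1/2) * ln (h q * h q))"
      by (intro smooth_fun_cmult smooth_fun_ln smooth_fun_mult N(1) h)
        (use h0 in \<open>auto simp: zero_less_mult_iff linorder_neq_iff\<close>)
    then have Fs: "smooth_fun M N F"
      by (rule smooth_fun_cong[OF _ N(1)]) (simp flip: hh)
    have "dv' X p - dv X p = act E X F p" if X: "X \<in> Sec M E" for X
    proof -
      have D: "anchor E p (X p) \<in> tangent_space M p" by (rule anchor_tangent[OF X])
      have near: "smooth_near M p f" if "smooth_fun M N f" for f
        unfolding smooth_near_def using that N by blast
      note hn = near[OF h] and Fn = near[OF Fs] and mn = near[OF m]
      have "\<forall>\<^sub>F q in nhds p. h q * h q = exp (F q + F q)"
        unfolding eventually_nhds using N hh by (intro exI[of _ N]) auto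
      from tangent_cong[OF D smooth_near_mult[OF hn hn] this]
      have "exp (F p + F p) * (act E X F p + act E X F p) = act E X h p * h p + h p * act E X h p"
        unfolding act_def
        using tangent_exp[OF D smooth_near_add[OF Fn Fn]] tangent_add[OF D Fn Fn] tangent_mult[OF D hn hn]
        by (simp add: mult.commute)
      then have "h p * (h p * act E X F p) = h p * act E X h p"
        unfolding hh[OF N(2)] by (simp add: algebra_simps)
      then have Dh: "act E X h p = h p * act E X F p" using h0[OF N(2)] by simp
      have ratio: "ev \<mu>' Zs q = h q * ev \<mu> Zs q" if "q \<in> N" for q Zs
      proof -
        have "q \<in> U" "q \<in> U'" "q \<in> W" using that N by auto
        from representatives_proportional[OF rep rep' fr this, of Y "map (\<lambda>X. X q) Zs"] N(5)[OF that]
        show ?thesis unfolding h_def m_def m'_def Ys_def ev_def[of _ Zs] by (simp add: divide_inverse)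
      qed
      have "\<forall>\<^sub>F q in nhds p. h q * m q = m' q"
        unfolding eventually_nhds m_def m'_def using N ratio by (intro exI[of _ N]) auto
      from tangent_cong[OF D smooth_near_mult[OF hn mn] this]
      have "act E X m' p = act E X h p * m p + h p * act E X m p"
        unfolding act_def tangent_mult[OF D hn mn] .
      moreover have "act E X m p = dv X p * m p + (\<Sum>j<rank E. ev \<mu> (Ys[j := bracket E X (Ys ! j)]) p)"
        unfolding m_def by (rule A.act_representative[OF rep pU X Ys])
      \<comment> \<open>The factor \<open>h p\<close> is the same for every list, so the bracket sum
        is \<open>h p\<close> times the one for \<open>\<mu>\<close> and cancels in the
        comparison.\<close>
      moreover have "act E X m' p = dv' X p * (h p * m p)
          + h p * (\<Sum>j<rank E. ev \<mu> (Ys[j := bracket E X (Ys ! j)]) p)"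
        using B.act_representative[OF rep' pU' X Ys] ratio[OF N(2)]
        by (simp add: m_def m'_def sum_distrib_left)
      ultimately have "(h p * m p) * (dv' X p - dv X p) = (h p * m p) * act E X F p"
        unfolding Dh by (simp add: algebra_simps)
      then show ?thesis using h0[OF N(2)] m0[OF N(2)] by simp
    qed
    then show ?thesis using Fs N by blast
  qed
  moreover from this have F: "smooth_fun M UNIV F" by (intro smooth_fun_local) auto
  moreover have "smooth_near M p F" for p
    unfolding smooth_near_def using F by blast
  ultimately show thesis using that by blast
qed

end

section \<open>Cohomology in degree one\<close>

context vector_bundle_on
begin

lemma forms_diff:
  assumes "open U" "\<omega> \<in> forms M E k U" "\<omega>' \<in> forms M E k U"
  shows "(\<lambda>p vs. \<omega> p vs - \<omega>' p vs) \<in> forms M E k U"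
  unfolding forms_def
proof (intro CollectI conjI ballI)
  fix p assume "p \<in> U"
  then show "(\<lambda>vs. \<omega> p vs - \<omega>' p vs) \<in> alternating_forms k (fibre E p)"
    using assms alternating_forms_lincomb[of "\<omega> p" k "fibre E p" "\<omega>' p" 1 "- 1"]
    by (auto simp: forms_def)
next
  fix z assume z: "z \<in> frames E"
  obtain W e where We: "z = (W, e)" by fastforce
  have "smooth_fun M (U \<inter> W) (\<lambda>p. \<omega> p (map (\<lambda>i. e i p) ns) - \<omega>' p (map (\<lambda>i. e i p) ns))"
    if "length ns = k" "set ns \<subseteq> {..<rank E}" for ns
  proof (rule smooth_fun_diff)
    show "open (U \<inter> W)" using assms(1) frame_open z We by auto
    show "smooth_fun M (U \<inter> W) (\<lambda>p. \<omega> p (map (\<lambda>i. e i p) ns))"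
      using bspec[OF conjunct2[OF CollectD[OF assms(2)[unfolded forms_def]]] z] We that by simp
    show "smooth_fun M (U \<inter> W) (\<lambda>p. \<omega>' p (map (\<lambda>i. e i p) ns))"
      using bspec[OF conjunct2[OF CollectD[OF assms(3)[unfolded forms_def]]] z] We that by simp
  qed
  then show "case z of (W, e) \<Rightarrow> \<forall>ns. length ns = k \<and> set ns \<subseteq> {..<rank E} \<longrightarrow>
      smooth_fun M (U \<inter> W) (\<lambda>p. \<omega> p (map (\<lambda>i. e i p) ns) - \<omega>' p (map (\<lambda>i. e i p) ns))"
    by (simp add: We)
qed

lemma forms_zero: "(\<lambda>p vs. 0) \<in> forms M E k UNIV"
  unfolding forms_def alternating_forms_def by (auto intro!: smooth_fun_const frame_open)

text \<open>By \<open>tensorial_vanishing\<close> the value at \<open>p\<close> depends on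
  \<open>X p\<close> alone, so it defines a linear form on the fibre. Uniqueness holds because every
  fibre vector is the value of a global section and forms are zero on inadmissible lists.\<close>

lemma tensorial_imp_form:
  fixes \<Delta> :: "('m \<Rightarrow> 'v) \<Rightarrow> 'm \<Rightarrow> real"
  assumes add: "\<And>X Y p. X \<in> Sec M E \<Longrightarrow> Y \<in> Sec M E \<Longrightarrow> \<Delta> (\<lambda>q. X q + Y q) p = \<Delta> X p + \<Delta> Y p"
    and scale: "\<And>X f p. X \<in> Sec M E \<Longrightarrow> smooth_fun M UNIV f \<Longrightarrow> \<Delta> (\<lambda>q. f q *\<^sub>R X q) p = f p * \<Delta> X p"
    and smooth: "\<And>X. X \<in> Sec M E \<Longrightarrow> smooth_fun M UNIV (\<Delta> X)"
  shows "\<exists>!\<phi>. \<phi> \<in> forms M E 1 UNIV \<and> (\<forall>X\<in>Sec M E. \<forall>p. \<Delta> X p = \<phi> p [X p])"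
proof -
  have lincomb: "\<Delta> (\<lambda>q. a *\<^sub>R X q + b *\<^sub>R Y q) p = a * \<Delta> X p + b * \<Delta> Y p"
    if "X \<in> Sec M E" "Y \<in> Sec M E" for X Y a b p
    using add[of "\<lambda>q. a *\<^sub>R X q" "\<lambda>q. b *\<^sub>R Y q" p] scale[OF that(1) smooth_fun_const[of UNIV a], of p]
      scale[OF that(2) smooth_fun_const[of UNIV b], of p] that
      sections_scale[OF _ that(1) smooth_fun_const[of UNIV a]]
      sections_scale[OF _ that(2) smooth_fun_const[of UNIV b]] by simp
  have pointwise: "\<Delta> X p = \<Delta> Y p" if X: "X \<in> Sec M E" and Y: "Y \<in> Sec M E" and XY: "X p = Y p" for X Y p
  proof -
    have "(\<lambda>q. 1 *\<^sub>R X q + (- 1) *\<^sub>R Y q) \<in> Sec M E"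
      by (intro sections_lincomb X Y smooth_fun_const) auto
    then have "\<Delta> (\<lambda>q. 1 *\<^sub>R X q + (- 1) *\<^sub>R Y q) p = 0"
      using XY by (intro tensorial_vanishing add scale) auto
    then show ?thesis using lincomb[OF X Y, of 1 "- 1" p] by simp
  qed
  \<comment> \<open>Any section through \<open>v\<close> would do: \<open>pointwise\<close> makes
    the resulting value independent of the choice.\<close>
  define S where "S p v = (SOME X. X \<in> Sec M E \<and> X p = v)" for p v
  have S: "S p v \<in> Sec M E \<and> S p v p = v" if "v \<in> fibre E p" for p v
  proof -
    have "\<exists>X. X \<in> Sec M E \<and> X p = v" using section_through[OF that] by blast
    then show ?thesis unfolding S_def by (rule someI_ex)
  qed
  define \<phi> where "\<phi> p vs = (if length vs = 1 \<and> set vs \<subseteq> fibre E p then \<Delta> (S p (hd vs)) p else 0)" for p vs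
  have \<phi>_eq: "\<phi> p [X p] = \<Delta> X p" if X: "X \<in> Sec M E" for X p
    using pointwise[of "S p (X p)" X p] S[of "X p" p] X sections_in_fibre[OF X] by (simp add: \<phi>_def)
  have form: "\<phi> \<in> forms M E 1 UNIV"
    unfolding forms_def
  proof (intro CollectI conjI ballI)
    fix p :: 'm
    show "\<phi> p \<in> alternating_forms 1 (fibre E p)"
      unfolding alternating_forms_def
    proof (intro CollectI conjI allI impI)
      fix vs :: "'v list" and i :: nat and u v a b
      assume A: "length vs = 1 \<and> set vs \<subseteq> fibre E p \<and> i < 1 \<and> u \<in> fibre E p \<and> v \<in> fibre E p"
      then have upd: "vs[i := w] = [w]" for w by (cases vs) auto
      obtain X Y where X: "X \<in> Sec M E" "X p = u" and Y: "Y \<in> Sec M E" "Y p = v"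
        using A section_through by metis
      have "(\<lambda>q. a *\<^sub>R X q + b *\<^sub>R Y q) \<in> Sec M E"
        by (intro sections_lincomb X Y smooth_fun_const) auto
      from \<phi>_eq[OF this, of p] show "\<phi> p (vs[i := a *\<^sub>R u + b *\<^sub>R v]) = a * \<phi> p (vs[i := u]) + b * \<phi> p (vs[i := v])"
        unfolding upd using lincomb[OF X(1) Y(1)] \<phi>_eq[OF X(1), of p] \<phi>_eq[OF Y(1), of p] X(2) Y(2) by simp
    next
      fix vs :: "'v list" assume "\<not> distinct vs"
      then have "length vs \<noteq> 1" by (cases vs) auto
      then show "\<phi> p vs = 0" by (simp add: \<phi>_def)
    qed (auto simp: \<phi>_def)
  next
    fix z assume z: "z \<in> frames E"
    obtain W e where We: "z = (W, e)" by fastforce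
    have fr: "(W, e) \<in> frames E" using z We by simp
    \<comment> \<open>Near each point the frame section is the restriction of a global section
      \<open>Y i\<close>, where \<open>\<phi>\<close> takes the smooth value
      \<open>\<Delta> (Y i)\<close>.\<close>
    have "smooth_fun M W (\<lambda>p. \<phi> p [e i p])" if i: "i < rank E" for i
    proof (rule smooth_fun_local[OF frame_open[OF fr]])
      fix p assume p: "p \<in> W"
      obtain Y N where Y: "\<And>i. i < rank E \<Longrightarrow> Y i \<in> Sec M E" and N: "open N" "p \<in> N" "N \<subseteq> W"
        "\<And>i q. q \<in> N \<Longrightarrow> Y i q = e i q"
        using frame_extends[OF fr p] by metis
      have "smooth_fun M N (\<Delta> (Y i))"
        using smooth[OF Y[OF i]] by (rule smooth_fun_subset) simp
      then have "smooth_fun M N (\<lambda>p. \<phi> p [e i p])"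
      proof (rule smooth_fun_cong[OF _ N(1)])
        fix q assume "q \<in> N"
        then show "\<Delta> (Y i) q = \<phi> q [e i q]" using \<phi>_eq[OF Y[OF i], of q] N(4)[of q i] by simp
      qed
      then show "\<exists>W'. open W' \<and> p \<in> W' \<and> smooth_fun M W' (\<lambda>p. \<phi> p [e i p])" using N by blast
    qed
    then show "case z of (W, e) \<Rightarrow> \<forall>ns. length ns = 1 \<and> set ns \<subseteq> {..<rank E} \<longrightarrow>
        smooth_fun M (UNIV \<inter> W) (\<lambda>p. \<phi> p (map (\<lambda>i. e i p) ns))"
      by (auto simp: We length_Suc_conv)
  qed
  show ?thesis
  proof (rule ex1I[of _ \<phi>])
    show "\<phi> \<in> forms M E 1 UNIV \<and> (\<forall>X\<in>Sec M E. \<forall>p. \<Delta> X p = \<phi> p [X p])"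
      using form \<phi>_eq by simp
    fix \<psi> assume \<psi>: "\<psi> \<in> forms M E 1 UNIV \<and> (\<forall>X\<in>Sec M E. \<forall>p. \<Delta> X p = \<psi> p [X p])"
    show "\<psi> = \<phi>"
    proof (intro ext)
      fix p vs
      show "\<psi> p vs = \<phi> p vs"
      proof (cases "length vs = 1 \<and> set vs \<subseteq> fibre E p")
        case True
        then obtain v where v: "vs = [v]" "v \<in> fibre E p" by (cases vs) auto
        obtain X where "X \<in> Sec M E" "X p = v" using section_through[OF v(2)] .
        then show ?thesis using \<psi> \<phi>_eq v(1) by metis
      next
        case False
        interpret P: alternating_form 1 "fibre E p" "\<psi> p" using form_alternating_form \<psi> by blast
        show ?thesis using P.outside[OF False] False by (auto simp: \<phi>_def)
      qed
    qed
  qed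
qed

end

context lie_algebroid_on
begin

section \<open>The differential in low degrees and first cohomology\<close>

lemma dE_0: "dE E \<omega> [X] p = act E X (\<omega> []) p"
  by (simp add: dE_def nths_Cons_remove)

lemma dE_1: "dE E \<omega> [X, Y] p = act E X (\<omega> [Y]) p - act E Y (\<omega> [X]) p - \<omega> [bracket E X Y] p"
proof -
  have "nths [X, Y] (- {Suc 0}) = [X]" "nths [X, Y] (- {0, Suc 0}) = []"
    unfolding nths_Cons_remove by simp_all
  then show ?thesis by (simp add: dE_def nths_Cons_remove numeral_2_eq_2 lessThan_Suc)
qed

text \<open>A form of degree 0 is a smooth function, stored as the value at the empty list.\<close>

lemma coboundaries_1_iff:
  "\<omega> \<in> coboundaries M E 1 \<longleftrightarrow> \<omega> \<in> forms M E 1 UNIV \<and>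
    (\<exists>F. smooth_fun M UNIV F \<and> (\<forall>X\<in>Sec M E. \<forall>p. \<omega> p [X p] = act E X F p))"
    (is "_ \<longleftrightarrow> _ \<and> ?R")
proof -
  have "(\<exists>\<eta>\<in>forms M E 0 UNIV. \<forall>Xs p. length Xs = 1 \<and> set Xs \<subseteq> Sec M E \<longrightarrow>
      ev \<omega> Xs p = dE E (ev \<eta>) Xs p) \<longleftrightarrow> ?R" (is "?L \<longleftrightarrow> _")
  proof
    assume ?L
    then obtain \<eta> where \<eta>: "\<eta> \<in> forms M E 0 UNIV"
      "\<And>Xs p. length Xs = 1 \<Longrightarrow> set Xs \<subseteq> Sec M E \<Longrightarrow> ev \<omega> Xs p = dE E (ev \<eta>) Xs p" by blast
    have "smooth_fun M UNIV (ev \<eta> [])" using smooth_fun_ev[OF \<eta>(1)] by simp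
    moreover have "\<omega> p [X p] = act E X (ev \<eta> []) p" if "X \<in> Sec M E" for X p
      using \<eta>(2)[of "[X]" p] that by (simp add: dE_0) (simp add: ev_def)
    ultimately show ?R by blast
  next
    assume ?R
    then obtain F where F: "smooth_fun M UNIV F" "\<And>X p. X \<in> Sec M E \<Longrightarrow> \<omega> p [X p] = act E X F p" by blast
    define \<eta> where "\<eta> p vs = (if vs = [] then F p else 0)" for p and vs :: "'v list"
    have "\<eta> \<in> forms M E 0 UNIV"
      unfolding forms_def alternating_forms_def using F(1)
      by (auto simp: \<eta>_def intro: smooth_fun_subset)
    moreover have "ev \<eta> [] = F" by (simp add: ev_def \<eta>_def fun_eq_iff)
    then have "ev \<omega> Xs p = dE E (ev \<eta>) Xs p" if "length Xs = 1" "set Xs \<subseteq> Sec M E" for Xs p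
      using that F(2) by (auto simp: length_Suc_conv dE_0 ev_def[of \<omega>])
    ultimately show ?L by blast
  qed
  then show ?thesis unfolding coboundaries_def by simp
qed

lemma cohomologous_1_iff:
  "(\<omega>, \<omega>') \<in> cohomologous M E 1 \<longleftrightarrow> \<omega> \<in> cocycles M E 1 \<and> \<omega>' \<in> cocycles M E 1 \<and>
    (\<exists>F. smooth_fun M UNIV F \<and> (\<forall>X\<in>Sec M E. \<forall>p. \<omega> p [X p] - \<omega>' p [X p] = act E X F p))"
proof -
  have "(\<lambda>p vs. \<omega> p vs - \<omega>' p vs) \<in> forms M E 1 UNIV" if "\<omega> \<in> cocycles M E 1" "\<omega>' \<in> cocycles M E 1"
    using that forms_diff[of UNIV \<omega> 1 \<omega>'] unfolding cocycles_def by simp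
  then show ?thesis unfolding cohomologous_def coboundaries_1_iff by blast
qed

lemma act_diff:
  assumes "X \<in> Sec M E" "smooth_fun M UNIV F" "smooth_fun M UNIV G"
  shows "act E X (\<lambda>q. F q - G q) p = act E X F p - act E X G p"
proof -
  have "smooth_near M p F" "smooth_near M p G"
    using assms unfolding smooth_near_def by blast+
  then show ?thesis unfolding act_def by (rule tangent_diff[OF anchor_tangent[OF assms(1)]])
qed

text \<open>Together with reflexivity on cocycles this Euclidean property gives symmetry and
  transitivity, which is what equality of classes requires.\<close>

lemma cohomologous_1_common:
  assumes "(\<omega>, \<omega>1) \<in> cohomologous M E 1" "(\<omega>, \<omega>2) \<in> cohomologous M E 1"
  shows "(\<omega>1, \<omega>2) \<in> cohomologous M E 1"
proof -
  obtain F G where F: "smooth_fun M UNIV F" "\<And>X p. X \<in> Sec M E \<Longrightarrow> \<omega> p [X p] - \<omega>1 p [X p] = act E X F p"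
    and G: "smooth_fun M UNIV G" "\<And>X p. X \<in> Sec M E \<Longrightarrow> \<omega> p [X p] - \<omega>2 p [X p] = act E X G p"
    using assms unfolding cohomologous_1_iff by blast
  have "\<omega>1 p [X p] - \<omega>2 p [X p] = act E X (\<lambda>q. G q - F q) p" if "X \<in> Sec M E" for X p
    using F(2)[OF that, of p] G(2)[OF that, of p] act_diff[OF that G(1) F(1), of p] by simp
  moreover have "smooth_fun M UNIV (\<lambda>q. G q - F q)" using F(1) G(1) by (intro smooth_fun_diff) auto
  ultimately show ?thesis using assms unfolding cohomologous_1_iff by blast
qed

lemma cohomologous_1_refl: "\<omega> \<in> cocycles M E 1 \<Longrightarrow> (\<omega>, \<omega>) \<in> cohomologous M E 1"
  unfolding cohomologous_1_iff
  using tangent_const[OF anchor_tangent] by (intro conjI exI[of _ "\<lambda>q. 0"]) (auto simp: act_def smooth_fun_const)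

lemma cohomology_class_1_eq:
  assumes "(\<omega>, \<omega>') \<in> cohomologous M E 1"
  shows "cohomology_class M E 1 \<omega> = cohomology_class M E 1 \<omega>'"
proof -
  have "(\<omega>', \<omega>) \<in> cohomologous M E 1"
    using assms cohomologous_1_common[OF assms cohomologous_1_refl] unfolding cohomologous_1_iff by blast
  then show ?thesis
    unfolding cohomology_class_def using assms cohomologous_1_common by blast
qed

text \<open>Supplies a class to name when no modular form is at hand.\<close>

lemma zero_cocycle: "(\<lambda>p vs. 0) \<in> cocycles M E 1"
  unfolding cocycles_def
proof (intro CollectI conjI allI impI)
  fix Xs :: "('m \<Rightarrow> 'v) list" and p assume "length Xs = Suc 1 \<and> set Xs \<subseteq> Sec M E"
  then obtain X Y where Xs: "Xs = [X, Y]" "X \<in> Sec M E" "Y \<in> Sec M E"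
    by (auto simp: length_Suc_conv)
  have "ev (\<lambda>p vs. 0) Zs = (\<lambda>q::'m. 0)" for Zs :: "('m \<Rightarrow> 'v) list" by (simp add: ev_def fun_eq_iff)
  then show "dE E (ev (\<lambda>p vs. 0)) Xs p = 0"
    unfolding Xs dE_1 act_def
    using tangent_const[OF anchor_tangent[OF Xs(2)]] tangent_const[OF anchor_tangent[OF Xs(3)]] by simp
qed (rule forms_zero)

end

section \<open>The modular class of a morphism\<close>

locale algebroid_morphism_on = E1: lie_algebroid_on M E1 + E2: lie_algebroid_on M E2
  for M :: "'m::{t2_space, second_countable_topology} smooth_structure"
    and E1 :: "('m, 'v::real_vector) algebroid" and E2 :: "('m, 'w::real_vector) algebroid" +
  fixes \<kappa> :: "'m \<Rightarrow> 'v \<Rightarrow> 'w"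
  assumes morphism: "lie_algebroid_morphism M E1 E2 \<kappa>"
begin

lemmas morphism_axioms = morphism[unfolded lie_algebroid_morphism_def]
lemmas morphism_lincomb = morphism_axioms[THEN conjunct2, THEN conjunct1, rule_format]
lemmas morphism_anchor =
  morphism_axioms[THEN conjunct2, THEN conjunct2, THEN conjunct2, THEN conjunct1, rule_format]
lemmas morphism_bracket =
  morphism_axioms[THEN conjunct2, THEN conjunct2, THEN conjunct2, THEN conjunct2, rule_format]

lemma morphism_frame:
  assumes "(U, e) \<in> frames E1" "i < rank E1"
  shows "(\<lambda>p. \<kappa> p (e i p)) \<in> sections M E2 U"
  using bspec[OF morphism_axioms[THEN conjunct2, THEN conjunct2, THEN conjunct1] assms(1)] assms(2) by simp

lemma morphism_sum:
  "(\<And>i. i \<in> I \<Longrightarrow> v i \<in> fibre E1 p) \<Longrightarrow> \<kappa> p (\<Sum>i\<in>I. c i *\<^sub>R v i) = (\<Sum>i\<in>I. c i *\<^sub>R \<kappa> p (v i))"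
proof (induction I rule: infinite_finite_induct)
  case (insert j I)
  have "(\<Sum>i\<in>I. c i *\<^sub>R v i) \<in> fibre E1 p"
    using insert.prems by (auto intro!: subspace_sum[OF E1.subspace_fibre] subspace_scale[OF E1.subspace_fibre])
  then show ?case
    using insert morphism_lincomb[of "v j" p "\<Sum>i\<in>I. c i *\<^sub>R v i" "c j" 1] by simp
qed (use morphism_lincomb[OF subspace_0[OF E1.subspace_fibre] subspace_0[OF E1.subspace_fibre], of p 0 0] in auto)

text \<open>A morphism is required to be smooth on local frames only. Expanding \<open>X\<close> in
  a frame carries this over to global sections, to which a divergence of \<open>E2\<close> can be
  applied.\<close>

lemma morphism_section:
  assumes X: "X \<in> Sec M E1"
  shows "(\<lambda>p. \<kappa> p (X p)) \<in> Sec M E2"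
proof (rule E2.sections_local)
  fix p :: 'm
  obtain U e where fr: "(U, e) \<in> frames E1" "p \<in> U" using E1.frame_at .
  have U: "open U" by (rule E1.frame_open[OF fr(1)])
  have "(\<lambda>q. \<Sum>i<rank E1. E1.coord e q (X q) i *\<^sub>R \<kappa> q (e i q)) \<in> sections M E2 U"
    by (intro E2.sections_sum U morphism_frame[OF fr(1)])
      (use E1.smooth_fun_coord[OF X _ fr(1)] in auto)
  then have "(\<lambda>q. \<kappa> q (X q)) \<in> sections M E2 U"
  proof (rule E2.sections_cong[OF _ U])
    fix q assume q: "q \<in> U"
    have "X q = (\<Sum>i<rank E1. E1.coord e q (X q) i *\<^sub>R e i q)"
      using E1.coord_eq[OF fr(1) q] E1.sections_in_fibre[OF X] by blast
    moreover have "\<kappa> q (\<Sum>i<rank E1. E1.coord e q (X q) i *\<^sub>R e i q)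
        = (\<Sum>i<rank E1. E1.coord e q (X q) i *\<^sub>R \<kappa> q (e i q))"
      by (rule morphism_sum) (use E1.frame_in_fibre[OF fr(1) _ q] in auto)
    ultimately show "(\<Sum>i<rank E1. E1.coord e q (X q) i *\<^sub>R \<kappa> q (e i q)) = \<kappa> q (X q)"
      by simp
  qed
  then show "\<exists>U'. open U' \<and> p \<in> U' \<and> (\<lambda>p. \<kappa> p (X p)) \<in> sections M E2 U'" using U fr(2) by blast
qed simp

lemma act_morphism: "X \<in> Sec M E1 \<Longrightarrow> act E2 (\<lambda>p. \<kappa> p (X p)) f p = act E1 X f p"
  unfolding act_def using morphism_anchor E1.sections_in_fibre by simp

lemma Div0_E1: "dv \<in> Div0 M E1 \<Longrightarrow> \<exists>vol. divergence_on M E1 vol dv"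
  and Div0_E2: "dv' \<in> Div0 M E2 \<Longrightarrow> \<exists>vol. divergence_on M E2 vol dv'"
  unfolding Div0_def divergence_on_def divergence_on_axioms_def
  using E1.lie_algebroid_on_axioms E2.lie_algebroid_on_axioms by blast+

context
  fixes div1 div2
  assumes div1: "div1 \<in> Div0 M E1" and div2: "div2 \<in> Div0 M E2"
begin

text \<open>Both divergences produce a Leibniz term when \<open>X\<close> is multiplied by
  \<open>f\<close>. Since \<open>\<kappa>\<close> intertwines the anchors, these terms are equal and
  cancel in the difference, which is therefore linear over functions.\<close>

lemma modular_form_exists_unique: "\<exists>!\<phi>. modular_form M E1 \<kappa> div1 div2 \<phi>"
proof -
  obtain vol1 where "divergence_on M E1 vol1 div1" using Div0_E1[OF div1] by blast
  then interpret D1: divergence_on M E1 vol1 div1 .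
  obtain vol2 where "divergence_on M E2 vol2 div2" using Div0_E2[OF div2] by blast
  then interpret D2: divergence_on M E2 vol2 div2 .
  show ?thesis
    unfolding modular_form_def
  proof (rule E1.tensorial_imp_form)
    fix X Y p assume X: "X \<in> Sec M E1" and Y: "Y \<in> Sec M E1"
    have "\<kappa> q (X q + Y q) = 1 *\<^sub>R \<kappa> q (X q) + 1 *\<^sub>R \<kappa> q (Y q)" for q
      using morphism_lincomb[of "X q" q "Y q" 1 1] E1.sections_in_fibre[OF X] E1.sections_in_fibre[OF Y] by simp
    then show "pullback_div \<kappa> div2 (\<lambda>q. X q + Y q) p - div1 (\<lambda>q. X q + Y q) p
      = (pullback_div \<kappa> div2 X p - div1 X p) + (pullback_div \<kappa> div2 Y p - div1 Y p)"
      using D2.div_lincomb[OF morphism_section[OF X] morphism_section[OF Y], of 1 1 p]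
        D1.div_lincomb[OF X Y, of 1 1 p] by (simp add: pullback_div_def)
  next
    fix X f p assume X: "X \<in> Sec M E1" and f: "smooth_fun M UNIV f"
    have "\<kappa> q (f q *\<^sub>R X q) = f q *\<^sub>R \<kappa> q (X q)" for q
      using morphism_lincomb[of "X q" q "X q" "f q" 0] E1.sections_in_fibre[OF X] by simp
    then show "pullback_div \<kappa> div2 (\<lambda>q. f q *\<^sub>R X q) p - div1 (\<lambda>q. f q *\<^sub>R X q) p
      = f p * (pullback_div \<kappa> div2 X p - div1 X p)"
      using D2.div_scale[OF morphism_section[OF X] f, of p] D1.div_scale[OF X f, of p]
      by (simp add: pullback_div_def act_morphism[OF X] algebra_simps)
  next
    fix X assume X: "X \<in> Sec M E1"
    show "smooth_fun M UNIV (\<lambda>p. pullback_div \<kappa> div2 X p - div1 X p)"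
      unfolding pullback_div_def
      by (intro E1.smooth_fun_diff D1.div_smooth D2.div_smooth X morphism_section) simp
  qed
qed

text \<open>Each divergence satisfies the cocycle identity over its own algebroid. As
  \<open>\<kappa>\<close> preserves brackets and anchors, the identity for \<open>div2\<close> pulls
  back to \<open>E1\<close>, and the difference is closed.\<close>

lemma modular_form_cocycle:
  assumes \<phi>: "modular_form M E1 \<kappa> div1 div2 \<phi>"
  shows "\<phi> \<in> cocycles M E1 1"
  unfolding cocycles_def
proof (intro CollectI conjI allI impI)
  show "\<phi> \<in> forms M E1 1 UNIV" using \<phi> unfolding modular_form_def by simp
  fix Xs p assume "length Xs = Suc 1 \<and> set Xs \<subseteq> Sec M E1"
  then obtain X Y where Xs: "Xs = [X, Y]" and X: "X \<in> Sec M E1" and Y: "Y \<in> Sec M E1"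
    by (auto simp: length_Suc_conv)
  obtain vol1 where "divergence_on M E1 vol1 div1" using Div0_E1[OF div1] by blast
  then interpret D1: divergence_on M E1 vol1 div1 .
  obtain vol2 where "divergence_on M E2 vol2 div2" using Div0_E2[OF div2] by blast
  then interpret D2: divergence_on M E2 vol2 div2 .
  let ?k = "\<lambda>X p. \<kappa> p (X p)"
  have ev: "ev \<phi> [Z] = (\<lambda>q. div2 (?k Z) q - div1 Z q)" if "Z \<in> Sec M E1" for Z
    using \<phi> that unfolding modular_form_def pullback_div_def ev_def by auto
  have act: "act E1 V (ev \<phi> [Z]) p = act E2 (?k V) (div2 (?k Z)) p - act E1 V (div1 Z) p"
    if V: "V \<in> Sec M E1" and Z: "Z \<in> Sec M E1" for V Z
    unfolding ev[OF Z] act_morphism[OF V]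
    by (intro E1.act_diff V D1.div_smooth D2.div_smooth morphism_section Z)
  show "dE E1 (ev \<phi>) Xs p = 0"
    unfolding Xs E1.dE_1 act[OF X Y] act[OF Y X] ev[OF E1.bracket_closed[OF X Y]]
      morphism_bracket[OF X Y] D1.div_bracket[OF X Y]
      D2.div_bracket[OF morphism_section[OF X] morphism_section[OF Y]]
    by simp
qed

end

text \<open>The function \<open>F2\<close> comes from \<open>E2\<close>, but the compatibility of
  the anchors turns its derivative along the image of \<open>X\<close> into the derivative along
  \<open>X\<close> in \<open>E1\<close>. Hence \<open>F2 - F1\<close> is a primitive over
  \<open>E1\<close>.\<close>

lemma modular_forms_cohomologous:
  assumes "div1 \<in> Div0 M E1" "div2 \<in> Div0 M E2" "modular_form M E1 \<kappa> div1 div2 \<phi>"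
    and "div1' \<in> Div0 M E1" "div2' \<in> Div0 M E2" "modular_form M E1 \<kappa> div1' div2' \<phi>'"
  shows "(\<phi>, \<phi>') \<in> cohomologous M E1 1"
proof -
  obtain F1 where F1: "smooth_fun M UNIV F1" "\<And>X p. X \<in> Sec M E1 \<Longrightarrow> div1 X p - div1' X p = act E1 X F1 p"
    using Div0_E1[OF assms(1)] Div0_E1[OF assms(4)] E1.divergence_change_of_volume by metis
  obtain F2 where F2: "smooth_fun M UNIV F2" "\<And>X p. X \<in> Sec M E2 \<Longrightarrow> div2 X p - div2' X p = act E2 X F2 p"
    using Div0_E2[OF assms(2)] Div0_E2[OF assms(5)] E2.divergence_change_of_volume by metis
  have "\<phi> p [X p] - \<phi>' p [X p] = act E1 X (\<lambda>q. F2 q - F1 q) p" if X: "X \<in> Sec M E1" for X p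
  proof -
    have "div2 (\<lambda>p. \<kappa> p (X p)) p - div1 X p = \<phi> p [X p]" "div2' (\<lambda>p. \<kappa> p (X p)) p - div1' X p = \<phi>' p [X p]"
      using assms(3,6) X unfolding modular_form_def pullback_div_def by auto
    then show ?thesis
      using F1(2)[OF X, of p] F2(2)[OF morphism_section[OF X], of p] E1.act_diff[OF X F2(1) F1(1), of p]
        act_morphism[OF X, of F2 p] by simp
  qed
  moreover have "smooth_fun M UNIV (\<lambda>q. F2 q - F1 q)"
    using F1(1) F2(1) by (intro E1.smooth_fun_diff) auto
  ultimately show ?thesis
    unfolding E1.cohomologous_1_iff
    using modular_form_cocycle[OF assms(1-3)] modular_form_cocycle[OF assms(4-6)] by blast
qed

end

theorem theorem4p2:
  fixes M :: "'m::{t2_space, second_countable_topology} smooth_structure"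
    and E1 :: "('m, 'v::real_vector) algebroid"
    and E2 :: "('m, 'w::real_vector) algebroid"
    and \<kappa> :: "'m \<Rightarrow> 'v \<Rightarrow> 'w"
  assumes "smooth_manifold M"
    and "lie_algebroid M E1"
    and "lie_algebroid M E2"
    and "lie_algebroid_morphism M E1 E2 \<kappa>"
  shows "(\<forall>div1\<in>Div0 M E1. \<forall>div2\<in>Div0 M E2. \<exists>!\<phi>. modular_form M E1 \<kappa> div1 div2 \<phi>) \<and>
    (\<exists>c\<in>cohomology M E1 1. \<forall>div1\<in>Div0 M E1. \<forall>div2\<in>Div0 M E2. \<forall>\<phi>.
       modular_form M E1 \<kappa> div1 div2 \<phi> \<longrightarrow>
         \<phi> \<in> cocycles M E1 1 \<and> cohomology_class M E1 1 \<phi> = c)"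
proof -
  interpret algebroid_morphism_on M E1 E2 \<kappa>
    using assms by unfold_locales
  have "\<exists>c\<in>cohomology M E1 1. \<forall>div1\<in>Div0 M E1. \<forall>div2\<in>Div0 M E2. \<forall>\<phi>.
       modular_form M E1 \<kappa> div1 div2 \<phi> \<longrightarrow>
         \<phi> \<in> cocycles M E1 1 \<and> cohomology_class M E1 1 \<phi> = c"
  \<comment> \<open>The class \<open>c\<close> has to be named before any divergence is given. If
    some modular form exists, its class is taken; otherwise the universal claim is vacuous and the
    class of zero serves.\<close>
  proof (cases "\<exists>div1\<in>Div0 M E1. \<exists>div2\<in>Div0 M E2. \<exists>\<phi>. modular_form M E1 \<kappa> div1 div2 \<phi>")
    case True
    then obtain div1 div2 \<phi> where d: "div1 \<in> Div0 M E1" "div2 \<in> Div0 M E2" "modular_form M E1 \<kappa> div1 div2 \<phi>"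
      by blast
    have "cohomology_class M E1 1 \<phi> \<in> cohomology M E1 1"
      unfolding cohomology_def cohomology_class_def using modular_form_cocycle[OF d] by (rule quotientI)
    moreover have "\<psi> \<in> cocycles M E1 1 \<and> cohomology_class M E1 1 \<psi> = cohomology_class M E1 1 \<phi>"
      if "div1' \<in> Div0 M E1" "div2' \<in> Div0 M E2" "modular_form M E1 \<kappa> div1' div2' \<psi>" for div1' div2' \<psi>
      using modular_form_cocycle[OF that] E1.cohomology_class_1_eq[OF modular_forms_cohomologous[OF that d]]
      by blast
    ultimately show ?thesis by blast
  next
    case False
    moreover have "cohomology_class M E1 1 (\<lambda>p vs. 0) \<in> cohomology M E1 1"
      unfolding cohomology_def cohomology_class_def using E1.zero_cocycle by (rule quotientI)
    ultimately show ?thesis by blast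
  qed
  then show ?thesis using modular_form_exists_unique by blast
qed

end
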